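(* Let $U\in\mathcal C^2(\mathbb R)$, let $\alpha\in[1,2)$, $V'(x)=-x/|x|^{\alpha+1}$ for $x\ne0$, and let $(\sigma_N)$ be a sequence of nonnegative numbers with $\sigma_N\to0$. Assume either that $\alpha\in(1,2)$ and $U(x)=\frac\lambda2x^2$ with $\lambda>0$, or that $\alpha=1$ and $\sup_{x\in\mathbb R}|U''(x)|<\infty$. For each $N\ge2$ let $(X^1,\dots,X^N)$ be a solution of $$dX^i_t=\sqrt{2\sigma_N}\,dB^i_t-U'(X^i_t)\,dt-\frac1N\sum_{j\ne i}V'(X^i_t-X^j_t)\,dt,\qquad i=1,\dots,N,\quad(\ast)$$ and $\mu^N_t=\frac1N\sum_{i=1}^N\delta_{X^i_t}$. Assume $\mathbb E\,\mathcal W_2(\mu^N_0,\bar\rho_0)^2\to0$ with $\bar\rho_0\in\mathcal P_2(\mathbb R)$, and let the deterministic family $(\bar\rho_t)_{t\ge0}\in\mathcal C(\mathbb R^+,\mathcal P_2(\mathbb R))$ be the limit of $(\mu^N_t)_{t\ge0}$ as $N\to\infty$, in the sense that $\mathbb E\,\mathcal W_2(\mu^N_t,\bar\rho_t)\to0$ for every $t\ge0$. Then for all $f\in\mathcal C^2(\mathbb R)$ with bounded derivatives such that $f$, $f'$, $f'U'$ and $f''$ are Lipschitz continuous and $f'U'$ is bounded, and for all $t\ge0$, $$\int_{\mathbb R} f\,d\bar\rho_t=\int_{\mathbb R} f\,d\bar\rho_0-\int_0^t\!\int_{\mathbb R} f'(x)U'(x)\,\bar\rho_s(dx)\,ds+\frac12\int_0^t\!\iint_{\{x\neq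 y\}}\frac{(f'(x)-f'(y))(x-y)}{|x-y|^{\alpha+1}}\,\bar\rho_s(dx)\,\bar\rho_s(dy)\,ds .$$
   Context: $\mathcal O_N=\{(x_1,\dots,x_N)\in\mathbb R^N:\ x_1<\dots<x_N\}$; the $B^i$ are independent Brownian motions, independent of the initial condition, which lies in $\mathcal O_N$. A solution of $(\ast)$ is a continuous adapted process with values in the closure of $\mathcal O_N$, lying in $\mathcal O_N$ for a.e. $t$, with $\int_0^t|V'(X^i_s-X^j_s)|\,ds<\infty$ a.s. for all $t$ and $i\neq j$, satisfying the integral form of $(\ast)$. $\mathcal P_2(\mathbb R)$ is the set of probability measures on $\mathbb R$ with finite second moment, $\mathcal W_2$ the $L^2$ Wasserstein distance, and $\mathcal C(\mathbb R^+,\mathcal P_2(\mathbb R))$ the continuous functions from $[0,\infty)$ to $(\mathcal P_2(\mathbb R),\mathcal W_2)$. *)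

theory Defs
  imports "HOL-Probability.Probability"
begin

definition P2 :: "real measure set" where
  "P2 = {\<mu>. real_distribution \<mu> \<and> integrable \<mu> (\<lambda>x. x\<^sup>2)}"

definition couplings :: "real measure \<Rightarrow> real measure \<Rightarrow> (real \<times> real) measure set" where
  "couplings \<mu> \<nu> = {\<pi>. sets \<pi> = sets (borel \<Otimes>\<^sub>M borel) \<and> distr \<pi> borel fst = \<mu> \<and> distr \<pi> borel snd = \<nu>}"

text \<open>The infimum below is finite whenever both arguments lie in \<^const>\<open>P2\<close>; outside
  \<^const>\<open>P2\<close> the value of \<open>W2\<close> is meaningless.\<close>

definition W2 :: "real measure \<Rightarrow> real measure \<Rightarrow> real" where
  "W2 \<mu> \<nu> = sqrt (enn2real (INF \<pi>\<in>couplings \<mu> \<nu>. \<integral>\<^sup>+z. ennreal ((fst z - snd z)\<^sup>2) \<partial>\<pi>))"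

definition empirical :: "nat \<Rightarrow> (nat \<Rightarrow> real) \<Rightarrow> real measure" where
  "empirical N x = distr (uniform_count_measure {1..N}) borel x"

text \<open>The empirical measure is the average of the Dirac masses at the points \<open>x i\<close>.\<close>

lemma emeasure_empirical:
  assumes "A \<in> sets borel"
  shows "emeasure (empirical N x) A = ennreal ((\<Sum>i = 1..N. indicator A (x i)) / real N)"
proof -
  have m: "x \<in> measurable (uniform_count_measure {1..N}) borel"
    by (simp add: uniform_count_measure_def measurable_def space_point_measure sets_point_measure)
  have eq: "x -` A \<inter> {Suc 0..N} = {i. Suc 0 \<le> i \<and> i \<le> N \<and> x i \<in> A}"
    by auto
  have sub: "{i. Suc 0 \<le> i \<and> i \<le> N \<and> x i \<in> A} \<subseteq> {1..N}"
    by auto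
  have "emeasure (empirical N x) A = ennreal (real (card {i \<in> {1..N}. x i \<in> A}) / real N)"
    using m assms eq emeasure_uniform_count_measure[OF finite_atLeastAtMost sub]
    unfolding empirical_def
    by (subst emeasure_distr) (simp_all add: space_uniform_count_measure)
  also have "real (card {i \<in> {1..N}. x i \<in> A}) = (\<Sum>i = 1..N. indicator A (x i))"
    by (simp add: indicator_def sum.If_cases Int_def)
  finally show ?thesis .
qed

text \<open>Points of \<open>N\<close>-dimensional space are functions on \<open>nat\<close> of which only the coordinates
  \<open>1, \<dots>, N\<close> matter. Under the product topology on \<open>nat \<Rightarrow> real\<close> the closure of the
  cylinder set \<open>ordered N\<close> is the cylinder over the closure.\<close>

definition ordered :: "nat \<Rightarrow> (nat \<Rightarrow> real) set" where
  "ordered N = {x. strict_mono_on {1..N} x}"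

text \<open>The repulsive force \<open>V'\<close>. Its value at \<open>0\<close> is \<open>0\<close> by convention of division.\<close>

definition V_deriv :: "real \<Rightarrow> real \<Rightarrow> real" where
  "V_deriv \<alpha> x = - x / \<bar>x\<bar> powr (\<alpha> + 1)"

text \<open>Only times \<open>t \<ge> 0\<close> are relevant.\<close>

definition filtration_on :: "'a measure \<Rightarrow> (real \<Rightarrow> 'a measure) \<Rightarrow> bool" where
  "filtration_on M F \<longleftrightarrow>
     (\<forall>t\<ge>0. subalgebra M (F t)) \<and> (\<forall>s t. 0 \<le> s \<and> s \<le> t \<longrightarrow> subalgebra (F t) (F s))"

definition adapted :: "(real \<Rightarrow> 'a measure) \<Rightarrow> (real \<Rightarrow> 'a \<Rightarrow> real) \<Rightarrow> bool" where
  "adapted F Y \<longleftrightarrow> (\<forall>t\<ge>0. Y t \<in> borel_measurable (F t))"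

text \<open>\<open>N\<close> independent standard Brownian motions with respect to the filtration \<open>F\<close>: for
  \<open>0 \<le> s < t\<close> the increments of the \<open>N\<close> components are independent centred Gaussians of variance
  \<open>t - s\<close>, and the vector of increments is independent of \<open>F s\<close>. This makes the processes
  \<open>B i\<close> independent of one another and of every \<open>F 0\<close>-measurable random variable.\<close>

definition independent_brownian_motions ::
    "'a measure \<Rightarrow> (real \<Rightarrow> 'a measure) \<Rightarrow> nat \<Rightarrow> (nat \<Rightarrow> real \<Rightarrow> 'a \<Rightarrow> real) \<Rightarrow> bool" where
  "independent_brownian_motions M F N B \<longleftrightarrow>
     (\<forall>i\<in>{1..N}. adapted F (B i)) \<and>
     (AE \<omega> in M. \<forall>i\<in>{1..N}. B i 0 \<omega> = 0 \<and> continuous_on {0..} (\<lambda>t. B i t \<omega>)) \<and>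
     (\<forall>s t. 0 \<le> s \<and> s < t \<longrightarrow>
        (\<forall>i\<in>{1..N}. distributed M lborel (\<lambda>\<omega>. B i t \<omega> - B i s \<omega>)
                      (\<lambda>x. ennreal (normal_density 0 (sqrt (t - s)) x))) \<and>
        prob_space.indep_vars M (\<lambda>_. borel) (\<lambda>i \<omega>. B i t \<omega> - B i s \<omega>) {1..N} \<and>
        prob_space.indep_set M (sets (F s))
          (sets (vimage_algebra (space M) (\<lambda>\<omega>. \<lambda>i\<in>{1..N}. B i t \<omega> - B i s \<omega>)
                   (\<Pi>\<^sub>M i\<in>{1..N}. borel))))"

text \<open>Solutions on the stochastic basis \<open>(M, F, B)\<close> of the system
  \<open>dX i = sqrt (2 \<sigma>) dB i - U' (X i) dt - (1/N) (\<Sum>j \<noteq> i. V' (X i - X j)) dt\<close>.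
  By adaptedness the initial condition is \<open>F 0\<close>-measurable, hence independent of \<open>B\<close>.\<close>

definition solution ::
    "real \<Rightarrow> (real \<Rightarrow> real) \<Rightarrow> real \<Rightarrow> nat \<Rightarrow> 'a measure \<Rightarrow> (real \<Rightarrow> 'a measure) \<Rightarrow>
     (nat \<Rightarrow> real \<Rightarrow> 'a \<Rightarrow> real) \<Rightarrow> (nat \<Rightarrow> real \<Rightarrow> 'a \<Rightarrow> real) \<Rightarrow> bool" where
  "solution \<alpha> U' \<sigma> N M F B X \<longleftrightarrow>
     prob_space M \<and> filtration_on M F \<and> independent_brownian_motions M F N B \<and>
     (\<forall>i\<in>{1..N}. adapted F (X i)) \<and>
     (AE \<omega> in M. \<forall>i\<in>{1..N}. continuous_on {0..} (\<lambda>t. X i t \<omega>)) \<and>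
     (AE \<omega> in M. (\<lambda>i. X i 0 \<omega>) \<in> ordered N) \<and>
     (AE \<omega> in M. \<forall>t\<ge>0. (\<lambda>i. X i t \<omega>) \<in> closure (ordered N)) \<and>
     (AE \<omega> in M. AE t in lborel. t \<ge> 0 \<longrightarrow> (\<lambda>i. X i t \<omega>) \<in> ordered N) \<and>
     (AE \<omega> in M. \<forall>t\<ge>0. \<forall>i\<in>{1..N}. \<forall>j\<in>{1..N} - {i}.
        set_integrable lborel {0..t} (\<lambda>s. V_deriv \<alpha> (X i s \<omega> - X j s \<omega>))) \<and>
     (AE \<omega> in M. \<forall>t\<ge>0. \<forall>i\<in>{1..N}.
        X i t \<omega> = X i 0 \<omega> + sqrt (2 * \<sigma>) * B i t \<omega>
          - (LBINT s:{0..t}. U' (X i s \<omega>))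
          - 1 / real N * (\<Sum>j\<in>{1..N} - {i}. LBINT s:{0..t}. V_deriv \<alpha> (X i s \<omega> - X j s \<omega>)))"

definition C2_with :: "(real \<Rightarrow> real) \<Rightarrow> (real \<Rightarrow> real) \<Rightarrow> (real \<Rightarrow> real) \<Rightarrow> bool" where
  "C2_with g g' g'' \<longleftrightarrow>
     (\<forall>x. (g has_real_derivative g' x) (at x)) \<and> (\<forall>x. (g' has_real_derivative g'' x) (at x)) \<and>
     continuous_on UNIV g''"

definition lipschitz :: "(real \<Rightarrow> real) \<Rightarrow> bool" where
  "lipschitz g \<longleftrightarrow> (\<exists>L. L-lipschitz_on UNIV g)"

definition interaction_kernel :: "real \<Rightarrow> (real \<Rightarrow> real) \<Rightarrow> real \<times> real \<Rightarrow> real" where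
  "interaction_kernel \<alpha> f' =
     (\<lambda>(x, y). (f' x - f' y) * (x - y) / \<bar>x - y\<bar> powr (\<alpha> + 1))"

definition off_diagonal :: "(real \<times> real) set" where
  "off_diagonal = {(x, y). x \<noteq> y}"

end

theory Submission
  imports Defs
begin

text \<open>
  First, let \<open>Z = (1/N) \<Sum>i. a i * X i\<close> with centred weights \<open>a i\<close> increasing linearly in
  the rank \<open>i\<close>. The repulsion makes \<open>Z\<close> grow at rate
  \<open>S = (1/(2N\<^sup>2)) \<Sum>i j. (\<bar>i - j\<bar>/N) * \<bar>X i - X j\<bar> powr (-\<alpha>)\<close>, while the confinement is
  Lipschitz. A backward Gronwall argument from the final time therefore bounds the expected time
  integral of \<open>S\<close> uniformly in \<open>N\<close>. In the interpolation
  \<open>d powr (-\<beta>) \<le> r * d powr (-\<alpha>) + r powr (-(\<beta>/(\<alpha> - \<beta>)))\<close> with \<open>r = \<bar>i - j\<bar>/N\<close> the last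
  term has a bounded mean as long as \<open>2 * \<beta> < \<alpha>\<close>, so the Riesz energy of every such order \<open>\<beta>\<close>
  is bounded too. As \<open>\<alpha> < 2\<close>, there is such a \<open>\<beta>\<close> above the order \<open>\<alpha> - 1\<close> of the
  singularity of the kernel, and the contribution of close pairs is uniformly small.

  Second, only the expectation of the evolution of \<open>f\<close> matters, because the limit is
  deterministic. The noise is additive, hence it can be separated on a partition of the time
  interval, where it contributes \<open>O(\<sigma> N)\<close> in expectation.
\<close>

section \<open>Wasserstein distance and Lipschitz functionals\<close>

text \<open>The obstacle is that the kernel is not continuous at the diagonal, while
  \<open>lim\<close> speaks of each time separately and controls Lipschitz functionals only. So
  close pairs must be controlled uniformly in \<open>N\<close>, without any moment bound that is
  uniform in time. The growth rate of \<open>Z\<close> is bounded from below by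
  \<open>S - K * Z\<close>; a bound from above would presuppose one on \<open>S\<close>, so a
  forward estimate is circular. At the final time, however, \<open>Z\<close> is at most the mean of
  the absolute positions, a Lipschitz functional whose expectation converges. The weights follow the
  ranks because the order then gives all pairs the same sign in \<open>S\<close>, without
  cancellation. The price is the damping factor of neighbouring ranks; removing it by interpolation
  halves the order of the energy that remains under control. Truncated kernels vanish on the
  diagonal together with the kernel itself, so the diagonal excluded in the theorem contributes
  nothing at any stage, whether or not the limit has atoms.\<close>

lemma (in prob_space) expectation_abs_le_sqrt:
  fixes h :: "'a \<Rightarrow> real"
  assumes [measurable]: "h \<in> borel_measurable M" and sq: "integrable M (\<lambda>x. (h x)\<^sup>2)"
  shows "integrable M h" and "expectation (\<lambda>x. \<bar>h x\<bar>) \<le> sqrt (expectation (\<lambda>x. (h x)\<^sup>2))"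
proof -
  show i: "integrable M h"
    by (rule square_integrable_imp_integrable) (use sq in auto)
  have "(expectation (\<lambda>x. \<bar>h x\<bar>))\<^sup>2 \<le> expectation (\<lambda>x. \<bar>h x\<bar>\<^sup>2)"
  proof -
    have "integrable M (\<lambda>x. \<bar>h x\<bar>)" "integrable M (\<lambda>x. \<bar>h x\<bar>\<^sup>2)" using i sq by simp_all
    from variance_eq[OF this] variance_positive[of "\<lambda>x. \<bar>h x\<bar>"] show ?thesis by linarith
  qed
  then show "expectation (\<lambda>x. \<bar>h x\<bar>) \<le> sqrt (expectation (\<lambda>x. (h x)\<^sup>2))"
    by (simp add: real_le_rsqrt)
qed

lemma P2_D:
  assumes "\<mu> \<in> P2"
  shows "prob_space \<mu>" "sets \<mu> = sets borel" "space \<mu> = UNIV" "integrable \<mu> (\<lambda>x. x\<^sup>2)"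
proof -
  from assms have r: "real_distribution \<mu>" and i: "integrable \<mu> (\<lambda>x. x\<^sup>2)" by (auto simp: P2_def)
  interpret real_distribution \<mu> by (rule r)
  show "prob_space \<mu>" "sets \<mu> = sets borel" "space \<mu> = UNIV" "integrable \<mu> (\<lambda>x. x\<^sup>2)"
    using i prob_space_axioms by simp_all
qed

lemma lipschitz_borel_measurable:
  fixes g :: "real \<Rightarrow> real"
  assumes "L-lipschitz_on UNIV g"
  shows "g \<in> borel_measurable borel"
  using lipschitz_on_continuous_on[OF assms] by (simp add: borel_measurable_continuous_onI)

lemma P2_integrable_lipschitz:
  fixes g :: "real \<Rightarrow> real"
  assumes \<mu>: "\<mu> \<in> P2" and g: "L-lipschitz_on UNIV g"
  shows "integrable \<mu> g"
proof -
  interpret prob_space \<mu> using P2_D[OF \<mu>] by simp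
  note [measurable_cong] = P2_D(2)[OF \<mu>]
  have "integrable \<mu> (\<lambda>x. x)"
    by (rule expectation_abs_le_sqrt(1)) (use P2_D[OF \<mu>] in auto)
  then have "integrable \<mu> (\<lambda>x. \<bar>g 0\<bar> + L * \<bar>x\<bar>)" by simp
  moreover have "g \<in> borel_measurable \<mu>"
    using lipschitz_borel_measurable[OF g] by measurable
  moreover have "\<bar>g x\<bar> \<le> \<bar>g 0\<bar> + L * \<bar>x\<bar>" for x
    using lipschitz_onD[OF g, of x 0] by (auto simp: dist_real_def)
  then have "AE x in \<mu>. norm (g x) \<le> norm (\<bar>g 0\<bar> + L * \<bar>x\<bar>)"
    by (intro AE_I2) (simp add: order_trans[OF _ abs_ge_self])
  ultimately show ?thesis by (rule Bochner_Integration.integrable_bound)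
qed

lemma W2_nonneg: "0 \<le> W2 \<mu> \<nu>"
  by (simp add: W2_def)

text \<open>Jensen's inequality under the coupling. The estimate is squared and stated in extended
  reals because the infimum in \<open>W2\<close> ranges over all couplings, including those of
  infinite cost.\<close>

lemma coupling_lipschitz:
  fixes g :: "real \<Rightarrow> real"
  assumes \<mu>: "\<mu> \<in> P2" and \<nu>: "\<nu> \<in> P2" and g: "L-lipschitz_on UNIV g"
    and \<pi>: "\<pi> \<in> couplings \<mu> \<nu>"
  shows "ennreal (((LINT x|\<mu>. g x) - (LINT x|\<nu>. g x))\<^sup>2)
    \<le> ennreal (L\<^sup>2) * (\<integral>\<^sup>+z. ennreal ((fst z - snd z)\<^sup>2) \<partial>\<pi>)"
proof (cases "(\<integral>\<^sup>+z. ennreal ((fst z - snd z)\<^sup>2) \<partial>\<pi>) = \<infinity>")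
  case True
  \<comment> \<open>In extended reals \<open>0 * \<infinity> = 0\<close>, so for
    \<open>L = 0\<close> the right side vanishes even at infinite cost; then \<open>g\<close> is
    constant and the left side vanishes too.\<close>
  show ?thesis
  proof (cases "L = 0")
    case True
    have "g x = g 0" for x
      using lipschitz_onD[OF g, of x 0] True by simp
    then have g0: "g = (\<lambda>_. g 0)" by auto
    have "(LINT x|\<kappa>. g x) = g 0" if "\<kappa> \<in> P2" for \<kappa>
      using prob_space.prob_space[OF P2_D(1)[OF that]] by (subst g0) simp
    then show ?thesis using \<mu> \<nu> by simp
  next
    case False
    then have "ennreal (L\<^sup>2) \<noteq> 0" by simp
    then have "ennreal (L\<^sup>2) * \<infinity> = \<infinity>" by (simp add: ennreal_mult_eq_top_iff)
    then show ?thesis using True by simp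
  qed
next
  case False
  have s\<pi>: "sets \<pi> = sets (borel \<Otimes>\<^sub>M borel)" and d1: "distr \<pi> borel fst = \<mu>" and d2: "distr \<pi> borel snd = \<nu>"
    using \<pi> by (auto simp: couplings_def)
  note [measurable_cong] = s\<pi>
  have m1[measurable]: "fst \<in> measurable \<pi> borel" and m2[measurable]: "snd \<in> measurable \<pi> borel"
    by (measurable, measurable)
  \<comment> \<open>\<open>couplings\<close> does not ask for total mass 1; it is inherited from the
    first marginal.\<close>
  interpret prob_space \<pi>
    by (rule prob_space_distrD[OF m1]) (use d1 P2_D[OF \<mu>] in simp)
  note g_meas[measurable] = lipschitz_borel_measurable[OF g]
  have sq: "integrable \<pi> (\<lambda>z. (fst z - snd z)\<^sup>2)"
    using False by (intro integrableI_nonneg) (auto simp: top.not_eq_extremum)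
  note A = expectation_abs_le_sqrt[OF _ sq]
  have i1: "integrable \<pi> (\<lambda>z. g (fst z))" and i2: "integrable \<pi> (\<lambda>z. g (snd z))"
    using P2_integrable_lipschitz[OF \<mu> g] P2_integrable_lipschitz[OF \<nu> g]
    by (simp_all add: d1[symmetric] d2[symmetric] integrable_distr_eq)
  have L: "0 \<le> L" by (rule lipschitz_on_nonneg[OF g])
  have "\<bar>(LINT x|\<mu>. g x) - (LINT x|\<nu>. g x)\<bar> = \<bar>expectation (\<lambda>z. g (fst z) - g (snd z))\<bar>"
    using i1 i2 by (simp add: d1[symmetric] d2[symmetric] integral_distr)
  also have "\<dots> \<le> expectation (\<lambda>z. \<bar>g (fst z) - g (snd z)\<bar>)"
    by (rule integral_abs_bound)
  also have "\<dots> \<le> expectation (\<lambda>z. L * \<bar>fst z - snd z\<bar>)"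
    using i1 i2 A lipschitz_onD[OF g]
    by (intro integral_mono) (auto simp: dist_real_def)
  also have "\<dots> \<le> L * sqrt (expectation (\<lambda>z. (fst z - snd z)\<^sup>2))"
    using A(2) L by (auto intro!: mult_left_mono)
  finally have "((LINT x|\<mu>. g x) - (LINT x|\<nu>. g x))\<^sup>2 \<le> (L * sqrt (expectation (\<lambda>z. (fst z - snd z)\<^sup>2)))\<^sup>2"
    by (metis abs_ge_zero power2_abs power_mono)
  also have "\<dots> = L\<^sup>2 * expectation (\<lambda>z. (fst z - snd z)\<^sup>2)"
    by (simp add: power_mult_distrib)
  finally show ?thesis
    by (subst nn_integral_eq_integral[OF sq]) (auto simp: ennreal_mult[symmetric])
qed

text \<open>A coupling of finite cost makes the infimum in \<open>W2\<close> finite and its index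
  set nonempty, so that \<open>enn2real\<close> does not collapse it to 0.\<close>

lemma product_coupling:
  assumes \<mu>: "\<mu> \<in> P2" and \<nu>: "\<nu> \<in> P2"
  shows "\<mu> \<Otimes>\<^sub>M \<nu> \<in> couplings \<mu> \<nu>"
    and "(\<integral>\<^sup>+z. ennreal ((fst z - snd z)\<^sup>2) \<partial>(\<mu> \<Otimes>\<^sub>M \<nu>)) < \<infinity>"
proof -
  interpret \<mu>: prob_space \<mu> using P2_D[OF \<mu>] by simp
  interpret \<nu>: prob_space \<nu> using P2_D[OF \<nu>] by simp
  interpret pair_prob_space \<mu> \<nu> ..
  note [measurable_cong] = P2_D(2)[OF \<mu>] P2_D(2)[OF \<nu>]
  have f: "fst \<in> measurable (\<mu> \<Otimes>\<^sub>M \<nu>) borel" "snd \<in> measurable (\<mu> \<Otimes>\<^sub>M \<nu>) borel"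
    by (measurable, measurable)
  have "distr (\<mu> \<Otimes>\<^sub>M \<nu>) borel fst = \<mu>"
  proof (rule measure_eqI)
    show "sets (distr (\<mu> \<Otimes>\<^sub>M \<nu>) borel fst) = sets \<mu>" using P2_D[OF \<mu>] by simp
    fix A assume "A \<in> sets (distr (\<mu> \<Otimes>\<^sub>M \<nu>) borel fst)"
    then have A: "A \<in> sets borel" "A \<in> sets \<mu>" using P2_D[OF \<mu>] by auto
    have "fst -` A \<inter> space (\<mu> \<Otimes>\<^sub>M \<nu>) = A \<times> space \<nu>"
      using P2_D[OF \<mu>] by (auto simp: space_pair_measure)
    then show "emeasure (distr (\<mu> \<Otimes>\<^sub>M \<nu>) borel fst) A = emeasure \<mu> A"
      using A f by (subst emeasure_distr)
        (auto simp: \<nu>.emeasure_pair_measure_Times \<nu>.emeasure_space_1)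
  qed
  moreover have "distr (\<mu> \<Otimes>\<^sub>M \<nu>) borel snd = \<nu>"
  proof (rule measure_eqI)
    show "sets (distr (\<mu> \<Otimes>\<^sub>M \<nu>) borel snd) = sets \<nu>" using P2_D[OF \<nu>] by simp
    fix A assume "A \<in> sets (distr (\<mu> \<Otimes>\<^sub>M \<nu>) borel snd)"
    then have A: "A \<in> sets borel" "A \<in> sets \<nu>" using P2_D[OF \<nu>] by auto
    have "snd -` A \<inter> space (\<mu> \<Otimes>\<^sub>M \<nu>) = space \<mu> \<times> A"
      using P2_D[OF \<nu>] by (auto simp: space_pair_measure)
    then show "emeasure (distr (\<mu> \<Otimes>\<^sub>M \<nu>) borel snd) A = emeasure \<nu> A"
      using A f by (subst emeasure_distr)
        (auto simp: \<nu>.emeasure_pair_measure_Times \<mu>.emeasure_space_1)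
  qed
  moreover have "sets (\<mu> \<Otimes>\<^sub>M \<nu>) = sets (borel \<Otimes>\<^sub>M borel)"
    by (rule sets_pair_measure_cong) (use P2_D[OF \<mu>] P2_D[OF \<nu>] in auto)
  ultimately show "\<mu> \<Otimes>\<^sub>M \<nu> \<in> couplings \<mu> \<nu>" by (simp add: couplings_def)
  have fin: "(\<integral>\<^sup>+x. ennreal (x\<^sup>2) \<partial>\<mu>) < \<infinity>" "(\<integral>\<^sup>+x. ennreal (x\<^sup>2) \<partial>\<nu>) < \<infinity>"
    using P2_D(4)[OF \<mu>] P2_D(4)[OF \<nu>] by (auto simp: integrable_iff_bounded)
  have "(\<integral>\<^sup>+z. ennreal ((fst z - snd z)\<^sup>2) \<partial>(\<mu> \<Otimes>\<^sub>M \<nu>))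
      \<le> (\<integral>\<^sup>+z. 2 * ennreal ((fst z)\<^sup>2) + 2 * ennreal ((snd z)\<^sup>2) \<partial>(\<mu> \<Otimes>\<^sub>M \<nu>))"
  proof (rule nn_integral_mono)
    fix z :: "real \<times> real"
    have "(fst z - snd z)\<^sup>2 \<le> 2 * (fst z)\<^sup>2 + 2 * (snd z)\<^sup>2"
      using zero_le_power2[of "fst z + snd z"] by (simp add: power2_eq_square algebra_simps)
    then have "ennreal ((fst z - snd z)\<^sup>2) \<le> ennreal (2 * (fst z)\<^sup>2 + 2 * (snd z)\<^sup>2)"
      by (rule ennreal_leI)
    then show "ennreal ((fst z - snd z)\<^sup>2) \<le> 2 * ennreal ((fst z)\<^sup>2) + 2 * ennreal ((snd z)\<^sup>2)"
      by (simp add: ennreal_plus ennreal_mult)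
  qed
  also have "\<dots> = 2 * (\<integral>\<^sup>+x. ennreal (x\<^sup>2) \<partial>\<mu>) + 2 * (\<integral>\<^sup>+x. ennreal (x\<^sup>2) \<partial>\<nu>)"
    by (simp add: nn_integral_add nn_integral_cmult \<nu>.nn_integral_fst[symmetric]
        \<mu>.emeasure_space_1 \<nu>.emeasure_space_1)
  also have "\<dots> < \<infinity>"
    using fin by (simp add: ennreal_mult_less_top)
  finally show "(\<integral>\<^sup>+z. ennreal ((fst z - snd z)\<^sup>2) \<partial>(\<mu> \<Otimes>\<^sub>M \<nu>)) < \<infinity>" .
qed

text \<open>The easy half of Kantorovich-Rubinstein duality combined with the comparison of the
  first and second order distances. This is the only access to \<open>W2\<close> in what
  follows.\<close>

lemma W2_lipschitz:
  fixes g :: "real \<Rightarrow> real"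
  assumes \<mu>: "\<mu> \<in> P2" and \<nu>: "\<nu> \<in> P2" and g: "L-lipschitz_on UNIV g"
  shows "\<bar>(LINT x|\<mu>. g x) - (LINT x|\<nu>. g x)\<bar> \<le> L * W2 \<mu> \<nu>"
proof -
  define I where "I = (INF \<pi>\<in>couplings \<mu> \<nu>. \<integral>\<^sup>+z. ennreal ((fst z - snd z)\<^sup>2) \<partial>\<pi>)"
  define D where "D = \<bar>(LINT x|\<mu>. g x) - (LINT x|\<nu>. g x)\<bar>"
  have L: "0 \<le> L" by (rule lipschitz_on_nonneg[OF g])
  have "I \<le> (\<integral>\<^sup>+z. ennreal ((fst z - snd z)\<^sup>2) \<partial>(\<mu> \<Otimes>\<^sub>M \<nu>))"
    unfolding I_def by (rule INF_lower[OF product_coupling(1)[OF \<mu> \<nu>]])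
  then have I_fin: "I < \<infinity>" using product_coupling(2)[OF \<mu> \<nu>] by (rule order_le_less_trans)
  have C: "couplings \<mu> \<nu> \<noteq> {}" using product_coupling(1)[OF \<mu> \<nu>] by blast
  have "ennreal (D\<^sup>2) \<le> ennreal (L\<^sup>2) * I"
  proof (cases "L = 0")
    case True
    then show ?thesis
      using coupling_lipschitz[OF \<mu> \<nu> g product_coupling(1)[OF \<mu> \<nu>]] by (simp add: D_def)
  next
    case False
    then have *: "ennreal (1 / L\<^sup>2) * (ennreal (L\<^sup>2) * c) = c" for c
      by (simp add: mult.assoc[symmetric] ennreal_mult[symmetric])
    \<comment> \<open>\<open>INF_greatest\<close> bounds the bare infimum, so the Lipschitz factor
      is first moved to the other side; hence the separate case \<open>L = 0\<close>.\<close>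
    have "ennreal (1 / L\<^sup>2) * ennreal (D\<^sup>2) \<le> I"
      unfolding I_def D_def
    proof (rule INF_greatest)
      fix \<pi> assume "\<pi> \<in> couplings \<mu> \<nu>"
      from mult_left_mono[OF coupling_lipschitz[OF \<mu> \<nu> g this], of "ennreal (1 / L\<^sup>2)"]
      show "ennreal (1 / L\<^sup>2) * ennreal (\<bar>integral\<^sup>L \<mu> g - integral\<^sup>L \<nu> g\<bar>\<^sup>2)
          \<le> (\<integral>\<^sup>+z. ennreal ((fst z - snd z)\<^sup>2) \<partial>\<pi>)"
        by (simp add: *)
    qed
    then have "ennreal (L\<^sup>2) * (ennreal (1 / L\<^sup>2) * ennreal (D\<^sup>2)) \<le> ennreal (L\<^sup>2) * I"
      by (rule mult_left_mono) simp
    then show ?thesis using False by (simp add: mult.assoc[symmetric] ennreal_mult[symmetric])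
  qed
  also have "\<dots> = ennreal (L\<^sup>2 * enn2real I)"
    using I_fin by (simp add: ennreal_mult ennreal_enn2real)
  finally have "D\<^sup>2 \<le> L\<^sup>2 * enn2real I"
    by (simp add: ennreal_le_iff)
  then have "sqrt (D\<^sup>2) \<le> sqrt (L\<^sup>2 * enn2real I)" by (rule real_sqrt_le_mono)
  then show ?thesis
    using L by (simp add: D_def W2_def I_def real_sqrt_mult)
qed

text \<open>One marginal is replaced at a time: averaging over one variable keeps the Lipschitz
  constant in the other. The two replacements give the factor 2.\<close>

lemma W2_lipschitz_pair:
  fixes g :: "real \<Rightarrow> real \<Rightarrow> real"
  assumes \<mu>: "\<mu> \<in> P2" and \<nu>: "\<nu> \<in> P2"
    and g1: "\<And>y. L-lipschitz_on UNIV (\<lambda>x. g x y)" and g2: "\<And>x. L-lipschitz_on UNIV (g x)"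
  shows "\<bar>(LINT x|\<mu>. LINT y|\<mu>. g x y) - (LINT x|\<nu>. LINT y|\<nu>. g x y)\<bar> \<le> 2 * L * W2 \<mu> \<nu>"
    and "L-lipschitz_on UNIV (\<lambda>x. LINT y|\<mu>. g x y)"
proof -
  have G: "L-lipschitz_on UNIV (\<lambda>x. LINT y|\<kappa>. g x y)" if \<kappa>: "\<kappa> \<in> P2" for \<kappa>
  proof (rule lipschitz_onI)
    fix x x'
    interpret prob_space \<kappa> using P2_D[OF \<kappa>] by simp
    note i = P2_integrable_lipschitz[OF \<kappa> g2]
    have "\<bar>(LINT y|\<kappa>. g x y) - (LINT y|\<kappa>. g x' y)\<bar> = \<bar>LINT y|\<kappa>. g x y - g x' y\<bar>"
      using i by simp
    also have "\<dots> \<le> (LINT y|\<kappa>. \<bar>g x y - g x' y\<bar>)" by (rule integral_abs_bound)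
    also have "\<dots> \<le> (LINT y|\<kappa>. L * \<bar>x - x'\<bar>)"
      using i lipschitz_onD[OF g1, of x x'] by (intro integral_mono) (auto simp: dist_real_def)
    finally show "dist (LINT y|\<kappa>. g x y) (LINT y|\<kappa>. g x' y) \<le> L * dist x x'"
      by (simp add: dist_real_def prob_space)
  qed (use lipschitz_on_nonneg[OF g2] in auto)
  then show "L-lipschitz_on UNIV (\<lambda>x. LINT y|\<mu>. g x y)" using \<mu> .
  interpret prob_space \<mu> using P2_D[OF \<mu>] by simp
  note i = P2_integrable_lipschitz[OF \<mu> G[OF \<mu>]] P2_integrable_lipschitz[OF \<mu> G[OF \<nu>]]
  have "\<bar>(LINT x|\<mu>. LINT y|\<mu>. g x y) - (LINT x|\<mu>. LINT y|\<nu>. g x y)\<bar>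
      = \<bar>LINT x|\<mu>. (LINT y|\<mu>. g x y) - (LINT y|\<nu>. g x y)\<bar>"
    using i by simp
  also have "\<dots> \<le> (LINT x|\<mu>. \<bar>(LINT y|\<mu>. g x y) - (LINT y|\<nu>. g x y)\<bar>)" by (rule integral_abs_bound)
  also have "\<dots> \<le> (LINT x|\<mu>. L * W2 \<mu> \<nu>)"
    using i W2_lipschitz[OF \<mu> \<nu> g2] by (intro integral_mono) auto
  also have "\<dots> = L * W2 \<mu> \<nu>" by (simp add: prob_space)
  finally have "\<bar>(LINT x|\<mu>. LINT y|\<mu>. g x y) - (LINT x|\<mu>. LINT y|\<nu>. g x y)\<bar> \<le> L * W2 \<mu> \<nu>" .
  moreover have "\<bar>(LINT x|\<mu>. LINT y|\<nu>. g x y) - (LINT x|\<nu>. LINT y|\<nu>. g x y)\<bar> \<le> L * W2 \<mu> \<nu>"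
    by (rule W2_lipschitz[OF \<mu> \<nu> G[OF \<nu>]])
  ultimately show "\<bar>(LINT x|\<mu>. LINT y|\<mu>. g x y) - (LINT x|\<nu>. LINT y|\<nu>. g x y)\<bar> \<le> 2 * L * W2 \<mu> \<nu>"
    by linarith
qed

section \<open>Empirical measures\<close>

lemma
  fixes g :: "real \<Rightarrow> real"
  assumes N: "0 < N" and g[measurable]: "g \<in> borel_measurable borel"
  shows integral_empirical: "(LINT z|empirical N x. g z) = (\<Sum>i = 1..N. g (x i)) / N"
    and integrable_empirical: "integrable (empirical N x) g"
proof -
  have m[measurable]: "x \<in> measurable (uniform_count_measure {1..N}) borel"
    by (simp add: uniform_count_measure_def measurable_def space_point_measure sets_point_measure)
  show "(LINT z|empirical N x. g z) = (\<Sum>i = 1..N. g (x i)) / N"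
    unfolding empirical_def using m
    by (subst integral_distr) (auto simp: integral_uniform_count_measure)
  show "integrable (empirical N x) g"
    unfolding empirical_def using m
    by (subst integrable_distr_eq) (auto simp: uniform_count_measure_def integrable_point_measure_finite)
qed

lemma empirical_P2:
  assumes "0 < N" shows "empirical N x \<in> P2"
proof -
  have m: "x \<in> measurable (uniform_count_measure {1..N}) borel"
    by (simp add: uniform_count_measure_def measurable_def space_point_measure sets_point_measure)
  have "prob_space (empirical N x)"
    unfolding empirical_def
    by (rule prob_space.prob_space_distr[OF prob_space_uniform_count_measure m]) (use assms in auto)
  then have "real_distribution (empirical N x)"
    unfolding real_distribution_def real_distribution_axioms_def by (simp add: empirical_def)
  then show ?thesis
    using integrable_empirical[OF assms, of "\<lambda>x. x\<^sup>2"] by (simp add: P2_def)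
qed

section \<open>Gronwall inequalities and rank sums\<close>

text \<open>The discounted primitive of \<open>z\<close> minus the primitive of \<open>h\<close> is
  decreasing, because the discount factor is at most 1 and \<open>h\<close> is nonnegative. It
  bounds the time integral of \<open>z\<close>, which is the quantity wanted, and \<open>z\<close>
  may change sign.\<close>

lemma gronwall_integral:
  fixes z h :: "real \<Rightarrow> real"
  assumes T: "0 \<le> T" and K: "0 \<le> K"
    and z: "continuous_on {0..T} z" and h: "continuous_on {0..T} h" "\<And>s. s \<in> {0..T} \<Longrightarrow> 0 \<le> h s"
    and le: "\<And>s. s \<in> {0..T} \<Longrightarrow> z s \<le> h s + K * integral {0..s} z"
  shows "integral {0..T} z \<le> exp (K * T) * integral {0..T} h"
proof (cases "T = 0")
  case False
  define Q where "Q = (\<lambda>s. exp (- (K * s)) * integral {0..s} z - integral {0..s} h)"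
  have d: "(Q has_real_derivative (exp (- (K * s)) * (z s - K * integral {0..s} z) - h s)) (at s within {0..T})"
    if "s \<in> {0..T}" for s
    unfolding Q_def using integral_has_real_derivative[OF z that] integral_has_real_derivative[OF h(1) that]
    by (auto intro!: derivative_eq_intros simp: algebra_simps)
  have "Q T \<le> Q 0"
  proof (rule DERIV_nonpos_imp_decreasing_open[of 0 T Q])
    show "continuous_on {0..T} Q"
      unfolding continuous_on_eq_continuous_within by (blast intro: DERIV_continuous d)
    fix s assume s: "0 < s" "s < T"
    then have "(Q has_real_derivative (exp (- (K * s)) * (z s - K * integral {0..s} z) - h s)) (at s)"
      using d[of s] at_within_Icc_at[of 0 s T] by auto
    moreover have "exp (- (K * s)) * (z s - K * integral {0..s} z) \<le> 1 * h s"
    proof -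
      have "exp (- (K * s)) * (z s - K * integral {0..s} z) \<le> exp (- (K * s)) * h s"
        using le[of s] s by (intro mult_left_mono) auto
      also have "\<dots> \<le> 1 * h s" using s K h(2)[of s] by (intro mult_right_mono) auto
      finally show ?thesis .
    qed
    ultimately show "\<exists>y. (Q has_real_derivative y) (at s) \<and> y \<le> 0" by fastforce
  qed (use T in auto)
  then have "exp (- (K * T)) * integral {0..T} z \<le> integral {0..T} h" by (simp add: Q_def)
  then have "exp (K * T) * (exp (- (K * T)) * integral {0..T} z) \<le> exp (K * T) * integral {0..T} h"
    by (rule mult_left_mono) simp
  then show ?thesis by (simp add: mult.assoc[symmetric] exp_add[symmetric])
qed simp

text \<open>Time reversal of the preceding argument, for a quantity that is controlled by its value
  at \<open>T\<close> and by its integral over the remaining time. The discount is now normalised at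
  \<open>T\<close>.\<close>

lemma gronwall_integral_backward:
  fixes z h :: "real \<Rightarrow> real"
  assumes T: "0 \<le> T" and K: "0 \<le> K"
    and z: "continuous_on {0..T} z" and h: "continuous_on {0..T} h" "\<And>s. s \<in> {0..T} \<Longrightarrow> 0 \<le> h s"
    and le: "\<And>s. s \<in> {0..T} \<Longrightarrow> z s \<le> h s + K * (integral {0..T} z - integral {0..s} z)"
  shows "integral {0..T} z \<le> exp (K * T) * integral {0..T} h"
proof (cases "T = 0")
  case False
  define Q where "Q = (\<lambda>s. exp (K * (s - T)) * (integral {0..T} z - integral {0..s} z) + integral {0..s} h)"
  have d: "(Q has_real_derivative
      (exp (K * (s - T)) * (K * (integral {0..T} z - integral {0..s} z) - z s) + h s)) (at s within {0..T})"
    if "s \<in> {0..T}" for s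
    unfolding Q_def using integral_has_real_derivative[OF z that] integral_has_real_derivative[OF h(1) that]
    by (auto intro!: derivative_eq_intros simp: algebra_simps)
  have "Q 0 \<le> Q T"
  proof (rule DERIV_nonneg_imp_increasing_open[of 0 T Q])
    show "continuous_on {0..T} Q"
      unfolding continuous_on_eq_continuous_within by (blast intro: DERIV_continuous d)
    fix s assume s: "0 < s" "s < T"
    then have "(Q has_real_derivative
        (exp (K * (s - T)) * (K * (integral {0..T} z - integral {0..s} z) - z s) + h s)) (at s)"
      using d[of s] at_within_Icc_at[of 0 s T] by auto
    moreover have "exp (K * (s - T)) * (z s - K * (integral {0..T} z - integral {0..s} z)) \<le> 1 * h s"
    proof -
      have "exp (K * (s - T)) * (z s - K * (integral {0..T} z - integral {0..s} z)) \<le> exp (K * (s - T)) * h s"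
        using le[of s] s by (intro mult_left_mono) auto
      also have "\<dots> \<le> 1 * h s" using s K h(2)[of s]
        by (intro mult_right_mono) (auto simp: mult_nonneg_nonpos)
      finally show ?thesis .
    qed
    then have "0 \<le> exp (K * (s - T)) * (K * (integral {0..T} z - integral {0..s} z) - z s) + h s"
      by (simp add: algebra_simps)
    ultimately show "\<exists>y. (Q has_real_derivative y) (at s) \<and> 0 \<le> y" by blast
  qed (use T in auto)
  then have "exp (- (K * T)) * integral {0..T} z \<le> integral {0..T} h" by (simp add: Q_def)
  then have "exp (K * T) * (exp (- (K * T)) * integral {0..T} z) \<le> exp (K * T) * integral {0..T} h"
    by (rule mult_left_mono) simp
  then show ?thesis by (simp add: mult.assoc[symmetric] exp_add[symmetric])
qed simp

text \<open>Comparison with the integral of \<open>x powr (- \<gamma>)\<close> over [0, n], whose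
  singularity at 0 is integrable since \<gamma> < 1. The mean value theorem for the primitive takes
  the place of the integral.\<close>

lemma sum_powr_minus_le:
  fixes \<gamma> :: real
  assumes "0 \<le> \<gamma>" "\<gamma> < 1"
  shows "(\<Sum>k = 1..n. real k powr (- \<gamma>)) \<le> real n powr (1 - \<gamma>) / (1 - \<gamma>)"
proof (induction n)
  case (Suc n)
  have "(1 - \<gamma>) * real (Suc n) powr (- \<gamma>) \<le> real (Suc n) powr (1 - \<gamma>) - real n powr (1 - \<gamma>)"
  proof (cases "n = 0")
    case False
    have "\<exists>z. real n < z \<and> z < real (Suc n) \<and>
        real (Suc n) powr (1 - \<gamma>) - real n powr (1 - \<gamma>) = (real (Suc n) - real n) * ((1 - \<gamma>) * z powr (- \<gamma>))"
    proof (rule MVT2)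
      fix x :: real assume "real n \<le> x"
      then have "0 < x" using False by linarith
      from has_real_derivative_powr[OF this, of "1 - \<gamma>"]
      show "((\<lambda>x. x powr (1 - \<gamma>)) has_real_derivative (1 - \<gamma>) * x powr (- \<gamma>)) (at x)" by simp
    qed simp
    then obtain z where z: "real n < z" "z < real (Suc n)"
      "real (Suc n) powr (1 - \<gamma>) - real n powr (1 - \<gamma>) = (1 - \<gamma>) * z powr (- \<gamma>)" by auto
    have "real (Suc n) powr (- \<gamma>) \<le> z powr (- \<gamma>)"
      using z assms by (intro powr_mono2') auto
    then show ?thesis using assms z(3) by (simp add: mult_left_mono)
  qed (use assms in auto)
  then have "real (Suc n) powr (- \<gamma>) \<le> (real (Suc n) powr (1 - \<gamma>) - real n powr (1 - \<gamma>)) / (1 - \<gamma>)"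
    using assms by (simp add: field_simps)
  with Suc show ?case by (simp add: diff_divide_distrib)
qed simp

text \<open>Up to the factor \<open>N\<close> squared this is a Riemann sum for the double integral
  of the same power of the distance over the unit square. Each row consists of the ranks below and
  above \<open>i\<close>, and either half is part of the sum over all distances from 1 to
  \<open>N\<close>, hence the 2.\<close>

lemma sum_sum_powr_distance_le:
  fixes \<gamma> :: real
  assumes \<gamma>: "0 \<le> \<gamma>" "\<gamma> < 1" and N: "0 < N"
  shows "(\<Sum>i = 1..N. \<Sum>j = 1..N. (\<bar>real i - real j\<bar> / N) powr (- \<gamma>)) \<le> 2 * (real N)\<^sup>2 / (1 - \<gamma>)"
proof -
  define c where "c = (\<Sum>k = 1..N. (real k / N) powr (- \<gamma>))"
  have "c = real N powr \<gamma> * (\<Sum>k = 1..N. real k powr (- \<gamma>))"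
    unfolding c_def sum_distrib_left
    by (intro sum.cong) (auto simp: powr_divide powr_minus field_simps)
  also have "\<dots> \<le> real N powr \<gamma> * (real N powr (1 - \<gamma>) / (1 - \<gamma>))"
    by (intro mult_left_mono sum_powr_minus_le \<gamma>) auto
  also have "\<dots> = real N / (1 - \<gamma>)"
    using N by (simp add: powr_add[symmetric])
  finally have c: "c \<le> real N / (1 - \<gamma>)" .
  have inner: "(\<Sum>j = 1..N. (\<bar>real i - real j\<bar> / N) powr (- \<gamma>)) \<le> 2 * c" if i: "i \<in> {1..N}" for i
  proof -
    let ?g = "\<lambda>j. (\<bar>real i - real j\<bar> / N) powr (- \<gamma>)"
    \<comment> \<open>The index \<open>j = i\<close> drops out because
      \<open>0 powr (- \<gamma>) = 0\<close>.\<close>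
    have "{1..N} = insert i ({1..<i} \<union> {i<..N})" using i by auto
    then have "sum ?g {1..N} = sum ?g ({1..<i} \<union> {i<..N})" by simp
    also have "\<dots> = sum ?g {1..<i} + sum ?g {i<..N}" by (rule sum.union_disjoint) auto
    finally have "sum ?g {1..N} = sum ?g {1..<i} + sum ?g {i<..N}" .
    moreover have "sum ?g {1..<i} \<le> c"
    proof -
      have "sum ?g {1..<i} = sum (\<lambda>k. (real k / N) powr (- \<gamma>)) {1..<i}"
        using i by (intro sum.reindex_bij_witness[of _ "\<lambda>k. i - k" "\<lambda>j. i - j"]) auto
      also have "\<dots> \<le> c" unfolding c_def using i by (intro sum_mono2) auto
      finally show ?thesis .
    qed
    moreover have "sum ?g {i<..N} \<le> c"
    proof -
      have "sum ?g {i<..N} = sum (\<lambda>k. (real k / N) powr (- \<gamma>)) {1..N - i}"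
        using i by (intro sum.reindex_bij_witness[of _ "\<lambda>k. i + k" "\<lambda>j. j - i"]) auto
      also have "\<dots> \<le> c" unfolding c_def using i by (intro sum_mono2) auto
      finally show ?thesis .
    qed
    ultimately show ?thesis by simp
  qed
  have "(\<Sum>i = 1..N. \<Sum>j = 1..N. (\<bar>real i - real j\<bar> / N) powr (- \<gamma>)) \<le> (\<Sum>i = 1..N. 2 * c)"
    by (intro sum_mono inner)
  also have "\<dots> = 2 * N * c" by simp
  also have "\<dots> \<le> 2 * N * (real N / (1 - \<gamma>))" using c by (intro mult_left_mono) auto
  finally show ?thesis by (simp add: power2_eq_square)
qed

text \<open>If the first term on the right does not suffice, then
  \<open>r \<le> d powr (\<alpha> - \<beta>)\<close>, which bounds \<open>d\<close> from below by a
  power of \<open>r\<close> and yields the second term.\<close>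

lemma powr_minus_interpolate:
  fixes d r :: real
  assumes "0 < d" "0 < r" "0 < \<beta>" "\<beta> < \<alpha>"
  shows "d powr (- \<beta>) \<le> r * d powr (- \<alpha>) + r powr (- (\<beta> / (\<alpha> - \<beta>)))"
proof (cases "d powr (- \<beta>) \<le> r * d powr (- \<alpha>)")
  case False
  then have "r * d powr (- \<alpha>) * d powr \<alpha> \<le> d powr (- \<beta>) * d powr \<alpha>"
    using assms by (intro mult_right_mono) auto
  then have "r \<le> d powr (\<alpha> - \<beta>)"
    using assms by (simp add: mult.assoc powr_add[symmetric])
  then have "r powr (1 / (\<alpha> - \<beta>)) \<le> (d powr (\<alpha> - \<beta>)) powr (1 / (\<alpha> - \<beta>))"
    using assms by (intro powr_mono2) auto
  then have "r powr (1 / (\<alpha> - \<beta>)) \<le> d"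
    using assms by (simp add: powr_powr)
  then have "d powr (- \<beta>) \<le> (r powr (1 / (\<alpha> - \<beta>))) powr (- \<beta>)"
    using assms by (intro powr_mono2') auto
  then show ?thesis using assms by (simp add: powr_powr add_increasing)
next
  case True
  then show ?thesis by (rule order_trans) simp
qed

text \<open>The diagonal may stay in the sum, as \<open>0 powr p = 0\<close>. For the same reason
  coincident particles would not be seen, so bounds on this energy are applied together with the
  strict order.\<close>

definition riesz_energy :: "nat \<Rightarrow> real \<Rightarrow> (nat \<Rightarrow> real) \<Rightarrow> real" where
  "riesz_energy N \<beta> y = (\<Sum>i = 1..N. \<Sum>j = 1..N. \<bar>y i - y j\<bar> powr (- \<beta>)) / (real N)\<^sup>2"

text \<open>The \<open>S\<close> of the overview. The 2 in the denominator comes from symmetrising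
  the pair forces against the rank weights.\<close>

definition ranked_energy :: "nat \<Rightarrow> real \<Rightarrow> (nat \<Rightarrow> real) \<Rightarrow> real" where
  "ranked_energy N \<alpha> y =
     (\<Sum>i = 1..N. \<Sum>j = 1..N. \<bar>real i - real j\<bar> / N * \<bar>y i - y j\<bar> powr (- \<alpha>)) / (2 * (real N)\<^sup>2)"

lemma ranked_energy_nonneg: "0 \<le> ranked_energy N \<alpha> y"
  by (auto simp: ranked_energy_def intro!: sum_nonneg divide_nonneg_nonneg)

lemma riesz_energy_nonneg: "0 \<le> riesz_energy N \<alpha> y"
  by (auto simp: riesz_energy_def intro!: sum_nonneg divide_nonneg_nonneg)

text \<open>Pairwise interpolation with \<open>r\<close> the rank distance divided by
  \<open>N\<close>. The condition \<open>2 * \<beta> < \<alpha>\<close> is the same as \<gamma> < 1,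
  under which the rank term averages to a constant; the strict order ensures that distinct ranks
  have positive distance.\<close>

lemma riesz_energy_le:
  assumes N: "2 \<le> N" and y: "strict_mono_on {1..N} y" and \<beta>: "0 < \<beta>" "2 * \<beta> < \<alpha>"
  shows "riesz_energy N \<beta> y \<le> 2 * ranked_energy N \<alpha> y + 2 / (1 - \<beta> / (\<alpha> - \<beta>))"
proof -
  define \<gamma> where "\<gamma> = \<beta> / (\<alpha> - \<beta>)"
  have \<gamma>: "0 \<le> \<gamma>" "\<gamma> < 1" using \<beta> by (auto simp: \<gamma>_def)
  have *: "\<bar>y i - y j\<bar> powr (- \<beta>) \<le> \<bar>real i - real j\<bar> / N * \<bar>y i - y j\<bar> powr (- \<alpha>)
      + (\<bar>real i - real j\<bar> / N) powr (- \<gamma>)" if "i \<in> {1..N}" "j \<in> {1..N}" for i j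
  proof (cases "i = j")
    case False
    then have "y i \<noteq> y j" using y that by (metis (no_types) strict_mono_on_eqD)
    then show ?thesis using False N \<beta> unfolding \<gamma>_def by (intro powr_minus_interpolate) auto
  qed simp
  have "(\<Sum>i = 1..N. \<Sum>j = 1..N. \<bar>y i - y j\<bar> powr (- \<beta>)) \<le>
      (\<Sum>i = 1..N. \<Sum>j = 1..N. \<bar>real i - real j\<bar> / N * \<bar>y i - y j\<bar> powr (- \<alpha>)
      + (\<bar>real i - real j\<bar> / N) powr (- \<gamma>))"
    by (intro sum_mono *)
  also have "\<dots> \<le> (\<Sum>i = 1..N. \<Sum>j = 1..N. \<bar>real i - real j\<bar> / N * \<bar>y i - y j\<bar> powr (- \<alpha>))
      + 2 * (real N)\<^sup>2 / (1 - \<gamma>)"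
    using sum_sum_powr_distance_le[OF \<gamma>, of N] N by (simp add: sum.distrib)
  finally have "riesz_energy N \<beta> y \<le> ((\<Sum>i = 1..N. \<Sum>j = 1..N. \<bar>real i - real j\<bar> / N * \<bar>y i - y j\<bar> powr (- \<alpha>))
      + 2 * (real N)\<^sup>2 / (1 - \<gamma>)) / (real N)\<^sup>2"
    unfolding riesz_energy_def by (rule divide_right_mono) simp
  also have "\<dots> = 2 * ranked_energy N \<alpha> y + 2 / (1 - \<gamma>)"
    using N by (simp add: ranked_energy_def add_divide_distrib)
  finally show ?thesis by (simp add: \<gamma>_def)
qed

section \<open>The repulsive force and the rank weights\<close>

lemma V_deriv_minus: "V_deriv \<alpha> (- x) = - V_deriv \<alpha> x"
  by (simp add: V_deriv_def)

lemma V_deriv_0[simp]: "V_deriv \<alpha> 0 = 0"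
  by (simp add: V_deriv_def)

lemma V_deriv_pos: "0 < x \<Longrightarrow> V_deriv \<alpha> x = - (x powr (- \<alpha>))"
  by (simp add: V_deriv_def powr_add powr_minus divide_inverse)

lemma abs_V_deriv: "\<bar>V_deriv \<alpha> x\<bar> = \<bar>x\<bar> powr (- \<alpha>)"
  using V_deriv_pos[of "\<bar>x\<bar>" \<alpha>] V_deriv_minus[of \<alpha> x] by (cases x "0::real" rule: linorder_cases) auto

lemma V_deriv_measurable[measurable]: "V_deriv \<alpha> \<in> borel_measurable borel"
  unfolding V_deriv_def by measurable

text \<open>Action equals reaction: swapping the two indices replaces the weight by half of its
  difference. Applied to the rank weights it reveals the sign of the repulsion; applied to
  \<open>f'\<close> it weakens the singularity by one order.\<close>

lemma sum_antisymmetric: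
  fixes V :: "nat \<Rightarrow> nat \<Rightarrow> real"
  assumes "\<And>i j. V i j = - V j i"
  shows "(\<Sum>i = 1..N. \<Sum>j = 1..N. a i * V i j) = (\<Sum>i = 1..N. \<Sum>j = 1..N. (a i - a j) * V i j) / 2"
proof -
  have "(\<Sum>i = 1..N. \<Sum>j = 1..N. a i * V i j) = (\<Sum>i = 1..N. \<Sum>j = 1..N. a j * V j i)"
    by (rule sum.swap)
  also have "\<dots> = - (\<Sum>i = 1..N. \<Sum>j = 1..N. a j * V i j)"
    by (subst assms) (simp add: sum_negf)
  finally show ?thesis by (simp add: left_diff_distrib sum_subtractf)
qed

text \<open>The rescaled rank \<open>i / N\<close> minus its average
  \<open>(N + 1) / (2 * N)\<close>.\<close>

definition rank_weight :: "nat \<Rightarrow> nat \<Rightarrow> real" where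
  "rank_weight N i = (2 * real i - real N - 1) / (2 * real N)"

lemma abs_rank_weight_le: "i \<in> {1..N} \<Longrightarrow> \<bar>rank_weight N i\<bar> \<le> 1"
  by (auto simp: rank_weight_def field_simps)

lemma rank_weight_diff: "0 < N \<Longrightarrow> rank_weight N i - rank_weight N j = (real i - real j) / N"
  by (simp add: rank_weight_def field_simps)

lemma sum_rank_weight: "sum (rank_weight N) {1..N} = 0"
proof -
  have "(\<Sum>i = 1..N. 2 * real i) = real N * (real N + 1)"
    by (induction N) (auto simp: algebra_simps)
  then have "(\<Sum>i = 1..N. 2 * real i - real N - 1) = 0"
    by (simp add: sum_subtractf algebra_simps)
  then show ?thesis
    by (simp add: rank_weight_def sum_divide_distrib[symmetric])
qed

text \<open>For ordered points the weight difference and the displacement of a pair have the same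
  sign, so all pairs push the weighted sum in one direction.\<close>

lemma sum_rank_weight_V_deriv:
  assumes N: "2 \<le> N" and y: "strict_mono_on {1..N} y"
  shows "(\<Sum>i = 1..N. rank_weight N i * (\<Sum>j = 1..N. V_deriv \<alpha> (y i - y j))) = - ((real N)\<^sup>2 * ranked_energy N \<alpha> y)"
proof -
  have *: "(rank_weight N i - rank_weight N j) * V_deriv \<alpha> (y i - y j)
      = - (\<bar>real i - real j\<bar> / N * \<bar>y i - y j\<bar> powr (- \<alpha>))" if "i \<in> {1..N}" "j \<in> {1..N}" for i j
  proof (cases i j rule: linorder_cases)
    case less
    then have "y i < y j" using strict_mono_onD[OF y] that by blast
    then show ?thesis
      using less N V_deriv_pos[of "y j - y i" \<alpha>] V_deriv_minus[of \<alpha> "y j - y i"]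
      by (simp add: rank_weight_diff field_simps)
  next
    case greater
    then have "y j < y i" using strict_mono_onD[OF y] that by blast
    then show ?thesis using greater N V_deriv_pos[of "y i - y j" \<alpha>] by (simp add: rank_weight_diff)
  qed simp
  have "(\<Sum>i = 1..N. rank_weight N i * (\<Sum>j = 1..N. V_deriv \<alpha> (y i - y j)))
      = (\<Sum>i = 1..N. \<Sum>j = 1..N. (rank_weight N i - rank_weight N j) * V_deriv \<alpha> (y i - y j)) / 2"
    unfolding sum_distrib_left by (rule sum_antisymmetric) (metis V_deriv_minus minus_diff_eq)
  also have "\<dots> = (\<Sum>i = 1..N. \<Sum>j = 1..N. - (\<bar>real i - real j\<bar> / N * \<bar>y i - y j\<bar> powr (- \<alpha>))) / 2"
    by (intro arg_cong[where f="\<lambda>x. x / 2"] sum.cong refl *)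
  also have "\<dots> = - ((real N)\<^sup>2 * ranked_energy N \<alpha> y)"
    using N by (simp add: ranked_energy_def sum_negf)
  finally show ?thesis .
qed

text \<open>A covariance identity: as the weights are centred, the weighted sum depends on
  differences of \<open>z\<close> only.\<close>

lemma sum_rank_weight_symmetrize:
  assumes N: "2 \<le> N"
  shows "(\<Sum>i = 1..N. rank_weight N i * z i) = (\<Sum>i = 1..N. \<Sum>j = 1..N. (real i - real j) * (z i - z j)) / (2 * (real N)\<^sup>2)"
proof -
  have "(\<Sum>i = 1..N. \<Sum>j = 1..N. (real i - real j) * (z i - z j))
     = real N * (\<Sum>i = 1..N. \<Sum>j = 1..N. (rank_weight N i - rank_weight N j) * (z i - z j))"
    using N by (simp add: rank_weight_diff sum_distrib_left)
  also have "(\<Sum>i = 1..N. \<Sum>j = 1..N. (rank_weight N i - rank_weight N j) * (z i - z j))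
      = 2 * (\<Sum>i = 1..N. \<Sum>j = 1..N. rank_weight N i * (z i - z j))"
    by (subst sum_antisymmetric) auto
  also have "(\<Sum>i = 1..N. \<Sum>j = 1..N. rank_weight N i * (z i - z j))
      = real N * (\<Sum>i = 1..N. rank_weight N i * z i) - sum (rank_weight N) {1..N} * (\<Sum>j = 1..N. z j)"
    by (simp add: right_diff_distrib sum_subtractf sum_distrib_left[symmetric] sum_distrib_right)
  finally show ?thesis using N by (simp add: sum_rank_weight[simplified] power2_eq_square)
qed

text \<open>After symmetrisation the comparison holds pair by pair: monotonicity of \<open>y\<close>
  turns the product of the two differences into a product of absolute values, which absorbs the
  Lipschitz bound whatever the sign of the increment of \<open>u\<close>.\<close>

lemma sum_rank_weight_lipschitz_le:
  assumes N: "2 \<le> N" and y: "mono_on {1..N} y" and K: "0 \<le> K"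
    and u: "\<And>a b. \<bar>u a - u b\<bar> \<le> K * \<bar>a - b\<bar>"
  shows "(\<Sum>i = 1..N. rank_weight N i * u (y i)) \<le> K * (\<Sum>i = 1..N. rank_weight N i * y i)"
proof -
  have "(real i - real j) * (u (y i) - u (y j)) \<le> K * ((real i - real j) * (y i - y j))"
    if "i \<in> {1..N}" "j \<in> {1..N}" for i j
  proof -
    have "(real i - real j) * (y i - y j) = \<bar>real i - real j\<bar> * \<bar>y i - y j\<bar>"
    proof (cases "i \<le> j")
      case True
      then have "y i \<le> y j" using y that by (auto simp: mono_on_def)
      then show ?thesis using True by (simp add: algebra_simps)
    next
      case False
      then have "y j \<le> y i" using y that by (auto simp: mono_on_def)
      then show ?thesis using False by simp
    qed
    moreover have "(real i - real j) * (u (y i) - u (y j)) \<le> \<bar>real i - real j\<bar> * \<bar>u (y i) - u (y j)\<bar>"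
      by (metis abs_ge_self abs_mult)
    moreover have "\<dots> \<le> \<bar>real i - real j\<bar> * (K * \<bar>y i - y j\<bar>)"
      using u by (intro mult_left_mono) auto
    ultimately show ?thesis by (simp add: algebra_simps)
  qed
  then have "(\<Sum>i = 1..N. \<Sum>j = 1..N. (real i - real j) * (u (y i) - u (y j)))
      \<le> (\<Sum>i = 1..N. \<Sum>j = 1..N. K * ((real i - real j) * (y i - y j)))"
    by (intro sum_mono)
  then show ?thesis
    unfolding sum_rank_weight_symmetrize[OF N] by (simp add: sum_distrib_left[symmetric] divide_right_mono)
qed

text \<open>Chebyshev's sum inequality, read off from the preceding comparison with
  \<open>u = 0\<close> and \<open>K = 1\<close>.\<close>

lemma sum_rank_weight_nonneg:
  assumes N: "2 \<le> N" and y: "mono_on {1..N} y"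
  shows "0 \<le> (\<Sum>i = 1..N. rank_weight N i * y i)"
  using sum_rank_weight_lipschitz_le[OF N y, of 1 "\<lambda>_. 0"]
    sum_rank_weight_lipschitz_le[OF N y, of 0 "\<lambda>_. 0"] by simp

section \<open>Pathwise energy estimate\<close>

lemma
  fixes g :: "'b \<Rightarrow> 'a \<Rightarrow> real"
  assumes "\<And>i. i \<in> I \<Longrightarrow> set_integrable M A (g i)"
  shows set_integrable_sum: "set_integrable M A (\<lambda>x. \<Sum>i\<in>I. c i * g i x)"
    and set_integral_sum: "(LINT x:A|M. \<Sum>i\<in>I. c i * g i x) = (\<Sum>i\<in>I. c i * (LINT x:A|M. g i x))"
proof -
  have i: "integrable M (\<lambda>x. c i * (indicator A x * g i x))" if "i \<in> I" for i
    using assms[OF that] unfolding set_integrable_def by (intro integrable_mult_right) simp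
  have eq: "indicator A x *\<^sub>R (\<Sum>i\<in>I. c i * g i x) = (\<Sum>i\<in>I. c i * (indicator A x * g i x))" for x
    by (cases "x \<in> A") simp_all
  show "set_integrable M A (\<lambda>x. \<Sum>i\<in>I. c i * g i x)"
    unfolding set_integrable_def eq by (rule Bochner_Integration.integrable_sum[OF i])
  show "(LINT x:A|M. \<Sum>i\<in>I. c i * g i x) = (\<Sum>i\<in>I. c i * (LINT x:A|M. g i x))"
    unfolding set_lebesgue_integral_def eq by (subst Bochner_Integration.integral_sum[OF i]) auto
qed

lemma lipschitz_bound_continuous:
  fixes u :: "real \<Rightarrow> real"
  assumes "0 \<le> K" "\<And>a b. \<bar>u a - u b\<bar> \<le> K * \<bar>a - b\<bar>"
  shows "continuous_on A u"
proof -
  have "K-lipschitz_on UNIV u"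
    by (rule lipschitz_onI) (use assms in \<open>auto simp: dist_real_def\<close>)
  then show ?thesis using lipschitz_on_continuous_on continuous_on_subset by blast
qed

lemma set_integrable_continuous:
  fixes g :: "real \<Rightarrow> real"
  assumes "continuous_on {0..} g"
  shows "set_integrable lborel {0..t} g"
  unfolding set_integrable_def
  by (rule borel_integrable_compact[OF _ continuous_on_subset[OF assms]]) auto

lemma set_integral_split:
  fixes g :: "real \<Rightarrow> real"
  assumes "0 \<le> s" "s \<le> t" "set_integrable lborel {0..t} g"
  shows "set_integrable lborel {0..s} g" "set_integrable lborel {s<..t} g"
    "(LBINT u:{0..t}. g u) = (LBINT u:{0..s}. g u) + (LBINT u:{s<..t}. g u)"
proof -
  show a: "set_integrable lborel {0..s} g" and b: "set_integrable lborel {s<..t} g"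
    by (rule set_integrable_subset[OF assms(3)]; use assms in auto)+
  have "{0..t} = {0..s} \<union> {s<..t}" using assms by auto
  then show "(LBINT u:{0..t}. g u) = (LBINT u:{0..s}. g u) + (LBINT u:{s<..t}. g u)"
    by (simp only:) (rule set_integral_Un[OF _ a b], auto)
qed

text \<open>The sums below include the diagonal \<open>j = i\<close>, where the force and the negative
  powers of the distance vanish by the conventions for division and \<open>powr\<close> at \<open>0\<close>.\<close>

locale repulsive_path =
  fixes N :: nat and \<alpha> \<sigma> K :: real and U' :: "real \<Rightarrow> real" and x w :: "nat \<Rightarrow> real \<Rightarrow> real"
  assumes N: "2 \<le> N" and \<sigma>: "0 \<le> \<sigma>" and K: "0 \<le> K"
    and U'_lip: "\<And>a b. \<bar>U' a - U' b\<bar> \<le> K * \<bar>a - b\<bar>"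
    and cont_x: "\<And>i. i \<in> {1..N} \<Longrightarrow> continuous_on {0..} (x i)"
    and cont_w: "\<And>i. i \<in> {1..N} \<Longrightarrow> continuous_on {0..} (w i)"
    and w_0: "\<And>i. i \<in> {1..N} \<Longrightarrow> w i 0 = 0"
    and ordered_0: "strict_mono_on {1..N} (\<lambda>i. x i 0)"
    and ordered_AE: "AE s in lborel. 0 \<le> s \<longrightarrow> strict_mono_on {1..N} (\<lambda>i. x i s)"
    and force_integrable: "\<And>t i j. 0 \<le> t \<Longrightarrow> i \<in> {1..N} \<Longrightarrow> j \<in> {1..N} \<Longrightarrow>
      set_integrable lborel {0..t} (\<lambda>s. V_deriv \<alpha> (x i s - x j s))"
    and equation: "\<And>t i. 0 \<le> t \<Longrightarrow> i \<in> {1..N} \<Longrightarrow>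
      x i t = x i 0 + sqrt (2 * \<sigma>) * w i t - (LBINT s:{0..t}. U' (x i s))
        - 1 / N * (\<Sum>j = 1..N. LBINT s:{0..t}. V_deriv \<alpha> (x i s - x j s))"
begin

definition drift :: "nat \<Rightarrow> real \<Rightarrow> real" where
  "drift i s = - U' (x i s) - 1 / N * (\<Sum>j = 1..N. V_deriv \<alpha> (x i s - x j s))"

lemma cont_U': "continuous_on A U'"
  using K U'_lip by (rule lipschitz_bound_continuous)

lemma cont_U'_x: "i \<in> {1..N} \<Longrightarrow> continuous_on {0..} (\<lambda>s. U' (x i s))"
  by (rule continuous_on_compose2[OF cont_U'[of UNIV] cont_x]) auto

lemma drift_integrable:
  assumes t: "0 \<le> t" and i: "i \<in> {1..N}"
  shows "set_integrable lborel {0..t} (drift i)"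
    and "x i t = x i 0 + sqrt (2 * \<sigma>) * w i t + (LBINT s:{0..t}. drift i s)"
proof -
  note U = set_integrable_continuous[OF cont_U'_x[OF i], of t]
  have V: "set_integrable lborel {0..t} (\<lambda>s. \<Sum>j = 1..N. V_deriv \<alpha> (x i s - x j s))"
    using set_integrable_sum[OF force_integrable[OF t i], of "{1..N}" "\<lambda>j. j" "\<lambda>_. 1"] by simp
  have U': "set_integrable lborel {0..t} (\<lambda>s. - U' (x i s))" using U by (simp add: set_integrable_def)
  have V': "set_integrable lborel {0..t} (\<lambda>s. 1 / N * (\<Sum>j = 1..N. V_deriv \<alpha> (x i s - x j s)))"
    by (rule set_integrable_mult_right) (rule V)
  show "set_integrable lborel {0..t} (drift i)"
    using set_integral_diff(1)[OF U' V'] unfolding drift_def .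
  have "(LBINT s:{0..t}. \<Sum>j = 1..N. V_deriv \<alpha> (x i s - x j s))
      = (\<Sum>j = 1..N. LBINT s:{0..t}. V_deriv \<alpha> (x i s - x j s))"
    using set_integral_sum[OF force_integrable[OF t i], of "{1..N}" "\<lambda>j. j" "\<lambda>_. 1"] by simp
  then have "(LBINT s:{0..t}. drift i s) = - (LBINT s:{0..t}. U' (x i s))
        - 1 / N * (\<Sum>j = 1..N. LBINT s:{0..t}. V_deriv \<alpha> (x i s - x j s))"
    using set_integral_diff[OF U' V'] unfolding drift_def by (simp add: set_integral_uminus[OF U])
  then show "x i t = x i 0 + sqrt (2 * \<sigma>) * w i t + (LBINT s:{0..t}. drift i s)"
    using equation[OF t i] by simp
qed

lemma increment:
  assumes "0 \<le> s" "s \<le> t" and i: "i \<in> {1..N}"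
  shows "x i t - x i s = sqrt (2 * \<sigma>) * (w i t - w i s) + (LBINT u:{s<..t}. drift i u)"
proof -
  have t: "0 \<le> t" using assms by linarith
  show ?thesis
    using drift_integrable(2)[OF t i] drift_integrable(2)[OF assms(1) i]
      set_integral_split(3)[OF assms(1,2) drift_integrable(1)[OF t i]]
    by (simp add: right_diff_distrib)
qed

lemma ranked_energy_integrable:
  assumes "0 \<le> t"
  shows "set_integrable lborel {0..t} (\<lambda>s. ranked_energy N \<alpha> (\<lambda>i. x i s))"
proof -
  have "set_integrable lborel {0..t} (\<lambda>s. \<bar>V_deriv \<alpha> (x i s - x j s)\<bar>)" if "i \<in> {1..N}" "j \<in> {1..N}" for i j
    by (rule set_integrable_abs[OF force_integrable[OF assms that]])
  then have "integrable lborel (\<lambda>s. \<Sum>i = 1..N. \<Sum>j = 1..N. \<bar>real i - real j\<bar> / N *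
      (indicator {0..t} s * \<bar>V_deriv \<alpha> (x i s - x j s)\<bar>))"
    unfolding set_integrable_def by (intro Bochner_Integration.integrable_sum integrable_mult_right) auto
  then have "integrable lborel (\<lambda>s. (\<Sum>i = 1..N. \<Sum>j = 1..N. \<bar>real i - real j\<bar> / N *
      (indicator {0..t} s * \<bar>V_deriv \<alpha> (x i s - x j s)\<bar>)) / (2 * (real N)\<^sup>2))"
    by (rule integrable_divide)
  then show ?thesis
    unfolding set_integrable_def ranked_energy_def
    by (simp add: sum_distrib_left abs_V_deriv mult_ac)
qed

text \<open>Repulsion contributes exactly the ranked energy, and the confinement costs at most
  \<open>K\<close> times the weighted mean itself. The bound is one-sided, which is why it is
  exploited backwards in time.\<close>

lemma weighted_drift:
  assumes "0 \<le> s" "strict_mono_on {1..N} (\<lambda>i. x i s)"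
  shows "ranked_energy N \<alpha> (\<lambda>i. x i s) - K * ((\<Sum>i = 1..N. rank_weight N i * x i s) / N)
    \<le> (\<Sum>i = 1..N. rank_weight N i * drift i s) / N"
proof -
  have "(\<Sum>i = 1..N. rank_weight N i * drift i s) = - (\<Sum>i = 1..N. rank_weight N i * U' (x i s))
      - 1 / N * (\<Sum>i = 1..N. rank_weight N i * (\<Sum>j = 1..N. V_deriv \<alpha> (x i s - x j s)))"
    by (simp add: drift_def right_diff_distrib sum_subtractf sum_negf sum_divide_distrib[symmetric])
  also have "\<dots> = N * ranked_energy N \<alpha> (\<lambda>i. x i s) - (\<Sum>i = 1..N. rank_weight N i * U' (x i s))"
    using N by (subst sum_rank_weight_V_deriv[OF N assms(2)]) (simp add: power2_eq_square)
  finally have "(\<Sum>i = 1..N. rank_weight N i * drift i s) / N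
      = ranked_energy N \<alpha> (\<lambda>i. x i s) - (\<Sum>i = 1..N. rank_weight N i * U' (x i s)) / N"
    using N by (simp add: diff_divide_distrib)
  moreover have "(\<Sum>i = 1..N. rank_weight N i * U' (x i s)) / N \<le> K * (\<Sum>i = 1..N. rank_weight N i * x i s) / N"
    using sum_rank_weight_lipschitz_le[where y="\<lambda>i. x i s" and u=U', OF N strict_mono_on_imp_mono_on[OF assms(2)] K U'_lip]
    by (intro divide_right_mono) auto
  ultimately show ?thesis by simp
qed

definition noise :: "real \<Rightarrow> real" where
  "noise s = sqrt (2 * \<sigma>) * (\<Sum>i = 1..N. \<bar>w i s\<bar>) / N"

lemma cont_noise: "continuous_on {0..} noise"
  unfolding noise_def by (intro continuous_intros cont_w) (use N in auto)

lemma noise_nonneg: "0 \<le> noise s"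
  unfolding noise_def by (intro divide_nonneg_nonneg mult_nonneg_nonneg sum_nonneg) (use \<sigma> in auto)

lemma abs_weighted_mean_le: "\<bar>(\<Sum>i = 1..N. rank_weight N i * y i) / N\<bar> \<le> (\<Sum>i = 1..N. \<bar>y i\<bar>) / N"
proof -
  have "\<bar>\<Sum>i = 1..N. rank_weight N i * y i\<bar> \<le> (\<Sum>i = 1..N. \<bar>rank_weight N i\<bar> * \<bar>y i\<bar>)"
    using sum_abs[of "\<lambda>i. rank_weight N i * y i" "{1..N}"] by (simp add: abs_mult)
  also have "\<dots> \<le> (\<Sum>i = 1..N. \<bar>y i\<bar>)"
    using abs_rank_weight_le by (intro sum_mono) (auto intro!: mult_left_le_one_le)
  finally show ?thesis using N by (simp add: divide_right_mono)
qed

text \<open>The weighted mean \<open>Z\<close> controls the spread of the particles, and the repulsion can only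
  increase it. It is therefore bounded backwards in time by its value at \<open>T\<close>, and the energy
  dissipated on the way is bounded in terms of that value.\<close>

lemma ranked_energy_integral_le:
  assumes T: "0 \<le> T"
  shows "(LBINT s:{0..T}. ranked_energy N \<alpha> (\<lambda>i. x i s))
    \<le> (1 + K * exp (K * T) * (1 + T)) * ((\<Sum>i = 1..N. \<bar>x i T\<bar>) / N + noise T + (LBINT s:{0..T}. noise s))"
proof -
  define Z where "Z = (\<lambda>s. (\<Sum>i = 1..N. rank_weight N i * x i s) / N)"
  define n where "n = (\<lambda>s. (\<Sum>i = 1..N. rank_weight N i * (sqrt (2 * \<sigma>) * w i s)) / N)"
  define D where "D = (\<lambda>s. (\<Sum>i = 1..N. rank_weight N i * drift i s) / N)"
  define A where "A = (\<Sum>i = 1..N. \<bar>x i T\<bar>) / N"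
  have ZA: "\<bar>Z T\<bar> \<le> A" unfolding Z_def A_def by (rule abs_weighted_mean_le)
  have nn: "\<bar>n s\<bar> \<le> noise s" for s
    using abs_weighted_mean_le[of "\<lambda>i. sqrt (2 * \<sigma>) * w i s"] \<sigma>
    unfolding n_def noise_def by (simp add: abs_mult sum_distrib_left)
  have contZ: "continuous_on {0..} Z" unfolding Z_def by (intro continuous_intros cont_x) (use N in auto)
  have Zi: "set_integrable lborel {0..t} Z" for t by (rule set_integrable_continuous[OF contZ])
  have Z_int: "integral {0..t} Z = (LBINT u:{0..t}. Z u)" for t
    using set_borel_integral_eq_integral(2)[OF Zi] by simp
  have Di: "set_integrable lborel {0..t} D" if "0 \<le> t" for t
    using set_integrable_sum[OF drift_integrable(1)[OF that], of "{1..N}" "\<lambda>i. i" "rank_weight N"]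
    unfolding D_def by simp
  have D_int: "(LBINT u:{s<..T}. D u) = Z T - Z s - n T + n s" if s: "0 \<le> s" "s \<le> T" for s
  proof -
    have "(LBINT u:{s<..T}. D u) = (\<Sum>i = 1..N. rank_weight N i * (LBINT u:{s<..T}. drift i u)) / N"
      using set_integral_sum[OF set_integral_split(2)[OF s drift_integrable(1)[OF T]],
          of "{1..N}" "\<lambda>i. i" "rank_weight N"]
      unfolding D_def by simp
    also have "\<dots> = (\<Sum>i = 1..N. rank_weight N i * (x i T - x i s - sqrt (2 * \<sigma>) * (w i T - w i s))) / N"
      using increment[OF s] by (intro arg_cong[where f="\<lambda>z. z / N"] sum.cong) auto
    also have "\<dots> = Z T - Z s - n T + n s"
      by (simp add: Z_def n_def algebra_simps sum_subtractf sum.distrib diff_divide_distrib add_divide_distrib)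
    finally show ?thesis .
  qed
  have E: "AE s in lborel. 0 \<le> s \<longrightarrow> ranked_energy N \<alpha> (\<lambda>i. x i s) - K * Z s \<le> D s"
    using ordered_AE by eventually_elim (use weighted_drift in \<open>auto simp: Z_def D_def\<close>)
  \<comment> \<open>Dropping the nonnegative energy leaves \<open>- (K * Z)\<close> as a lower bound
    for the drift after \<open>s\<close>, that is, an upper bound for \<open>Z s\<close> through the
    future of \<open>Z\<close>.\<close>
  have backward: "Z s \<le> (A + noise T + noise s) + K * (integral {0..T} Z - integral {0..s} Z)"
    if s: "s \<in> {0..T}" for s
  proof -
    have s': "0 \<le> s" "s \<le> T" using s by auto
    note Zs = set_integral_split[OF s' Zi]
    have "(LBINT u:{s<..T}. - (K * Z u)) \<le> (LBINT u:{s<..T}. D u)"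
    proof (rule set_integral_mono_AE)
      show "set_integrable lborel {s<..T} (\<lambda>u. - (K * Z u))" 
        using set_integrable_mult_right[of "- K", OF Zs(2)] by simp
      show "set_integrable lborel {s<..T} D" by (rule set_integral_split(2)[OF s' Di[OF T]])
      show "AE u in lborel. u \<in> {s<..T} \<longrightarrow> - (K * Z u) \<le> D u"
        using E
      proof eventually_elim
        case (elim u)
        then show ?case using s' ranked_energy_nonneg[of N \<alpha> "\<lambda>i. x i u"] by force
      qed
    qed
    moreover have "(LBINT u:{s<..T}. - (K * Z u)) = - (K * (LBINT u:{s<..T}. Z u))"
      using set_integral_mult_right[of lborel "{s<..T}" "- K" Z] by simp
    ultimately have "Z s \<le> Z T - n T + n s + K * (LBINT u:{s<..T}. Z u)"
      using D_int[OF s'] by simp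
    then show ?thesis
      using ZA nn[of T] nn[of s] Zs(3) by (simp add: Z_int)
  qed
  have sub: "continuous_on {0..} g \<Longrightarrow> continuous_on {0..T} g" for g :: "real \<Rightarrow> real"
    by (rule continuous_on_subset) auto
  have A0: "0 \<le> A" unfolding A_def by (intro divide_nonneg_nonneg sum_nonneg) auto
  define J where "J = (LBINT s:{0..T}. noise s)"
  have J: "integral {0..T} noise = J"
    unfolding J_def using set_borel_integral_eq_integral(2)[OF set_integrable_continuous[OF cont_noise]] by simp
  have J0: "0 \<le> J" unfolding J[symmetric]
    by (rule integral_nonneg) (auto intro!: integrable_continuous_real sub cont_noise noise_nonneg)
  have "integral {0..T} Z \<le> exp (K * T) * integral {0..T} (\<lambda>s. A + noise T + noise s)"
    using backward A0 noise_nonneg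
    by (intro gronwall_integral_backward T K sub contZ continuous_intros cont_noise) auto
  also have "integral {0..T} (\<lambda>s. A + noise T + noise s) = T * (A + noise T) + J"
    using T by (subst integral_add) (auto intro!: integrable_continuous_real sub cont_noise simp: J)
  also have "\<dots> \<le> (1 + T) * (A + noise T + J)"
    using A0 J0 noise_nonneg[of T] T by (simp add: algebra_simps)
  finally have ZI: "integral {0..T} Z \<le> exp (K * T) * ((1 + T) * (A + noise T + J))" by simp
  have "(LBINT s:{0..T}. ranked_energy N \<alpha> (\<lambda>i. x i s)) \<le> (LBINT s:{0..T}. D s + K * Z s)"
  proof (rule set_integral_mono_AE)
    show "set_integrable lborel {0..T} (\<lambda>s. D s + K * Z s)" using Di[OF T] Zi by simp
    show "AE s in lborel. s \<in> {0..T} \<longrightarrow> ranked_energy N \<alpha> (\<lambda>i. x i s) \<le> D s + K * Z s"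
      using E by eventually_elim auto
  qed (rule ranked_energy_integrable[OF T])
  also have "\<dots> = (LBINT s:{0..T}. D s) + K * integral {0..T} Z"
    using Di[OF T] Zi by (simp add: Z_int)
  also have "(LBINT s:{0..T}. D s) = (LBINT s:{0<..T}. D s)"
    using set_integral_split(1,3)[OF order_refl T Di[OF T]] set_integral_at_point[of lborel 0 D] by simp
  also have "\<dots> = Z T - Z 0 - n T + n 0" using D_int[of 0] T by simp
  also have "\<dots> \<le> A + noise T"
  proof -
    have "0 \<le> Z 0" unfolding Z_def
      using sum_rank_weight_nonneg[OF N strict_mono_on_imp_mono_on[OF ordered_0]] by simp
    moreover have "n 0 = 0" unfolding n_def using w_0 by simp
    ultimately show ?thesis using ZA nn[of T] by simp
  qed
  also have "A + noise T + K * integral {0..T} Z \<le> A + noise T + K * (exp (K * T) * ((1 + T) * (A + noise T + J)))"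
    using ZI K by (intro add_left_mono mult_left_mono) auto
  also have "\<dots> \<le> (1 + K * exp (K * T) * (1 + T)) * (A + noise T + J)"
    using J0 by (simp add: algebra_simps)
  finally show ?thesis by (simp add: A_def J_def)
qed

text \<open>Forward Gronwall for a single coordinate, with the total force over [0, T] treated as a
  given constant. The bound is qualitative: it serves to show that positions at intermediate times
  are integrable for fixed \<open>N\<close>.\<close>

lemma position_integral_le:
  assumes T: "0 \<le> T" and i: "i \<in> {1..N}"
  shows "(LBINT s:{0..T}. \<bar>x i s\<bar>) \<le> exp (K * T) * (LBINT s:{0..T}. \<bar>x i 0\<bar> + \<bar>U' 0\<bar> * T
      + 1 / N * (\<Sum>j = 1..N. LBINT u:{0..T}. \<bar>V_deriv \<alpha> (x i u - x j u)\<bar>) + sqrt (2 * \<sigma>) * \<bar>w i s\<bar>)"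
proof -
  define R where "R = 1 / N * (\<Sum>j = 1..N. LBINT u:{0..T}. \<bar>V_deriv \<alpha> (x i u - x j u)\<bar>)"
  define h where "h = (\<lambda>s. \<bar>x i 0\<bar> + \<bar>U' 0\<bar> * T + R + sqrt (2 * \<sigma>) * \<bar>w i s\<bar>)"
  have R0: "0 \<le> R" unfolding R_def set_lebesgue_integral_def
    by (intro mult_nonneg_nonneg sum_nonneg Bochner_Integration.integral_nonneg) auto
  have conth: "continuous_on {0..} h" unfolding h_def by (intro continuous_intros cont_w i)
  have contx: "continuous_on {0..} (\<lambda>s. \<bar>x i s\<bar>)" by (intro continuous_intros cont_x i)
  note ih = set_integrable_continuous[OF conth] and ix = set_integrable_continuous[OF contx]
  have sub: "continuous_on {0..} g \<Longrightarrow> continuous_on {0..T} g" for g :: "real \<Rightarrow> real"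
    by (rule continuous_on_subset) auto
  have "integral {0..T} (\<lambda>s. \<bar>x i s\<bar>) \<le> exp (K * T) * integral {0..T} h"
  proof (rule gronwall_integral[OF T K sub[OF contx] sub[OF conth]])
    show "0 \<le> h s" for s unfolding h_def using R0 T \<sigma> by simp
    fix s assume s: "s \<in> {0..T}"
    then have s0: "0 \<le> s" "s \<le> T" by auto
    have U: "\<bar>LBINT u:{0..s}. U' (x i u)\<bar> \<le> \<bar>U' 0\<bar> * T + K * integral {0..s} (\<lambda>s. \<bar>x i s\<bar>)"
    proof -
      note U = set_integrable_continuous[OF cont_U'_x[OF i], of s]
      have c: "set_integrable lborel {0..s} (\<lambda>u. \<bar>U' 0\<bar>)"
        by (rule set_integrable_continuous) auto
      have "\<bar>LBINT u:{0..s}. U' (x i u)\<bar> \<le> (LBINT u:{0..s}. \<bar>U' (x i u)\<bar>)"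
        using set_integral_norm_bound[OF U] by simp
      also have "\<dots> \<le> (LBINT u:{0..s}. \<bar>U' 0\<bar> + K * \<bar>x i u\<bar>)"
      proof (rule set_integral_mono)
        fix u show "\<bar>U' (x i u)\<bar> \<le> \<bar>U' 0\<bar> + K * \<bar>x i u\<bar>"
          using U'_lip[of "x i u" 0] by simp
      qed (use set_integrable_abs[OF U] c ix in auto)
      also have "\<dots> = \<bar>U' 0\<bar> * s + K * (LBINT u:{0..s}. \<bar>x i u\<bar>)"
        using c ix s0 by (simp add: set_integral_const mult.commute)
      also have "(LBINT u:{0..s}. \<bar>x i u\<bar>) = integral {0..s} (\<lambda>s. \<bar>x i s\<bar>)"
        by (rule set_borel_integral_eq_integral(2)[OF ix])
      also have "\<bar>U' 0\<bar> * s \<le> \<bar>U' 0\<bar> * T" using s0 by (intro mult_left_mono) auto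
      finally show ?thesis by simp
    qed
    have V: "\<bar>1 / N * (\<Sum>j = 1..N. LBINT u:{0..s}. V_deriv \<alpha> (x i u - x j u))\<bar> \<le> R"
    proof -
      have "\<bar>LBINT u:{0..s}. V_deriv \<alpha> (x i u - x j u)\<bar> \<le> (LBINT u:{0..T}. \<bar>V_deriv \<alpha> (x i u - x j u)\<bar>)"
        if j: "j \<in> {1..N}" for j
      proof -
        note F = force_integrable[OF s0(1) i j] force_integrable[OF T i j]
        have "\<bar>LBINT u:{0..s}. V_deriv \<alpha> (x i u - x j u)\<bar> \<le> (LBINT u:{0..s}. \<bar>V_deriv \<alpha> (x i u - x j u)\<bar>)"
          using set_integral_norm_bound[OF F(1)] by simp
        also have "\<dots> \<le> (LBINT u:{0..T}. \<bar>V_deriv \<alpha> (x i u - x j u)\<bar>)"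
          using set_integrable_abs[OF F(1)] set_integrable_abs[OF F(2)] s0
          unfolding set_integrable_def set_lebesgue_integral_def
          by (intro integral_mono) (auto simp: indicator_def)
        finally show ?thesis .
      qed
      then have "(\<Sum>j = 1..N. \<bar>LBINT u:{0..s}. V_deriv \<alpha> (x i u - x j u)\<bar>)
          \<le> (\<Sum>j = 1..N. LBINT u:{0..T}. \<bar>V_deriv \<alpha> (x i u - x j u)\<bar>)"
        by (intro sum_mono)
      from order_trans[OF sum_abs this] show ?thesis
        unfolding R_def by (simp add: abs_mult divide_right_mono)
    qed
    have "\<bar>sqrt (2 * \<sigma>) * w i s\<bar> = sqrt (2 * \<sigma>) * \<bar>w i s\<bar>" using \<sigma> by (simp add: abs_mult)
    then show "\<bar>x i s\<bar> \<le> h s + K * integral {0..s} (\<lambda>s. \<bar>x i s\<bar>)"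
      using U V equation[OF s0(1) i] unfolding h_def by linarith
  qed
  then show ?thesis
    using set_borel_integral_eq_integral(2)[OF ix] set_borel_integral_eq_integral(2)[OF ih]
    by (simp add: h_def R_def)
qed

end

text \<open>With the derivative as value at \<open>y = z\<close>, the mean value property and
  \<open>f z - f y = difference_quotient f f' y z * (z - y)\<close> hold without exception.\<close>

definition difference_quotient :: "(real \<Rightarrow> real) \<Rightarrow> (real \<Rightarrow> real) \<Rightarrow> real \<Rightarrow> real \<Rightarrow> real" where
  "difference_quotient f f' y z = (if y = z then f' y else (f z - f y) / (z - y))"

text \<open>Left end of the cell of mesh \<open>h\<close>, open on the left and closed on the right,
  that contains \<open>u\<close>. Among nonnegative times the maximum with 0 matters at
  \<open>u = 0\<close> alone, where the cell would begin before time 0.\<close>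

definition cell_left :: "real \<Rightarrow> real \<Rightarrow> real" where
  "cell_left h u = max 0 (h * (of_int \<lceil>u / h\<rceil> - 1))"

definition cell_right :: "real \<Rightarrow> real \<Rightarrow> real" where
  "cell_right h u = max 0 (h * of_int \<lceil>u / h\<rceil>)"

lemma cell_eq:
  assumes "0 < h" "u \<in> {real k * h<..real (Suc k) * h}"
  shows "cell_left h u = real k * h" "cell_right h u = real (Suc k) * h"
proof -
  have "\<lceil>u / h\<rceil> = int k + 1"
    using assms by (intro ceiling_unique) (auto simp: field_simps)
  then show "cell_left h u = real k * h" "cell_right h u = real (Suc k) * h"
    using assms(1) by (auto simp: cell_left_def cell_right_def)
qed

lemma cell_bounds:
  assumes "0 < h" "0 \<le> u"
  shows "0 \<le> cell_left h u" "0 \<le> cell_right h u"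
    "\<bar>cell_left h u - u\<bar> \<le> h" "\<bar>cell_right h u - u\<bar> \<le> h"
proof -
  have "h * (of_int \<lceil>u / h\<rceil> - 1) < h * (u / h)" "h * (u / h) \<le> h * of_int \<lceil>u / h\<rceil>"
    by (rule mult_strict_left_mono mult_left_mono; use ceiling_correct[of "u / h"] assms in simp)+
  then show "0 \<le> cell_left h u" "0 \<le> cell_right h u"
    "\<bar>cell_left h u - u\<bar> \<le> h" "\<bar>cell_right h u - u\<bar> \<le> h"
    using assms by (auto simp: cell_left_def cell_right_def algebra_simps)
qed

lemma cell_measurable[measurable]:
  "cell_left h \<in> borel_measurable borel" "cell_right h \<in> borel_measurable borel"
  unfolding cell_left_def cell_right_def by measurable

lemma difference_quotient_mvt:
  assumes "\<And>x. (f has_real_derivative f' x) (at x)"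
  shows "\<exists>\<xi>. \<bar>\<xi> - y\<bar> \<le> \<bar>z - y\<bar> \<and> difference_quotient f f' y z = f' \<xi>"
proof (cases y z rule: linorder_cases)
  case less
  from MVT2[OF this, of f f'] assms obtain \<xi> where "y < \<xi>" "\<xi> < z" "f z - f y = (z - y) * f' \<xi>" by auto
  then show ?thesis by (intro exI[of _ \<xi>]) (auto simp: difference_quotient_def)
next
  case equal
  then show ?thesis by (intro exI[of _ y]) (auto simp: difference_quotient_def)
next
  case greater
  from MVT2[OF this, of f f'] assms obtain \<xi> where "z < \<xi>" "\<xi> < y" "f y - f z = (y - z) * f' \<xi>" by auto
  then show ?thesis by (intro exI[of _ \<xi>]) (auto simp: difference_quotient_def field_simps)
qed

text \<open>The point inserted between two consecutive positions has moved by the noise increment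
  alone. What remains of the step is the integral of the drift over the cell, and the difference
  quotient, constant on the cell, converts it exactly into an increment of \<open>f\<close>.\<close>

lemma (in repulsive_path) telescope:
  fixes f f' :: "real \<Rightarrow> real"
  assumes h: "0 < h" and i: "i \<in> {1..N}"
  defines "q \<equiv> \<lambda>u. difference_quotient f f'
    (x i (cell_left h u) + sqrt (2 * \<sigma>) * (w i (cell_right h u) - w i (cell_left h u))) (x i (cell_right h u))"
  shows "set_integrable lborel {0..real n * h} (\<lambda>u. q u * drift i u) \<and>
    f (x i (real n * h)) - f (x i 0) = (LBINT u:{0..real n * h}. q u * drift i u) +
      (\<Sum>k<n. f (x i (real k * h) + sqrt (2 * \<sigma>) * (w i (real (Suc k) * h) - w i (real k * h))) - f (x i (real k * h)))"
proof (induction n)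
  case 0
  have "set_integrable lborel {0} (\<lambda>u. q u * drift i u)"
    by (subst set_integrable_cong[OF refl refl, where f'="\<lambda>_. q 0 * drift i 0"]) (auto simp: set_integrable_def)
  moreover have "(LBINT u:{0::real}. q u * drift i u) = (LBINT u:{0::real}. q 0 * drift i 0)"
    unfolding set_lebesgue_integral_def by (rule Bochner_Integration.integral_cong) (auto simp: indicator_def)
  ultimately show ?case by (simp add: set_lebesgue_integral_def)
next
  case (Suc n)
  define s where "s = real n * h"
  define t where "t = real (Suc n) * h"
  have s: "0 \<le> s" "s \<le> t" using h by (auto simp: s_def t_def)
  define y where "y = x i s + sqrt (2 * \<sigma>) * (w i t - w i s)"
  define c where "c = difference_quotient f f' y (x i t)"
  have q: "q u = c" if "u \<in> {s<..t}" for u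
    using cell_eq[OF h that[unfolded s_def t_def]] by (simp add: q_def c_def y_def s_def t_def)
  note D = set_integral_split(2)[OF s drift_integrable(1)[OF order_trans[OF s] i]]
  have I: "set_integrable lborel {s<..t} (\<lambda>u. q u * drift i u)"
    using D q by (subst set_integrable_cong[OF refl refl, where f'="\<lambda>u. c * drift i u"]) auto
  have "(LBINT u:{s<..t}. q u * drift i u) = (LBINT u:{s<..t}. c * drift i u)"
    using q by (intro set_lebesgue_integral_cong) auto
  also have "\<dots> = c * (LBINT u:{s<..t}. drift i u)" by simp
  also have "(LBINT u:{s<..t}. drift i u) = x i t - y"
    using increment[OF s i] by (simp add: y_def)
  also have "c * (x i t - y) = f (x i t) - f y"
    by (simp add: c_def difference_quotient_def)
  finally have E: "(LBINT u:{s<..t}. q u * drift i u) = f (x i t) - f y" .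
  have "{0..t} = {0..s} \<union> {s<..t}" using s by auto
  moreover have "set_integrable lborel {0..s} (\<lambda>u. q u * drift i u)" using Suc by (simp add: s_def)
  ultimately have "set_integrable lborel {0..t} (\<lambda>u. q u * drift i u)"
    "(LBINT u:{0..t}. q u * drift i u) = (LBINT u:{0..s}. q u * drift i u) + (LBINT u:{s<..t}. q u * drift i u)"
    using I by (auto intro!: set_integrable_Un set_integral_Un)
  with Suc E show ?case by (simp add: y_def s_def t_def)
qed

section \<open>Regular versions of solutions\<close>

text \<open>Rounding the time down to a multiple of \<open>1 / (n + 1)\<close> leaves countably many
  measurable sections; continuity of the paths lets the rounded processes converge.\<close>

lemma continuous_process_measurable:
  fixes Y :: "real \<Rightarrow> 'a \<Rightarrow> real"
  assumes Y: "\<And>s. Y s \<in> borel_measurable M"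
    and cont: "\<And>\<omega>. \<omega> \<in> space M \<Longrightarrow> continuous_on UNIV (\<lambda>s. Y s \<omega>)"
  shows "(\<lambda>(\<omega>, s). Y s \<omega>) \<in> borel_measurable (M \<Otimes>\<^sub>M borel)"
proof -
  define r where "r = (\<lambda>(n::nat) s::real. of_int \<lfloor>s * real (Suc n)\<rfloor> / real (Suc n))"
  have "(\<lambda>z. Y (r n (snd z)) (fst z)) \<in> borel_measurable (M \<Otimes>\<^sub>M borel)" for n
  proof -
    have "(\<lambda>z. (\<lambda>k z. Y (of_int k / real (Suc n)) (fst z)) \<lfloor>snd z * real (Suc n)\<rfloor> z)
        \<in> borel_measurable (M \<Otimes>\<^sub>M borel)"
    proof (rule measurable_compose_countable[where f="\<lambda>k z. Y (of_int k / real (Suc n)) (fst z)"])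
      show "(\<lambda>z. Y (of_int k / real (Suc n)) (fst z)) \<in> borel_measurable (M \<Otimes>\<^sub>M borel)" for k :: int
        by (rule measurable_compose[OF measurable_fst Y])
    qed measurable
    then show ?thesis by (simp add: r_def)
  qed
  moreover have "(\<lambda>n. Y (r n (snd z)) (fst z)) \<longlonglongrightarrow> Y (snd z) (fst z)" if "z \<in> space (M \<Otimes>\<^sub>M borel)" for z
  proof -
    have r: "(\<lambda>n. r n s) \<longlonglongrightarrow> s" for s
    proof (rule LIM_zero_cancel, rule tendsto_0_le)
      show "(\<lambda>n. inverse (real (Suc n))) \<longlonglongrightarrow> 0" by (rule LIMSEQ_inverse_real_of_nat)
      have "norm (r n s - s) \<le> norm (inverse (real (Suc n))) * 1" for n
      proof -
        define c where "c = real (Suc n)"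
        have c: "0 < c" by (simp add: c_def)
        have "\<bar>of_int \<lfloor>s * c\<rfloor> - s * c\<bar> \<le> 1" by linarith
        then have "\<bar>of_int \<lfloor>s * c\<rfloor> - s * c\<bar> / c \<le> 1 / c" using c by (intro divide_right_mono) auto
        moreover have "r n s - s = (of_int \<lfloor>s * c\<rfloor> - s * c) / c"
          using c unfolding r_def c_def[symmetric] by (simp add: diff_divide_distrib)
        ultimately show ?thesis
          using c unfolding c_def[symmetric] by (simp add: abs_divide inverse_eq_divide)
      qed
      then show "\<forall>\<^sub>F n in sequentially. norm (r n s - s) \<le> norm (inverse (real (Suc n))) * 1" by simp
    qed
    have "fst z \<in> space M" using that by (auto simp: space_pair_measure)
    from continuous_on_tendsto_compose[OF cont[OF this] r] show ?thesis by simp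
  qed
  ultimately show ?thesis
    unfolding split_beta' by (rule borel_measurable_LIMSEQ_metric)
qed

text \<open>Modified on a null set, the processes are jointly measurable. Negative times are
  meaningless, hence \<open>max 0 s\<close>.\<close>

locale regular_solution = prob_space M
  for M :: "'a measure" and N :: nat and \<alpha> \<sigma> K :: real and U' :: "real \<Rightarrow> real"
    and X B :: "nat \<Rightarrow> real \<Rightarrow> 'a \<Rightarrow> real" +
  assumes N: "2 \<le> N" and \<sigma>: "0 \<le> \<sigma>" and K: "0 \<le> K"
    and U'_lip: "\<And>a b. \<bar>U' a - U' b\<bar> \<le> K * \<bar>a - b\<bar>"
    and X_joint: "\<And>i. i \<in> {1..N} \<Longrightarrow> (\<lambda>(\<omega>, s). X i (max 0 s) \<omega>) \<in> borel_measurable (M \<Otimes>\<^sub>M borel)"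
    and B_joint: "\<And>i. i \<in> {1..N} \<Longrightarrow> (\<lambda>(\<omega>, s). B i (max 0 s) \<omega>) \<in> borel_measurable (M \<Otimes>\<^sub>M borel)"
    and path_AE: "AE \<omega> in M. repulsive_path N \<alpha> \<sigma> K U' (\<lambda>i s. X i s \<omega>) (\<lambda>i s. B i s \<omega>)"
    and B_square: "\<And>i s r. i \<in> {1..N} \<Longrightarrow> 0 \<le> s \<Longrightarrow> s < r \<Longrightarrow>
      integrable M (\<lambda>\<omega>. (B i r \<omega> - B i s \<omega>)\<^sup>2) \<and> expectation (\<lambda>\<omega>. (B i r \<omega> - B i s \<omega>)\<^sup>2) = r - s"
    and B_orthogonal: "\<And>i s r (g :: real \<Rightarrow> real). i \<in> {1..N} \<Longrightarrow> 0 \<le> s \<Longrightarrow> s < r \<Longrightarrow>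
      g \<in> borel_measurable borel \<Longrightarrow> bounded (range g) \<Longrightarrow>
      expectation (\<lambda>\<omega>. g (X i s \<omega>) * (B i r \<omega> - B i s \<omega>)) = 0"

text \<open>For the last claim, \<open>g (X i s)\<close> is measurable with respect to
  \<open>F s\<close>, while the increment is one coordinate of the vector that is independent of
  \<open>F s\<close>. The expectation of the product factorises and the increment is
  centred.\<close>

lemma solution_brownian:
  assumes sol: "solution \<alpha> U' \<sigma> N M F B X" and i: "i \<in> {1..N}" and s: "0 \<le> s" "s < r"
  shows "integrable M (\<lambda>\<omega>. (B i r \<omega> - B i s \<omega>)\<^sup>2)"
    and "prob_space.expectation M (\<lambda>\<omega>. (B i r \<omega> - B i s \<omega>)\<^sup>2) = r - s"
    and "g \<in> borel_measurable borel \<Longrightarrow> bounded (range (g :: real \<Rightarrow> real)) \<Longrightarrow>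
      prob_space.expectation M (\<lambda>\<omega>. g (X i s \<omega>) * (B i r \<omega> - B i s \<omega>)) = 0"
proof -
  interpret prob_space M using sol by (simp add: solution_def)
  let ?D = "\<lambda>\<omega>. B i r \<omega> - B i s \<omega>" and ?V = "\<lambda>\<omega>. \<lambda>i\<in>{1..N}. B i r \<omega> - B i s \<omega>"
  have bm: "independent_brownian_motions M F N B" and F: "filtration_on M F"
    and ad: "adapted F (X i)" using sol i by (auto simp: solution_def)
  have D: "distributed M lborel ?D (\<lambda>x. ennreal (normal_density 0 (sqrt (r - s)) x))"
    using bm i s unfolding independent_brownian_motions_def by blast
  have pos: "0 < sqrt (r - s)" using s by simp
  have "integrable lborel (\<lambda>x. normal_density 0 (sqrt (r - s)) x * x\<^sup>2)"
    using integrable_normal_moment[OF pos, of 0 2] by simp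
  then show sq: "integrable M (\<lambda>\<omega>. (?D \<omega>)\<^sup>2)"
    using distributed_integrable[OF D, of "\<lambda>x. x\<^sup>2"] by simp
  have E0: "expectation ?D = 0" by (rule normal_distributed_expectation[OF pos D])
  show "expectation (\<lambda>\<omega>. (?D \<omega>)\<^sup>2) = r - s"
    using normal_distributed_variance[OF pos D] E0 s by simp
  have Dm[measurable]: "?D \<in> borel_measurable M"
    using distributed_measurable[OF D] by simp
  have Di: "integrable M ?D"
    by (rule expectation_abs_le_sqrt(1)[OF Dm sq])
  assume g[measurable]: "g \<in> borel_measurable borel" and bdd: "bounded (range g)"
  have Fs: "subalgebra M (F s)" using F s by (auto simp: filtration_on_def)
  have Xs: "X i s \<in> borel_measurable (F s)" using ad s by (auto simp: adapted_def)
  have gX: "(\<lambda>\<omega>. g (X i s \<omega>)) \<in> borel_measurable (F s)" using Xs by measurable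
  have gXM[measurable]: "(\<lambda>\<omega>. g (X i s \<omega>)) \<in> borel_measurable M" by (rule measurable_from_subalg[OF Fs gX])
  let ?W = "vimage_algebra (space M) ?V (\<Pi>\<^sub>M i\<in>{1..N}. borel)"
  have ind: "indep_set (sets (F s)) (sets ?W)"
    using bm s unfolding independent_brownian_motions_def by blast
  have "?V \<in> space M \<rightarrow> space (\<Pi>\<^sub>M i\<in>{1..N}. borel :: real measure)" by (auto simp: space_PiM)
  then have "?V \<in> measurable ?W (\<Pi>\<^sub>M i\<in>{1..N}. borel)" by (rule measurable_vimage_algebra1)
  from measurable_compose[OF this measurable_component_singleton[OF i]]
  have DW: "?D \<in> borel_measurable ?W" using i by simp
  have "indep_var borel (\<lambda>\<omega>. g (X i s \<omega>)) borel ?D"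
    unfolding indep_var_eq
  proof (intro conjI)
    \<comment> \<open>Independence passes to the smaller sigma-algebras generated by the two
      variables.\<close>
    have "indep_set (sigma_sets (space M) {(\<lambda>\<omega>. g (X i s \<omega>)) -` A \<inter> space M |A. A \<in> sets borel})
        (sigma_sets (space M) {?D -` A \<inter> space M |A. A \<in> sets borel})
      \<longleftrightarrow> True" if "sigma_sets (space M) {(\<lambda>\<omega>. g (X i s \<omega>)) -` A \<inter> space M |A. A \<in> sets borel} \<subseteq> sets (F s)"
        "sigma_sets (space M) {?D -` A \<inter> space M |A. A \<in> sets borel} \<subseteq> sets ?W"
      using ind that unfolding indep_sets2_eq by blast
    moreover have "sigma_sets (space M) {(\<lambda>\<omega>. g (X i s \<omega>)) -` A \<inter> space M |A. A \<in> sets borel} \<subseteq> sets (F s)"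
    proof -
      have sp: "space (F s) = space M" using Fs by (auto simp: subalgebra_def)
      show ?thesis
        using measurable_sets[OF gX] unfolding sp[symmetric] by (intro sets.sigma_sets_subset) auto
    qed
    moreover have "sigma_sets (space M) {?D -` A \<inter> space M |A. A \<in> sets borel} \<subseteq> sets ?W"
    proof -
      have sp: "space ?W = space M" by simp
      have "sigma_sets (space ?W) {?D -` A \<inter> space ?W |A. A \<in> sets borel} \<subseteq> sets ?W"
        using measurable_sets[OF DW] by (intro sets.sigma_sets_subset) auto
      then show ?thesis unfolding sp .
    qed
    ultimately show "indep_set (sigma_sets (space M) {(\<lambda>\<omega>. g (X i s \<omega>)) -` A \<inter> space M |A. A \<in> sets borel})
        (sigma_sets (space M) {?D -` A \<inter> space M |A. A \<in> sets borel})" by blast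
  qed (measurable)
  moreover obtain C where "\<And>x. \<bar>g x\<bar> \<le> C" using bdd by (auto simp: bounded_iff)
  then have "integrable M (\<lambda>\<omega>. g (X i s \<omega>))"
    by (intro integrable_const_bound[of _ C]) auto
  ultimately show "expectation (\<lambda>\<omega>. g (X i s \<omega>) * ?D \<omega>) = 0"
    using indep_var_lebesgue_integral[of "\<lambda>\<omega>. g (X i s \<omega>)" ?D] Di E0 by simp
qed

text \<open>The index \<open>j = i\<close> may be added to the sum because
  \<open>V_deriv \<alpha> 0 = 0\<close>.\<close>

lemma path_equation:
  fixes x w :: "nat \<Rightarrow> real \<Rightarrow> real"
  assumes "i \<in> {1..N}"
    and "x i t = x i 0 + sqrt (2 * \<sigma>) * w i t - (LBINT s:{0..t}. U' (x i s))
          - 1 / real N * (\<Sum>j\<in>{1..N} - {i}. LBINT s:{0..t}. V_deriv \<alpha> (x i s - x j s))"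
  shows "x i t = x i 0 + sqrt (2 * \<sigma>) * w i t - (LBINT s:{0..t}. U' (x i s))
          - 1 / N * (\<Sum>j = 1..N. LBINT s:{0..t}. V_deriv \<alpha> (x i s - x j s))"
  using assms by (subst sum.remove[of "{1..N}" i]) auto

lemma solution_path_AE:
  assumes sol: "solution \<alpha> U' \<sigma> N M F B X" and N: "2 \<le> N" and \<sigma>: "0 \<le> \<sigma>" and K: "0 \<le> K"
    and U': "\<And>a b. \<bar>U' a - U' b\<bar> \<le> K * \<bar>a - b\<bar>"
  shows "AE \<omega> in M. repulsive_path N \<alpha> \<sigma> K U' (\<lambda>i s. X i s \<omega>) (\<lambda>i s. B i s \<omega>)"
proof -
  have "AE \<omega> in M. \<forall>i\<in>{1..N}. B i 0 \<omega> = 0 \<and> continuous_on {0..} (\<lambda>t. B i t \<omega>)"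
    "AE \<omega> in M. \<forall>i\<in>{1..N}. continuous_on {0..} (\<lambda>t. X i t \<omega>)"
    "AE \<omega> in M. (\<lambda>i. X i 0 \<omega>) \<in> ordered N"
    "AE \<omega> in M. AE t in lborel. t \<ge> 0 \<longrightarrow> (\<lambda>i. X i t \<omega>) \<in> ordered N"
    "AE \<omega> in M. \<forall>t\<ge>0. \<forall>i\<in>{1..N}. \<forall>j\<in>{1..N} - {i}.
        set_integrable lborel {0..t} (\<lambda>s. V_deriv \<alpha> (X i s \<omega> - X j s \<omega>))"
    "AE \<omega> in M. \<forall>t\<ge>0. \<forall>i\<in>{1..N}.
        X i t \<omega> = X i 0 \<omega> + sqrt (2 * \<sigma>) * B i t \<omega>
          - (LBINT s:{0..t}. U' (X i s \<omega>))
          - 1 / real N * (\<Sum>j\<in>{1..N} - {i}. LBINT s:{0..t}. V_deriv \<alpha> (X i s \<omega> - X j s \<omega>))"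
    using sol unfolding solution_def independent_brownian_motions_def by blast+
  then show ?thesis
  proof eventually_elim
    case (elim \<omega>)
    show ?case
    proof
      fix t :: real and i j assume t: "0 \<le> t" and i: "i \<in> {1..N}"
      show "X i t \<omega> = X i 0 \<omega> + sqrt (2 * \<sigma>) * B i t \<omega> - (LBINT s:{0..t}. U' (X i s \<omega>))
          - 1 / real N * (\<Sum>j = 1..N. LBINT s:{0..t}. V_deriv \<alpha> (X i s \<omega> - X j s \<omega>))"
        using path_equation[where x="\<lambda>i s. X i s \<omega>" and w="\<lambda>i s. B i s \<omega>", OF i] elim(6) t i by blast
      assume j: "j \<in> {1..N}"
      show "set_integrable lborel {0..t} (\<lambda>s. V_deriv \<alpha> (X i s \<omega> - X j s \<omega>))"
      proof (cases "i = j")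
        case True
        then show ?thesis by (simp add: set_integrable_def)
      next
        case False
        then show ?thesis using elim(5) t i j by blast
      qed
    next
      show "AE s in lborel. 0 \<le> s \<longrightarrow> strict_mono_on {1..N} (\<lambda>i. X i s \<omega>)"
        using elim(4) by (simp add: ordered_def)
    qed (use elim(1-3) N \<sigma> K U' in \<open>auto simp: ordered_def\<close>)
  qed
qed

text \<open>Both processes are set to 0 on one null set outside of which all path properties hold
  simultaneously. Then every path is continuous, which gives joint measurability, and the new
  processes agree with the old ones at all times off that set.\<close>

lemma solution_regular_version:
  assumes sol: "solution \<alpha> U' \<sigma> N M F B X" and N: "2 \<le> N" and \<sigma>: "0 \<le> \<sigma>" and K: "0 \<le> K"
    and U': "\<And>a b. \<bar>U' a - U' b\<bar> \<le> K * \<bar>a - b\<bar>"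
  shows "\<exists>X' B'. regular_solution M N \<alpha> \<sigma> K U' X' B' \<and> (AE \<omega> in M. \<forall>i t. X' i t \<omega> = X i t \<omega>)"
proof -
  interpret prob_space M using sol by (simp add: solution_def)
  obtain Z where Z: "\<And>\<omega>. \<omega> \<in> space M - Z \<Longrightarrow> repulsive_path N \<alpha> \<sigma> K U' (\<lambda>i s. X i s \<omega>) (\<lambda>i s. B i s \<omega>)"
    and Z0: "Z \<in> null_sets M"
    using AE_E3[OF solution_path_AE[OF assms]] by blast
  have [measurable]: "Z \<in> sets M" using Z0 by auto
  define X' where "X' = (\<lambda>i s \<omega>. if \<omega> \<in> Z then 0 else X i s \<omega>)"
  define B' where "B' = (\<lambda>i s \<omega>. if \<omega> \<in> Z then 0 else B i s \<omega>)"
  have nZ: "AE \<omega> in M. \<omega> \<notin> Z" using Z0 by (rule AE_not_in)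
  have F: "filtration_on M F" and adX: "\<And>i. i \<in> {1..N} \<Longrightarrow> adapted F (X i)"
    and adB: "\<And>i. i \<in> {1..N} \<Longrightarrow> adapted F (B i)"
    using sol by (auto simp: solution_def independent_brownian_motions_def)
  have Xm: "X i s \<in> borel_measurable M" and Bm: "B i s \<in> borel_measurable M"
    if "i \<in> {1..N}" "0 \<le> s" for i s
  proof -
    have sub: "subalgebra M (F s)" using F that(2) by (simp add: filtration_on_def)
    show "X i s \<in> borel_measurable M" "B i s \<in> borel_measurable M"
      using measurable_from_subalg[OF sub] adX[OF that(1)] adB[OF that(1)] that(2) by (auto simp: adapted_def)
  qed
  have cont: "continuous_on UNIV (\<lambda>s. g (max 0 s))" if "continuous_on {0..} g" for g :: "real \<Rightarrow> real"
    by (rule continuous_on_compose2[OF that]) (auto intro!: continuous_intros)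
  have "regular_solution M N \<alpha> \<sigma> K U' X' B'"
  proof
    fix i assume i: "i \<in> {1..N}"
    show "(\<lambda>(\<omega>, s). X' i (max 0 s) \<omega>) \<in> borel_measurable (M \<Otimes>\<^sub>M borel)"
    proof (rule continuous_process_measurable)
      show "X' i (max 0 s) \<in> borel_measurable M" for s
        using Xm[OF i, of "max 0 s"] unfolding X'_def by measurable
      fix \<omega> assume "\<omega> \<in> space M"
      then show "continuous_on UNIV (\<lambda>s. X' i (max 0 s) \<omega>)"
        using cont[OF repulsive_path.cont_x[OF Z i]] by (cases "\<omega> \<in> Z") (auto simp: X'_def)
    qed
    show "(\<lambda>(\<omega>, s). B' i (max 0 s) \<omega>) \<in> borel_measurable (M \<Otimes>\<^sub>M borel)"
    proof (rule continuous_process_measurable)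
      show "B' i (max 0 s) \<in> borel_measurable M" for s
        using Bm[OF i, of "max 0 s"] unfolding B'_def by measurable
      fix \<omega> assume "\<omega> \<in> space M"
      then show "continuous_on UNIV (\<lambda>s. B' i (max 0 s) \<omega>)"
        using cont[OF repulsive_path.cont_w[OF Z i]] by (cases "\<omega> \<in> Z") (auto simp: B'_def)
    qed
    fix s r :: real assume s: "0 \<le> s" "s < r"
    have [measurable]: "B i s \<in> borel_measurable M" "B i r \<in> borel_measurable M" "X i s \<in> borel_measurable M"
      using Bm[OF i, of s] Bm[OF i, of r] Xm[OF i, of s] s by auto
    have [measurable]: "B' i s \<in> borel_measurable M" "B' i r \<in> borel_measurable M" "X' i s \<in> borel_measurable M"
      unfolding B'_def X'_def by measurable
    note bm = solution_brownian[OF sol i s]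
    have e: "AE \<omega> in M. (B' i r \<omega> - B' i s \<omega>)\<^sup>2 = (B i r \<omega> - B i s \<omega>)\<^sup>2"
      using nZ by eventually_elim (simp add: B'_def)
    show "integrable M (\<lambda>\<omega>. (B' i r \<omega> - B' i s \<omega>)\<^sup>2) \<and>
        expectation (\<lambda>\<omega>. (B' i r \<omega> - B' i s \<omega>)\<^sup>2) = r - s"
      using integrable_cong_AE[OF _ _ e] integral_cong_AE[OF _ _ e] bm(1,2) by simp
    fix g :: "real \<Rightarrow> real" assume g[measurable]: "g \<in> borel_measurable borel" and b: "bounded (range g)"
    have "AE \<omega> in M. g (X' i s \<omega>) * (B' i r \<omega> - B' i s \<omega>) = g (X i s \<omega>) * (B i r \<omega> - B i s \<omega>)"
      using nZ by eventually_elim (simp add: X'_def B'_def)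
    from integral_cong_AE[OF _ _ this]
    show "expectation (\<lambda>\<omega>. g (X' i s \<omega>) * (B' i r \<omega> - B' i s \<omega>)) = 0"
      using bm(3)[OF g b] by simp
  next
    show "AE \<omega> in M. repulsive_path N \<alpha> \<sigma> K U' (\<lambda>i s. X' i s \<omega>) (\<lambda>i s. B' i s \<omega>)"
      using nZ AE_space by eventually_elim (use Z in \<open>auto simp: X'_def B'_def\<close>)
  qed (use N \<sigma> K U' in auto)
  moreover have "AE \<omega> in M. \<forall>i t. X' i t \<omega> = X i t \<omega>"
    using nZ by eventually_elim (simp add: X'_def)
  ultimately show ?thesis by blast
qed

section \<open>Moment and energy bounds in expectation\<close>

context regular_solution
begin

lemma section_measurable:
  assumes Y: "(\<lambda>(\<omega>, s). Y (max 0 s) \<omega>) \<in> borel_measurable (M \<Otimes>\<^sub>M borel)" and s: "0 \<le> s"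
  shows "(Y s :: 'a \<Rightarrow> real) \<in> borel_measurable M"
proof -
  have "(\<lambda>\<omega>. (\<omega>, s)) \<in> measurable M (M \<Otimes>\<^sub>M borel)" by simp
  from measurable_compose[OF this Y] s show ?thesis by (simp add: max_absorb2)
qed

lemma X_M: "i \<in> {1..N} \<Longrightarrow> 0 \<le> s \<Longrightarrow> X i s \<in> borel_measurable M"
  and B_M: "i \<in> {1..N} \<Longrightarrow> 0 \<le> s \<Longrightarrow> B i s \<in> borel_measurable M"
  using section_measurable[OF X_joint] section_measurable[OF B_joint] by auto

end

text \<open>Convergence of the empirical measures yields integrability at a given time only for
  large \<open>N\<close>, with a threshold that depends on the time. Hence it is assumed at the two
  ends; the times between are handled on the product space.\<close>

locale regular_solution_on = regular_solution +
  fixes T :: real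
  assumes T: "0 \<le> T"
    and X_0: "\<And>i. i \<in> {1..N} \<Longrightarrow> integrable M (X i 0)"
    and X_T: "\<And>i. i \<in> {1..N} \<Longrightarrow> integrable M (X i T)"
begin

abbreviation L :: "real measure" where "L \<equiv> restrict_space lborel {0..T}"
abbreviation P :: "('a \<times> real) measure" where "P \<equiv> M \<Otimes>\<^sub>M L"

sublocale L: finite_measure L
  by (rule finite_measureI) (use T in \<open>simp add: emeasure_restrict_space\<close>)

sublocale pair_sigma_finite M L ..

lemma measure_L: "measure L {0..T} = T"
  using T by (simp add: measure_restrict_space)

lemma integral_L: "(LINT s|L. g s) = (LBINT s:{0..T}. g s)" for g :: "real \<Rightarrow> real"
  by (simp add: set_lebesgue_integral_def integral_restrict_space)

lemma integrable_L: "integrable L g \<longleftrightarrow> set_integrable lborel {0..T} g" for g :: "real \<Rightarrow> real"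
  by (simp add: set_integrable_eq)

lemma measurable_L_borel: "g \<in> borel_measurable borel \<Longrightarrow> g \<in> borel_measurable L"
  by (rule measurable_restrict_space1) simp

lemma process_measurable:
  assumes Y: "(\<lambda>(\<omega>, s). Y (max 0 s) \<omega>) \<in> borel_measurable (M \<Otimes>\<^sub>M borel)"
    and c: "c \<in> borel_measurable borel" "\<And>s. s \<in> {0..T} \<Longrightarrow> 0 \<le> c s"
  shows "(\<lambda>z. Y (c (snd z)) (fst z) :: real) \<in> borel_measurable P"
proof -
  have "(\<lambda>z. c (snd z)) \<in> borel_measurable P"
    using measurable_L_borel[OF c(1)] by measurable
  then have "(\<lambda>z. (fst z, c (snd z))) \<in> measurable P (M \<Otimes>\<^sub>M borel)"
    by measurable
  from measurable_compose[OF this Y]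
  have "(\<lambda>z. Y (max 0 (c (snd z))) (fst z)) \<in> borel_measurable P" by simp
  then show ?thesis
    by (rule measurable_cong[THEN iffD1, rotated])
       (use c(2) in \<open>auto simp: space_pair_measure max_absorb2\<close>)
qed

lemmas X_time = process_measurable[OF X_joint] and B_time = process_measurable[OF B_joint]

lemma X_P: "i \<in> {1..N} \<Longrightarrow> (\<lambda>z. X i (snd z) (fst z)) \<in> borel_measurable P"
  and B_P: "i \<in> {1..N} \<Longrightarrow> (\<lambda>z. B i (snd z) (fst z)) \<in> borel_measurable P"
  using X_time[of i "\<lambda>s. s"] B_time[of i "\<lambda>s. s"] by auto

lemma AE_P:
  assumes "AE \<omega> in M. Q \<omega>"
  shows "AE z in P. Q (fst z)"
proof -
  obtain Z where Z: "\<And>\<omega>. \<omega> \<in> space M - Z \<Longrightarrow> Q \<omega>" "Z \<in> null_sets M"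
    using AE_E3[OF assms] by blast
  have "Z \<times> space L \<in> null_sets P"
  proof (rule null_setsI)
    have Z': "Z \<in> sets M" "emeasure M Z = 0" using Z(2) by auto
    show "Z \<times> space L \<in> sets P" using Z'(1) by (rule pair_measureI) (rule sets.top)
    show "emeasure P (Z \<times> space L) = 0"
      using L.emeasure_pair_measure_Times[OF Z'(1) sets.top] Z'(2) by simp
  qed
  then show ?thesis
    by (rule AE_I') (use Z(1) in \<open>fastforce simp: space_pair_measure\<close>)
qed

lemma integrable_P_fst:
  fixes g :: "'a \<Rightarrow> real"
  assumes "integrable M g"
  shows "integrable P (\<lambda>z. g (fst z))"
proof (rule integrableI_bounded)
  have [measurable]: "g \<in> borel_measurable M" using assms by auto
  show "(\<lambda>z. g (fst z)) \<in> borel_measurable P" by measurable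
  have "(\<integral>\<^sup>+z. ennreal (norm (g (fst z))) \<partial>P) = (\<integral>\<^sup>+\<omega>. ennreal (norm (g \<omega>)) * emeasure L (space L) \<partial>M)"
    by (simp add: L.nn_integral_fst[symmetric] del: space_restrict_space)
  also have "\<dots> = (\<integral>\<^sup>+\<omega>. ennreal (norm (g \<omega>)) \<partial>M) * emeasure L (space L)"
    by (simp add: nn_integral_multc)
  also have "\<dots> < \<infinity>"
    using assms T by (simp add: integrable_iff_bounded ennreal_mult_less_top emeasure_restrict_space)
  finally show "(\<integral>\<^sup>+z. ennreal (norm (g (fst z))) \<partial>P) < \<infinity>" .
qed

text \<open>Tonelli with time as the inner variable: the way from pathwise estimates to estimates in
  expectation.\<close>

lemma integrable_P_pathwise:
  fixes h :: "'a \<times> real \<Rightarrow> real"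
  assumes h[measurable]: "h \<in> borel_measurable P" "\<And>z. 0 \<le> h z" and r: "integrable M r"
    and le: "AE \<omega> in M. integrable L (\<lambda>s. h (\<omega>, s)) \<and> (LINT s|L. h (\<omega>, s)) \<le> r \<omega>"
  shows "integrable P h" "(LINT z|P. h z) \<le> expectation r"
proof -
  have "(\<integral>\<^sup>+z. ennreal (norm (h z)) \<partial>P) = (\<integral>\<^sup>+\<omega>. \<integral>\<^sup>+s. ennreal (h (\<omega>, s)) \<partial>L \<partial>M)"
    using h(2) by (simp add: L.nn_integral_fst[symmetric])
  also have "\<dots> \<le> (\<integral>\<^sup>+\<omega>. ennreal (norm (r \<omega>)) \<partial>M)"
  proof (rule nn_integral_mono_AE)
    show "AE \<omega> in M. (\<integral>\<^sup>+s. ennreal (h (\<omega>, s)) \<partial>L) \<le> ennreal (norm (r \<omega>))"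
      using le
    proof eventually_elim
      case (elim \<omega>)
      then have "(\<integral>\<^sup>+s. ennreal (h (\<omega>, s)) \<partial>L) = ennreal (LINT s|L. h (\<omega>, s))"
        using h(2) by (intro nn_integral_eq_integral) auto
      also have "\<dots> \<le> ennreal (norm (r \<omega>))" using elim by (intro ennreal_leI) auto
      finally show ?case .
    qed
  qed
  also have "\<dots> < \<infinity>" using r by (simp add: integrable_iff_bounded)
  finally show i: "integrable P h" by (intro integrableI_bounded h)
  have "(LINT z|P. h z) = expectation (\<lambda>\<omega>. LINT s|L. h (\<omega>, s))"
    using i by (simp add: integral_fst')
  also have "\<dots> \<le> expectation r"
    using integrable_fst'[OF i] r le by (intro integral_mono_AE) auto
  finally show "(LINT z|P. h z) \<le> expectation r" .
qed

text \<open>Tonelli in the other order, for quantities such as the noise whose moments are known at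
  each time.\<close>

lemma integrable_P_timewise:
  fixes h :: "'a \<times> real \<Rightarrow> real"
  assumes h[measurable]: "h \<in> borel_measurable P" "\<And>z. 0 \<le> h z"
    and c: "\<And>s. s \<in> {0..T} \<Longrightarrow> integrable M (\<lambda>\<omega>. h (\<omega>, s)) \<and> expectation (\<lambda>\<omega>. h (\<omega>, s)) \<le> c"
  shows "integrable P h" "(LINT z|P. h z) \<le> c * T"
proof -
  have c0: "0 \<le> c"
    using c[of 0] T h(2) Bochner_Integration.integral_nonneg[of M "\<lambda>\<omega>. h (\<omega>, 0)"] by fastforce
  have "(\<integral>\<^sup>+z. ennreal (norm (h z)) \<partial>P) = (\<integral>\<^sup>+s. \<integral>\<^sup>+\<omega>. ennreal (h (\<omega>, s)) \<partial>M \<partial>L)"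
    using h(2) by (subst nn_integral_snd[symmetric]) auto
  also have "\<dots> \<le> (\<integral>\<^sup>+s. ennreal c \<partial>L)"
  proof (rule nn_integral_mono)
    fix s assume "s \<in> space L"
    then have s: "s \<in> {0..T}" by simp
    have "(\<integral>\<^sup>+\<omega>. ennreal (h (\<omega>, s)) \<partial>M) = ennreal (expectation (\<lambda>\<omega>. h (\<omega>, s)))"
      using h(2) c[OF s] by (intro nn_integral_eq_integral) auto
    also have "\<dots> \<le> ennreal c" using c[OF s] by (intro ennreal_leI) auto
    finally show "(\<integral>\<^sup>+\<omega>. ennreal (h (\<omega>, s)) \<partial>M) \<le> ennreal c" .
  qed
  also have "\<dots> = ennreal (c * T)"
    using T c0 by (simp add: emeasure_restrict_space ennreal_mult)
  finally have le: "(\<integral>\<^sup>+z. ennreal (norm (h z)) \<partial>P) \<le> ennreal (c * T)" .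
  then show i: "integrable P h"
    by (intro integrableI_bounded h) (auto intro: le_less_trans)
  have "ennreal (LINT z|P. h z) \<le> ennreal (c * T)"
    using le h(2) by (subst nn_integral_eq_integral[OF i, symmetric]) auto
  then show "(LINT z|P. h z) \<le> c * T"
    using c0 T by (simp add: ennreal_le_iff)
qed

text \<open>The constant comes from \<open>|b| \<le> 1 + b^2\<close> and the variance
  \<open>s\<close>.\<close>

lemma B_moment:
  assumes i: "i \<in> {1..N}" and s: "0 \<le> s"
  shows "integrable M (B i s)" "expectation (\<lambda>\<omega>. \<bar>B i s \<omega>\<bar>) \<le> 1 + s"
proof -
  note [measurable] = B_M[OF i s] B_M[OF i order_refl]
  have B0: "AE \<omega> in M. B i 0 \<omega> = 0"
    using path_AE by eventually_elim (use repulsive_path.w_0 i in blast)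
  have "integrable M (B i s) \<and> expectation (\<lambda>\<omega>. \<bar>B i s \<omega>\<bar>) \<le> 1 + s"
  \<comment> \<open>\<open>B_square\<close> covers increments of positive length, and
    \<open>B i 0\<close> vanishes only almost surely.\<close>
  proof (cases "s = 0")
    case True
    have "integrable M (B i s) \<longleftrightarrow> integrable M (\<lambda>_. 0 :: real)"
      using B0 True by (intro integrable_cong_AE) auto
    moreover have "expectation (\<lambda>\<omega>. \<bar>B i s \<omega>\<bar>) = expectation (\<lambda>_. 0)"
      using B0 True by (intro integral_cong_AE) auto
    ultimately show ?thesis using s by simp
  next
    case False
    then have s': "0 < s" using s by simp
    note sq = B_square[OF i order_refl s']
    have e: "AE \<omega> in M. B i s \<omega> - B i 0 \<omega> = B i s \<omega>" using B0 by eventually_elim simp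
    have "integrable M (\<lambda>\<omega>. B i s \<omega> - B i 0 \<omega>)"
      by (rule expectation_abs_le_sqrt(1)) (use sq in auto)
    then have iB: "integrable M (B i s)" using integrable_cong_AE[OF _ _ e] by simp
    have "AE \<omega> in M. \<bar>B i s \<omega>\<bar> \<le> 1 + (B i s \<omega> - B i 0 \<omega>)\<^sup>2"
      using B0
    proof eventually_elim
      case (elim \<omega>)
      have "\<bar>b\<bar> \<le> 1 + b\<^sup>2" for b :: real
        using zero_le_power2[of "\<bar>b\<bar> - 1 / 2"] by (simp add: power2_eq_square algebra_simps)
      then show ?case using elim by simp
    qed
    then have "expectation (\<lambda>\<omega>. \<bar>B i s \<omega>\<bar>) \<le> expectation (\<lambda>\<omega>. 1 + (B i s \<omega> - B i 0 \<omega>)\<^sup>2)"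
      using iB sq by (intro integral_mono_AE) auto
    also have "\<dots> = 1 + s" using sq by (simp add: prob_space)
    finally show ?thesis using iB by simp
  qed
  then show "integrable M (B i s)" "expectation (\<lambda>\<omega>. \<bar>B i s \<omega>\<bar>) \<le> 1 + s" by auto
qed

definition noise :: "'a \<times> real \<Rightarrow> real" where
  "noise z = sqrt (2 * \<sigma>) * (\<Sum>i = 1..N. \<bar>B i (snd z) (fst z)\<bar>) / N"

lemma noise_nonneg: "0 \<le> noise z"
  unfolding noise_def by (intro divide_nonneg_nonneg mult_nonneg_nonneg sum_nonneg) (use \<sigma> in auto)

lemma noise_section:
  assumes s: "s \<in> {0..T}"
  shows "integrable M (\<lambda>\<omega>. noise (\<omega>, s))" "expectation (\<lambda>\<omega>. noise (\<omega>, s)) \<le> sqrt (2 * \<sigma>) * (1 + T)"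
proof -
  have le: "expectation (\<lambda>\<omega>. \<bar>B i s \<omega>\<bar>) \<le> 1 + T" if "i \<in> {1..N}" for i
    using B_moment(2)[OF that, of s] s by auto
  have i: "integrable M (\<lambda>\<omega>. \<Sum>i = 1..N. \<bar>B i s \<omega>\<bar>)"
    using s B_moment by (intro Bochner_Integration.integrable_sum integrable_abs) auto
  then show "integrable M (\<lambda>\<omega>. noise (\<omega>, s))" by (simp add: noise_def)
  have "expectation (\<lambda>\<omega>. noise (\<omega>, s)) = sqrt (2 * \<sigma>) * (\<Sum>i = 1..N. expectation (\<lambda>\<omega>. \<bar>B i s \<omega>\<bar>)) / N"
    using s B_moment by (simp add: noise_def)
  also have "\<dots> \<le> sqrt (2 * \<sigma>) * (\<Sum>i = 1..N. 1 + T) / N"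
    using le \<sigma> by (intro divide_right_mono mult_left_mono sum_mono) auto
  also have "\<dots> = sqrt (2 * \<sigma>) * (1 + T)" using N by simp
  finally show "expectation (\<lambda>\<omega>. noise (\<omega>, s)) \<le> sqrt (2 * \<sigma>) * (1 + T)" .
qed

lemma noise_measurable: "noise \<in> borel_measurable P"
  unfolding noise_def[abs_def] using B_P by (intro borel_measurable_divide borel_measurable_times borel_measurable_sum) auto

lemma noise_integrable:
  shows "integrable P noise" "(LINT z|P. noise z) \<le> sqrt (2 * \<sigma>) * (1 + T) * T"
  using integrable_P_timewise[OF noise_measurable noise_nonneg, of "sqrt (2 * \<sigma>) * (1 + T)"] noise_section
  by auto

abbreviation configuration :: "'a \<times> real \<Rightarrow> nat \<Rightarrow> real" where
  "configuration z \<equiv> \<lambda>i. X i (snd z) (fst z)"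

lemma energy_measurable:
  "(\<lambda>z. ranked_energy N \<beta> (configuration z)) \<in> borel_measurable P"
  "(\<lambda>z. riesz_energy N \<beta> (configuration z)) \<in> borel_measurable P"
proof -
  have [measurable]: "(\<lambda>z. \<bar>X i (snd z) (fst z) - X j (snd z) (fst z)\<bar> powr (- \<beta>)) \<in> borel_measurable P"
    if "i \<in> {1..N}" "j \<in> {1..N}" for i j
    using X_P[OF that(1)] X_P[OF that(2)] by measurable
  show "(\<lambda>z. ranked_energy N \<beta> (configuration z)) \<in> borel_measurable P"
    unfolding ranked_energy_def by (intro borel_measurable_divide borel_measurable_sum borel_measurable_times) auto
  show "(\<lambda>z. riesz_energy N \<beta> (configuration z)) \<in> borel_measurable P"
    unfolding riesz_energy_def by (intro borel_measurable_divide borel_measurable_sum) auto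
qed

text \<open>Expectation of the pathwise estimate; the noise at \<open>T\<close> and its time
  integral contribute \<open>1 + T\<close> and \<open>(1 + T) * T\<close>. Only the first moment at
  the final time is left on the right.\<close>

lemma ranked_energy_bound:
  shows "integrable P (\<lambda>z. ranked_energy N \<alpha> (configuration z))"
    and "(LINT z|P. ranked_energy N \<alpha> (configuration z)) \<le> (1 + K * exp (K * T) * (1 + T)) *
      (expectation (\<lambda>\<omega>. (\<Sum>i = 1..N. \<bar>X i T \<omega>\<bar>) / N) + sqrt (2 * \<sigma>) * (1 + T)\<^sup>2)"
proof -
  define C where "C = 1 + K * exp (K * T) * (1 + T)"
  have C: "0 \<le> C" unfolding C_def using K T by simp
  define A where "A = (\<lambda>\<omega>. (\<Sum>i = 1..N. \<bar>X i T \<omega>\<bar>) / N)"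
  define r where "r = (\<lambda>\<omega>. C * (A \<omega> + noise (\<omega>, T) + (LINT s|L. noise (\<omega>, s))))"
  have A: "integrable M A"
    unfolding A_def using X_T by (intro integrable_divide Bochner_Integration.integrable_sum) auto
  have T': "T \<in> {0..T}" using T by simp
  note n = noise_section[OF T'] integrable_fst'[OF noise_integrable(1)]
  have r: "integrable M r" unfolding r_def using A n by simp
  have "expectation r = C * (expectation A + expectation (\<lambda>\<omega>. noise (\<omega>, T)) + (LINT z|P. noise z))"
    unfolding r_def using A n integral_fst'[OF noise_integrable(1)] by simp
  also have "\<dots> \<le> C * (expectation A + sqrt (2 * \<sigma>) * (1 + T) + sqrt (2 * \<sigma>) * (1 + T) * T)"
    using C n(2) noise_integrable(2) by (intro mult_left_mono add_mono) auto
  also have "\<dots> = C * (expectation A + sqrt (2 * \<sigma>) * (1 + T)\<^sup>2)"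
    by (simp add: power2_eq_square algebra_simps)
  finally have Er: "expectation r \<le> C * (expectation A + sqrt (2 * \<sigma>) * (1 + T)\<^sup>2)" .
  have le: "AE \<omega> in M. integrable L (\<lambda>s. ranked_energy N \<alpha> (configuration (\<omega>, s))) \<and>
      (LINT s|L. ranked_energy N \<alpha> (configuration (\<omega>, s))) \<le> r \<omega>"
    using path_AE
  proof eventually_elim
    case (elim \<omega>)
    show ?case
      using repulsive_path.ranked_energy_integrable[OF elim T] repulsive_path.ranked_energy_integral_le[OF elim T]
      by (simp add: integrable_L integral_L r_def A_def C_def noise_def repulsive_path.noise_def[OF elim])
  qed
  note b = integrable_P_pathwise[OF energy_measurable(1) ranked_energy_nonneg r le]
  show "integrable P (\<lambda>z. ranked_energy N \<alpha> (configuration z))" by (rule b(1))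
  show "(LINT z|P. ranked_energy N \<alpha> (configuration z)) \<le> (1 + K * exp (K * T) * (1 + T)) *
      (expectation (\<lambda>\<omega>. (\<Sum>i = 1..N. \<bar>X i T \<omega>\<bar>) / N) + sqrt (2 * \<sigma>) * (1 + T)\<^sup>2)"
    using order_trans[OF b(2) Er] by (simp add: C_def A_def)
qed

lemma riesz_energy_bound:
  assumes \<beta>: "0 < \<beta>" "2 * \<beta> < \<alpha>"
  shows "integrable P (\<lambda>z. riesz_energy N \<beta> (configuration z))"
    and "(LINT z|P. riesz_energy N \<beta> (configuration z)) \<le>
      2 * (LINT z|P. ranked_energy N \<alpha> (configuration z)) + 2 / (1 - \<beta> / (\<alpha> - \<beta>)) * T"
proof -
  define c where "c = 2 / (1 - \<beta> / (\<alpha> - \<beta>))"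
  define r where "r = (\<lambda>\<omega>. 2 * (LINT s|L. ranked_energy N \<alpha> (configuration (\<omega>, s))) + c * T)"
  note ri = integrable_fst'[OF ranked_energy_bound(1)]
  have r: "integrable M r" unfolding r_def using ri by simp
  have Er: "expectation r = 2 * (LINT z|P. ranked_energy N \<alpha> (configuration z)) + c * T"
    unfolding r_def using ri integral_fst'[OF ranked_energy_bound(1)] by (simp add: prob_space)
  have m: "AE \<omega> in M. (\<lambda>s. riesz_energy N \<beta> (configuration (\<omega>, s))) \<in> borel_measurable L"
    by (rule AE_I2) (rule measurable_compose[OF measurable_Pair1' energy_measurable(2)])
  have le: "AE \<omega> in M. integrable L (\<lambda>s. riesz_energy N \<beta> (configuration (\<omega>, s))) \<and>
      (LINT s|L. riesz_energy N \<beta> (configuration (\<omega>, s))) \<le> r \<omega>"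
    using path_AE m
  proof eventually_elim
    case (elim \<omega>)
    interpret path: repulsive_path N \<alpha> \<sigma> K U' "\<lambda>i s. X i s \<omega>" "\<lambda>i s. B i s \<omega>" by (rule elim(1))
    have i: "integrable L (\<lambda>s. 2 * ranked_energy N \<alpha> (\<lambda>i. X i s \<omega>) + c)"
      using path.ranked_energy_integrable[OF T] by (auto simp: integrable_L[symmetric])
    have ae: "AE s in L. riesz_energy N \<beta> (\<lambda>i. X i s \<omega>) \<le> 2 * ranked_energy N \<alpha> (\<lambda>i. X i s \<omega>) + c"
      unfolding c_def using path.ordered_AE
      by (subst AE_restrict_space_iff) (auto intro!: riesz_energy_le N \<beta> elim!: eventually_mono)
    have j: "integrable L (\<lambda>s. riesz_energy N \<beta> (\<lambda>i. X i s \<omega>))"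
      by (rule Bochner_Integration.integrable_bound[OF i])
         (use elim(2) ae riesz_energy_nonneg[of N \<beta>] in \<open>auto elim!: eventually_mono\<close>)
    have "(LINT s|L. riesz_energy N \<beta> (\<lambda>i. X i s \<omega>)) \<le> (LINT s|L. 2 * ranked_energy N \<alpha> (\<lambda>i. X i s \<omega>) + c)"
      by (rule integral_mono_AE[OF j i ae])
    also have "\<dots> = r \<omega>"
      using path.ranked_energy_integrable[OF T] by (simp add: integrable_L[symmetric] r_def measure_L)
    finally show ?case using j by simp
  qed
  note b = integrable_P_pathwise[OF energy_measurable(2) riesz_energy_nonneg r le]
  show "integrable P (\<lambda>z. riesz_energy N \<beta> (configuration z))" by (rule b(1))
  show "(LINT z|P. riesz_energy N \<beta> (configuration z)) \<le>
      2 * (LINT z|P. ranked_energy N \<alpha> (configuration z)) + 2 / (1 - \<beta> / (\<alpha> - \<beta>)) * T"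
    using b(2) Er by (simp add: c_def)
qed

text \<open>Distinct ranks differ by at least 1, so a single force is at most \<open>2 * N^3\<close>
  times the ranked energy. The bound degenerates with \<open>N\<close> but gives integrability for
  each fixed system.\<close>

lemma force_integrable_P:
  assumes i: "i \<in> {1..N}" and j: "j \<in> {1..N}"
  shows "integrable P (\<lambda>z. V_deriv \<alpha> (configuration z i - configuration z j))"
proof (cases "i = j")
  case False
  show ?thesis
  proof (rule Bochner_Integration.integrable_bound)
    show "integrable P (\<lambda>z. 2 * (real N) ^ 3 * ranked_energy N \<alpha> (configuration z))"
      using ranked_energy_bound(1) by simp
    show "(\<lambda>z. V_deriv \<alpha> (configuration z i - configuration z j)) \<in> borel_measurable P"
      using X_P[OF i] X_P[OF j] by measurable
    have "\<bar>V_deriv \<alpha> (y i - y j)\<bar> \<le> 2 * (real N) ^ 3 * ranked_energy N \<alpha> y" for y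
    proof -
      have "1 * \<bar>y i - y j\<bar> powr (- \<alpha>) \<le> \<bar>real i - real j\<bar> * \<bar>y i - y j\<bar> powr (- \<alpha>)"
        using False by (intro mult_right_mono) auto
      also have "\<dots> = N * (\<bar>real i - real j\<bar> / N * \<bar>y i - y j\<bar> powr (- \<alpha>))" using N by simp
      also have "\<bar>real i - real j\<bar> / N * \<bar>y i - y j\<bar> powr (- \<alpha>)
          \<le> (\<Sum>j = 1..N. \<bar>real i - real j\<bar> / N * \<bar>y i - y j\<bar> powr (- \<alpha>))"
        by (rule member_le_sum[OF j, where f="\<lambda>j. \<bar>real i - real j\<bar> / N * \<bar>y i - y j\<bar> powr (- \<alpha>)"]) auto
      also have "\<dots> \<le> (\<Sum>i = 1..N. \<Sum>j = 1..N. \<bar>real i - real j\<bar> / N * \<bar>y i - y j\<bar> powr (- \<alpha>))"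
        by (rule member_le_sum[OF i, where f="\<lambda>i. \<Sum>j = 1..N. \<bar>real i - real j\<bar> / N * \<bar>y i - y j\<bar> powr (- \<alpha>)"])
           (auto intro: sum_nonneg)
      also have "\<dots> = 2 * (real N)\<^sup>2 * ranked_energy N \<alpha> y" using N by (simp add: ranked_energy_def)
      finally show ?thesis using N by (simp add: abs_V_deriv power2_eq_square power3_eq_cube)
    qed
    then show "AE z in P. norm (V_deriv \<alpha> (configuration z i - configuration z j))
        \<le> norm (2 * (real N) ^ 3 * ranked_energy N \<alpha> (configuration z))"
      by (auto intro!: AE_I2 order_trans[OF _ abs_ge_self])
  qed
qed simp

lemma position_integrable_P:
  assumes i: "i \<in> {1..N}"
  shows "integrable P (\<lambda>z. configuration z i)"
proof -
  define V where "V = (\<lambda>j z. \<bar>V_deriv \<alpha> (configuration z i - configuration z j)\<bar>)"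
  define h where "h = (\<lambda>z. \<bar>X i 0 (fst z)\<bar> + \<bar>U' 0\<bar> * T + 1 / N * (\<Sum>j = 1..N. LINT u|L. V j (fst z, u))
    + sqrt (2 * \<sigma>) * \<bar>B i (snd z) (fst z)\<bar>)"
  have V: "integrable P (V j)" if "j \<in> {1..N}" for j
    unfolding V_def using force_integrable_P[OF i that] by simp
  have iB: "integrable P (\<lambda>z. \<bar>B i (snd z) (fst z)\<bar>)"
  proof (rule integrable_P_timewise(1)[where c="1 + T"])
    fix s assume "s \<in> {0..T}"
    then show "integrable M (\<lambda>\<omega>. \<bar>B i (snd (\<omega>, s)) (fst (\<omega>, s))\<bar>) \<and>
        expectation (\<lambda>\<omega>. \<bar>B i (snd (\<omega>, s)) (fst (\<omega>, s))\<bar>) \<le> 1 + T"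
      using B_moment[OF i, of s] by auto
  qed (use B_P[OF i] in auto)
  have h: "integrable P h"
    unfolding h_def
  proof (intro Bochner_Integration.integrable_add integrable_mult_right)
    show "integrable P (\<lambda>z. \<bar>X i 0 (fst z)\<bar>)" using integrable_P_fst[OF X_0[OF i]] by simp
    show "integrable P (\<lambda>z. T)" by (rule integrable_P_fst) simp
    show "integrable P (\<lambda>z. \<Sum>j = 1..N. LINT u|L. V j (fst z, u))"
      by (intro integrable_P_fst Bochner_Integration.integrable_sum integrable_fst' V)
  qed (rule iB)
  have r: "integrable M (\<lambda>\<omega>. exp (K * T) * (LINT s|L. h (\<omega>, s)))"
    using integrable_fst'[OF h] by simp
  have le: "AE \<omega> in M. integrable L (\<lambda>s. \<bar>configuration (\<omega>, s) i\<bar>) \<and>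
      (LINT s|L. \<bar>configuration (\<omega>, s) i\<bar>) \<le> exp (K * T) * (LINT s|L. h (\<omega>, s))"
    using path_AE
  proof eventually_elim
    case (elim \<omega>)
    interpret path: repulsive_path N \<alpha> \<sigma> K U' "\<lambda>i s. X i s \<omega>" "\<lambda>i s. B i s \<omega>" by (rule elim)
    show ?case
      using path.position_integral_le[OF T i] set_integrable_continuous[OF path.cont_x[OF i]]
      by (simp add: integrable_L integral_L h_def V_def set_integrable_abs)
  qed
  have "integrable P (\<lambda>z. \<bar>configuration z i\<bar>)"
    by (rule integrable_P_pathwise(1)[OF _ _ r le]) (use X_P[OF i] in auto)
  then show ?thesis using integrable_abs_cancel[OF _ X_P[OF i]] by blast
qed

lemma U'_measurable[measurable]: "U' \<in> borel_measurable borel"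
  using lipschitz_bound_continuous[OF K U'_lip] by (rule borel_measurable_continuous_onI)

lemma confinement_integrable_P:
  assumes i: "i \<in> {1..N}"
  shows "integrable P (\<lambda>z. U' (configuration z i))"
proof (rule Bochner_Integration.integrable_bound)
  have "integrable P (\<lambda>z. \<bar>U' 0\<bar>)" by (rule integrable_P_fst) simp
  then show "integrable P (\<lambda>z. \<bar>U' 0\<bar> + K * \<bar>configuration z i\<bar>)"
    using position_integrable_P[OF i] by simp
  show "(\<lambda>z. U' (configuration z i)) \<in> borel_measurable P" using X_P[OF i] by measurable
  have "\<bar>U' y\<bar> \<le> \<bar>U' 0\<bar> + K * \<bar>y\<bar>" for y using U'_lip[of y 0] by simp
  then show "AE z in P. norm (U' (configuration z i)) \<le> norm (\<bar>U' 0\<bar> + K * \<bar>configuration z i\<bar>)"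
    by (auto intro!: AE_I2 order_trans[OF _ abs_ge_self])
qed

definition drift :: "nat \<Rightarrow> 'a \<times> real \<Rightarrow> real" where
  "drift i z = - U' (configuration z i) - 1 / N * (\<Sum>j = 1..N. V_deriv \<alpha> (configuration z i - configuration z j))"

lemma drift_integrable_P:
  assumes "i \<in> {1..N}"
  shows "integrable P (drift i)"
  unfolding drift_def[abs_def]
  using assms confinement_integrable_P force_integrable_P
  by (intro Bochner_Integration.integrable_diff integrable_minus integrable_mult_right
      Bochner_Integration.integrable_sum) auto

end

section \<open>Weak formulation for the particle system\<close>

lemma interaction_kernel_V_deriv:
  "interaction_kernel \<alpha> f' (x, y) = - ((f' x - f' y) * V_deriv \<alpha> (x - y))"
  by (simp add: interaction_kernel_def V_deriv_def minus_divide_left[symmetric] mult_minus_right[symmetric] del: mult_minus_right minus_diff_eq)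

lemma integrable_bounded_times:
  fixes g k :: "'a \<Rightarrow> real"
  assumes k: "integrable Q k" and g: "g \<in> borel_measurable Q" "\<And>z. \<bar>g z\<bar> \<le> C"
  shows "integrable Q (\<lambda>z. g z * k z)"
proof (rule Bochner_Integration.integrable_bound)
  show "integrable Q (\<lambda>z. C * k z)" using k by simp
  have "k \<in> borel_measurable Q" using k by auto
  with g(1) show "(\<lambda>z. g z * k z) \<in> borel_measurable Q" by measurable
  have "\<bar>g z\<bar> \<le> \<bar>C\<bar>" for z using g(2)[of z] by simp
  then show "AE z in Q. norm (g z * k z) \<le> norm (C * k z)"
    by (auto simp: abs_mult intro!: AE_I2 mult_right_mono)
qed

section \<open>Test functions and their first-order expansion\<close>

locale test_function =
  fixes f f' :: "real \<Rightarrow> real" and C\<^sub>1 C\<^sub>2 :: real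
  assumes deriv: "\<And>x. (f has_real_derivative f' x) (at x)"
    and bounded: "\<And>x. \<bar>f' x\<bar> \<le> C\<^sub>1"
    and lipschitz: "\<And>x y. \<bar>f' x - f' y\<bar> \<le> C\<^sub>2 * \<bar>x - y\<bar>"
begin

lemma C\<^sub>2_nonneg: "0 \<le> C\<^sub>2"
  using lipschitz[of 1 0] by simp

lemma C\<^sub>1_nonneg: "0 \<le> C\<^sub>1"
  using bounded[of 0] by simp

lemma mean_value: "\<exists>\<xi>. \<bar>\<xi> - y\<bar> \<le> \<bar>z - y\<bar> \<and> f z - f y = f' \<xi> * (z - y)"
proof -
  obtain \<xi> where "\<bar>\<xi> - y\<bar> \<le> \<bar>z - y\<bar>" "difference_quotient f f' y z = f' \<xi>"
    using difference_quotient_mvt[OF deriv] by blast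
  then show ?thesis by (intro exI[of _ \<xi>]) (auto simp: difference_quotient_def field_simps split: if_splits)
qed

lemma abs_diff_le: "\<bar>f z - f y\<bar> \<le> C\<^sub>1 * \<bar>z - y\<bar>"
  using mean_value[of y z] bounded by (auto simp: abs_mult mult_right_mono)

text \<open>Obtained from the mean value theorem and the Lipschitz bound on \<open>f'\<close>; the
  sharp factor 1/2 is given up, since only the quadratic order matters.\<close>

lemma taylor: "\<bar>f (x + w) - f x - f' x * w\<bar> \<le> C\<^sub>2 * w\<^sup>2"
proof -
  obtain \<xi> where \<xi>: "\<bar>\<xi> - x\<bar> \<le> \<bar>w\<bar>" "f (x + w) - f x = f' \<xi> * w"
    using mean_value[of x "x + w"] by auto
  have "\<bar>f (x + w) - f x - f' x * w\<bar> = \<bar>f' \<xi> - f' x\<bar> * \<bar>w\<bar>"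
    unfolding \<xi>(2) by (simp add: abs_mult[symmetric] left_diff_distrib)
  also have "\<dots> \<le> C\<^sub>2 * \<bar>w\<bar> * \<bar>w\<bar>"
    using lipschitz[of \<xi> x] mult_left_mono[OF \<xi>(1) C\<^sub>2_nonneg] by (intro mult_right_mono) auto
  finally show ?thesis by (simp add: power2_eq_square)
qed

lemma lipschitz_on_f': "C\<^sub>2-lipschitz_on UNIV f'"
  by (rule lipschitz_onI) (use lipschitz C\<^sub>2_nonneg in \<open>auto simp: dist_real_def\<close>)

lemma lipschitz_on_f: "C\<^sub>1-lipschitz_on UNIV f"
  by (rule lipschitz_onI) (use abs_diff_le C\<^sub>1_nonneg in \<open>auto simp: dist_real_def\<close>)

lemma f_measurable[measurable]: "f \<in> borel_measurable borel"
  by (rule lipschitz_borel_measurable[OF lipschitz_on_f])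

lemma f'_measurable[measurable]: "f' \<in> borel_measurable borel"
  by (rule lipschitz_borel_measurable[OF lipschitz_on_f'])

lemma difference_quotient_bound: "\<bar>difference_quotient f f' y z\<bar> \<le> C\<^sub>1"
  using difference_quotient_mvt[OF deriv, of y z] bounded by auto

lemma difference_quotient_near:
  "\<bar>difference_quotient f f' y z - f' x\<bar> \<le> C\<^sub>2 * (\<bar>y - x\<bar> + \<bar>z - y\<bar>)"
proof -
  obtain \<xi> where \<xi>: "\<bar>\<xi> - y\<bar> \<le> \<bar>z - y\<bar>" "difference_quotient f f' y z = f' \<xi>"
    using difference_quotient_mvt[OF deriv] by blast
  have "\<bar>f' \<xi> - f' x\<bar> \<le> C\<^sub>2 * \<bar>\<xi> - x\<bar>" by (rule lipschitz)
  also have "\<dots> \<le> C\<^sub>2 * (\<bar>y - x\<bar> + \<bar>z - y\<bar>)"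
    using \<xi>(1) by (intro mult_left_mono C\<^sub>2_nonneg) linarith
  finally show ?thesis by (simp add: \<xi>(2))
qed

lemma difference_quotient_measurable[measurable]:
  assumes [measurable]: "g \<in> borel_measurable M" "h \<in> borel_measurable M"
  shows "(\<lambda>x. difference_quotient f f' (g x) (h x)) \<in> borel_measurable M"
  unfolding difference_quotient_def by measurable

end

context regular_solution_on
begin

text \<open>To first order the increment acts through \<open>f' (X i s)\<close> times a centred
  variable independent of the past, which has expectation 0. The remainder is quadratic in a
  Gaussian of variance \<open>2 * \<sigma> * (r - s)\<close>.\<close>

lemma noise_step:
  assumes f: "test_function f f' C\<^sub>1 C\<^sub>2" and i: "i \<in> {1..N}" and s: "0 \<le> s" "s < r"
  defines "D \<equiv> \<lambda>\<omega>. f (X i s \<omega> + sqrt (2 * \<sigma>) * (B i r \<omega> - B i s \<omega>)) - f (X i s \<omega>)"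
  shows "integrable M D" "\<bar>expectation D\<bar> \<le> 2 * C\<^sub>2 * \<sigma> * (r - s)"
proof -
  interpret f: test_function f f' C\<^sub>1 C\<^sub>2 by (rule f)
  define w where "w = (\<lambda>\<omega>. sqrt (2 * \<sigma>) * (B i r \<omega> - B i s \<omega>))"
  have r: "0 \<le> r" using s by simp
  note [measurable] = B_M[OF i s(1)] B_M[OF i r] X_M[OF i s(1)]
  have iw: "integrable M w" unfolding w_def using B_moment(1)[OF i] s r by simp
  have w2: "(w \<omega>)\<^sup>2 = 2 * \<sigma> * (B i r \<omega> - B i s \<omega>)\<^sup>2" for \<omega>
    using \<sigma> by (simp add: w_def power_mult_distrib)
  have iw2: "integrable M (\<lambda>\<omega>. (w \<omega>)\<^sup>2)" and Ew2: "expectation (\<lambda>\<omega>. (w \<omega>)\<^sup>2) = 2 * \<sigma> * (r - s)"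
    using B_square[OF i s] by (simp_all add: w2)
  have D: "D = (\<lambda>\<omega>. f (X i s \<omega> + w \<omega>) - f (X i s \<omega>))" by (simp add: D_def w_def)
  have [measurable]: "w \<in> borel_measurable M" using iw by auto
  have Dm[measurable]: "D \<in> borel_measurable M" unfolding D by measurable
  show iD: "integrable M D"
  proof (rule Bochner_Integration.integrable_bound)
    show "integrable M (\<lambda>\<omega>. C\<^sub>1 * w \<omega>)" using iw by simp
    show "AE \<omega> in M. norm (D \<omega>) \<le> norm (C\<^sub>1 * w \<omega>)"
    proof (rule AE_I2)
      fix \<omega>
      show "norm (D \<omega>) \<le> norm (C\<^sub>1 * w \<omega>)"
        unfolding D using f.abs_diff_le[of "X i s \<omega> + w \<omega>" "X i s \<omega>"] f.C\<^sub>1_nonneg by (simp add: abs_mult)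
    qed
  qed (rule Dm)
  have ifw: "integrable M (\<lambda>\<omega>. f' (X i s \<omega>) * w \<omega>)"
  proof (rule Bochner_Integration.integrable_bound)
    show "integrable M (\<lambda>\<omega>. C\<^sub>1 * w \<omega>)" using iw by simp
    show "AE \<omega> in M. norm (f' (X i s \<omega>) * w \<omega>) \<le> norm (C\<^sub>1 * w \<omega>)"
      using f.bounded f.C\<^sub>1_nonneg by (intro AE_I2) (auto simp: abs_mult intro: mult_right_mono)
  qed measurable
  have "bounded (range f')" using f.bounded by (auto simp: bounded_iff)
  from B_orthogonal[OF i s f.f'_measurable this]
  have "expectation (\<lambda>\<omega>. sqrt (2 * \<sigma>) * (f' (X i s \<omega>) * (B i r \<omega> - B i s \<omega>))) = 0" by simp
  then have E0: "expectation (\<lambda>\<omega>. f' (X i s \<omega>) * w \<omega>) = 0" by (simp add: w_def mult.left_commute)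
  have "\<bar>expectation D\<bar> = \<bar>expectation (\<lambda>\<omega>. D \<omega> - f' (X i s \<omega>) * w \<omega>)\<bar>"
    using iD ifw E0 by simp
  also have "\<dots> \<le> expectation (\<lambda>\<omega>. \<bar>D \<omega> - f' (X i s \<omega>) * w \<omega>\<bar>)" by (rule integral_abs_bound)
  also have "\<dots> \<le> expectation (\<lambda>\<omega>. C\<^sub>2 * (w \<omega>)\<^sup>2)"
    using iD ifw iw2 f.taylor by (intro integral_mono) (auto simp: D)
  also have "\<dots> = 2 * C\<^sub>2 * \<sigma> * (r - s)" using Ew2 by simp
  finally show "\<bar>expectation D\<bar> \<le> 2 * C\<^sub>2 * \<sigma> * (r - s)" .
qed

lemma integrable_test_function:
  assumes f: "test_function f f' C\<^sub>1 C\<^sub>2" and Y: "integrable M (Y :: 'a \<Rightarrow> real)"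
  shows "integrable M (\<lambda>\<omega>. f (Y \<omega>))"
proof -
  interpret f: test_function f f' C\<^sub>1 C\<^sub>2 by (rule f)
  have [measurable]: "Y \<in> borel_measurable M" using Y by auto
  show ?thesis
  proof (rule Bochner_Integration.integrable_bound)
    show "integrable M (\<lambda>\<omega>. \<bar>f 0\<bar> + C\<^sub>1 * \<bar>Y \<omega>\<bar>)" using Y by simp
    have "\<bar>f y\<bar> \<le> \<bar>f 0\<bar> + C\<^sub>1 * \<bar>y\<bar>" for y using f.abs_diff_le[of y 0] by simp
    then show "AE \<omega> in M. norm (f (Y \<omega>)) \<le> norm (\<bar>f 0\<bar> + C\<^sub>1 * \<bar>Y \<omega>\<bar>)"
      by (auto intro!: AE_I2 order_trans[OF _ abs_ge_self])
  qed measurable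
qed

text \<open>Since the noise is additive, no stochastic integral is needed: on each cell of a partition
  the noise increment is separated from the absolutely continuous part, it contributes
  \<open>O(\<sigma>)\<close> in expectation, and the remaining difference quotients converge to \<open>f'\<close>.\<close>

lemma dynkin_error:
  assumes f: "test_function f f' C\<^sub>1 C\<^sub>2" and i: "i \<in> {1..N}"
  shows "\<bar>expectation (\<lambda>\<omega>. f (X i T \<omega>)) - expectation (\<lambda>\<omega>. f (X i 0 \<omega>))
    - (LINT z|P. f' (configuration z i) * drift i z)\<bar> \<le> 2 * C\<^sub>2 * \<sigma> * T"
\<comment> \<open>The partition has mesh \<open>T / (n + 1)\<close>, which has to be positive; for
  \<open>T = 0\<close> the product measure is null.\<close>
proof (cases "T = 0")
  case True
  have "(LINT z|P. f' (configuration z i) * drift i z) = 0"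
  proof -
    have "emeasure P (space P) = emeasure M (space M) * emeasure L (space L)"
      unfolding space_pair_measure by (rule L.emeasure_pair_measure_Times) (rule sets.top)+
    also have "\<dots> = 0" using True by (simp add: emeasure_restrict_space)
    finally have "space P \<in> null_sets P" by (intro null_setsI) auto
    then have "AE z in P. f' (configuration z i) * drift i z = 0"
      by (rule AE_I') auto
    then show ?thesis by (rule integral_eq_zero_AE)
  qed
  then show ?thesis using True by simp
next
  case False
  then have T0: "0 < T" using T by simp
  interpret f: test_function f f' C\<^sub>1 C\<^sub>2 by (rule f)
  define h where "h = (\<lambda>n. T / real (Suc n))"
  have h: "0 < h n" "real (Suc n) * h n = T" for n using T0 by (auto simp: h_def)
  define y where "y = (\<lambda>n z. X i (cell_left (h n) (snd z)) (fst z) + sqrt (2 * \<sigma>) *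
    (B i (cell_right (h n) (snd z)) (fst z) - B i (cell_left (h n) (snd z)) (fst z)))"
  define y' where "y' = (\<lambda>n z. X i (cell_right (h n) (snd z)) (fst z))"
  define q where "q = (\<lambda>n z. difference_quotient f f' (y n z) (y' n z))"
  define S where "S = (\<lambda>n \<omega>. \<Sum>k<Suc n. f (X i (real k * h n) \<omega> + sqrt (2 * \<sigma>) *
    (B i (real (Suc k) * h n) \<omega> - B i (real k * h n) \<omega>)) - f (X i (real k * h n) \<omega>))"
  have qm: "q n \<in> borel_measurable P" for n
  proof -
    note [measurable] = X_time[OF i cell_measurable(1), of "h n"] X_time[OF i cell_measurable(2), of "h n"]
      B_time[OF i cell_measurable(1), of "h n"] B_time[OF i cell_measurable(2), of "h n"]
    have [measurable]: "(\<lambda>z. X i (cell_left (h n) (snd z)) (fst z)) \<in> borel_measurable P"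
      "(\<lambda>z. X i (cell_right (h n) (snd z)) (fst z)) \<in> borel_measurable P"
      "(\<lambda>z. B i (cell_left (h n) (snd z)) (fst z)) \<in> borel_measurable P"
      "(\<lambda>z. B i (cell_right (h n) (snd z)) (fst z)) \<in> borel_measurable P"
      by (auto intro!: X_time[OF i] B_time[OF i] cell_bounds(1,2) h)
    show ?thesis unfolding q_def y_def y'_def by measurable
  qed
  have qb: "\<bar>q n z\<bar> \<le> C\<^sub>1" for n z unfolding q_def by (rule f.difference_quotient_bound)
  note qd = integrable_bounded_times[OF drift_integrable_P[OF i] qm qb]
  have S: "integrable M (S n)" "\<bar>expectation (S n)\<bar> \<le> 2 * C\<^sub>2 * \<sigma> * T" for n
  proof -
    have k: "0 \<le> real k * h n" "real k * h n < real (Suc k) * h n" for k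
      using h(1)[of n] by auto
    note st = noise_step[OF f i k]
    show "integrable M (S n)" unfolding S_def by (intro Bochner_Integration.integrable_sum st(1))
    have "\<bar>expectation (S n)\<bar> \<le> (\<Sum>k<Suc n. \<bar>expectation (\<lambda>\<omega>. f (X i (real k * h n) \<omega> + sqrt (2 * \<sigma>) *
    (B i (real (Suc k) * h n) \<omega> - B i (real k * h n) \<omega>)) - f (X i (real k * h n) \<omega>))\<bar>)"
      unfolding S_def by (subst Bochner_Integration.integral_sum[OF st(1)]) (rule sum_abs)
    also have "\<dots> \<le> (\<Sum>k<Suc n. 2 * C\<^sub>2 * \<sigma> * (real (Suc k) * h n - real k * h n))"
      by (intro sum_mono st(2))
    also have "\<dots> = 2 * C\<^sub>2 * \<sigma> * (real (Suc n) * h n)"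
      by (simp add: algebra_simps del: sum.lessThan_Suc)
    finally show "\<bar>expectation (S n)\<bar> \<le> 2 * C\<^sub>2 * \<sigma> * T" unfolding h(2) .
  qed
  have eq: "AE \<omega> in M. f (X i T \<omega>) - f (X i 0 \<omega>) = (LINT u|L. q n (\<omega>, u) * drift i (\<omega>, u)) + S n \<omega>" for n
    using path_AE
  proof eventually_elim
    case (elim \<omega>)
    interpret path: repulsive_path N \<alpha> \<sigma> K U' "\<lambda>i s. X i s \<omega>" "\<lambda>i s. B i s \<omega>" by (rule elim)
    show ?case
      using path.telescope[OF h(1)[of n] i, where n="Suc n" and f=f and f'=f', THEN conjunct2]
      unfolding h(2) integral_L q_def y_def y'_def S_def drift_def path.drift_def by simp
  qed
  define E where "E = expectation (\<lambda>\<omega>. f (X i T \<omega>)) - expectation (\<lambda>\<omega>. f (X i 0 \<omega>))"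
  note iT = integrable_test_function[OF f X_T[OF i]] and i0 = integrable_test_function[OF f X_0[OF i]]
  have "\<bar>E - (LINT z|P. q n z * drift i z)\<bar> \<le> 2 * C\<^sub>2 * \<sigma> * T" for n
  proof -
    have "E = expectation (\<lambda>\<omega>. f (X i T \<omega>) - f (X i 0 \<omega>))" unfolding E_def using iT i0 by simp
    also have "\<dots> = expectation (\<lambda>\<omega>. (LINT u|L. q n (\<omega>, u) * drift i (\<omega>, u)) + S n \<omega>)"
      using eq[of n] iT i0 S(1) integrable_fst'[OF qd] by (intro integral_cong_AE) auto
    also have "\<dots> = (LINT z|P. q n z * drift i z) + expectation (S n)"
      using S(1) integrable_fst'[OF qd] integral_fst'[OF qd] by simp
    finally show ?thesis using S(2)[of n] by simp
  qed
  \<comment> \<open>Both ends of the cell and the noise increment over it converge by continuity of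
    the path, so the quotients tend to \<open>f'\<close>; the drift, integrable for fixed
    \<open>N\<close>, provides the majorant.\<close>
  moreover have "(\<lambda>n. LINT z|P. q n z * drift i z) \<longlonglongrightarrow> (LINT z|P. f' (configuration z i) * drift i z)"
  proof (rule integral_dominated_convergence)
    have [measurable]: "drift i \<in> borel_measurable P" using drift_integrable_P[OF i] by auto
    show "(\<lambda>z. f' (configuration z i) * drift i z) \<in> borel_measurable P" using X_P[OF i] by measurable
    show "(\<lambda>z. q n z * drift i z) \<in> borel_measurable P" for n using qm by measurable
    show "integrable P (\<lambda>z. C\<^sub>1 * \<bar>drift i z\<bar>)" using drift_integrable_P[OF i] by simp
    show "AE z in P. norm (q n z * drift i z) \<le> C\<^sub>1 * \<bar>drift i z\<bar>" for n
      using qb by (auto simp: abs_mult intro!: AE_I2 mult_right_mono)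
    show "AE z in P. (\<lambda>n. q n z * drift i z) \<longlonglongrightarrow> f' (configuration z i) * drift i z"
      using AE_P[OF path_AE] AE_space
    proof eventually_elim
      case (elim z)
      interpret path: repulsive_path N \<alpha> \<sigma> K U' "\<lambda>i s. X i s (fst z)" "\<lambda>i s. B i s (fst z)" by (rule elim(1))
      have u: "0 \<le> snd z" using elim(2) by (auto simp: space_pair_measure)
      have h0: "h \<longlonglongrightarrow> 0" unfolding h_def
        using LIMSEQ_Suc[OF lim_const_over_n[of T]] by simp
      note cb = cell_bounds[OF h(1) u]
      have cl: "(\<lambda>n. cell_left (h n) (snd z)) \<longlonglongrightarrow> snd z" and cr: "(\<lambda>n. cell_right (h n) (snd z)) \<longlonglongrightarrow> snd z"
        by (rule LIM_zero_cancel, rule Lim_null_comparison[OF _ h0], use cb in simp)+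
      have lim: "(\<lambda>n. g (cell_left (h n) (snd z))) \<longlonglongrightarrow> g (snd z)" "(\<lambda>n. g (cell_right (h n) (snd z))) \<longlonglongrightarrow> g (snd z)"
        if "continuous_on {0..} g" for g :: "real \<Rightarrow> real"
        using continuous_on_tendsto_compose[OF that cl] continuous_on_tendsto_compose[OF that cr] u cb by auto
      note lx = lim[OF path.cont_x[OF i]] and lw = lim[OF path.cont_w[OF i]]
      have "(\<lambda>n. y n z) \<longlonglongrightarrow> configuration z i + sqrt (2 * \<sigma>) * (B i (snd z) (fst z) - B i (snd z) (fst z))"
        unfolding y_def by (intro tendsto_intros lx lw)
      then have ly: "(\<lambda>n. y n z) \<longlonglongrightarrow> configuration z i" by simp
      have ly': "(\<lambda>n. y' n z) \<longlonglongrightarrow> configuration z i" unfolding y'_def by (rule lx)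
      have "(\<lambda>n. C\<^sub>2 * (\<bar>y n z - configuration z i\<bar> + \<bar>y' n z - y n z\<bar>)) \<longlonglongrightarrow>
          C\<^sub>2 * (\<bar>configuration z i - configuration z i\<bar> + \<bar>configuration z i - configuration z i\<bar>)"
        by (intro tendsto_intros ly ly')
      then have "(\<lambda>n. C\<^sub>2 * (\<bar>y n z - configuration z i\<bar> + \<bar>y' n z - y n z\<bar>)) \<longlonglongrightarrow> 0" by simp
      then have "(\<lambda>n. q n z - f' (configuration z i)) \<longlonglongrightarrow> 0"
        by (rule Lim_null_comparison[rotated])
           (auto intro!: always_eventually f.difference_quotient_near simp: q_def)
      then have "(\<lambda>n. q n z) \<longlonglongrightarrow> f' (configuration z i)" by (rule LIM_zero_cancel)
      then show ?case by (intro tendsto_intros)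
    qed
  qed
  then have "(\<lambda>n. \<bar>E - (LINT z|P. q n z * drift i z)\<bar>) \<longlonglongrightarrow> \<bar>E - (LINT z|P. f' (configuration z i) * drift i z)\<bar>"
    by (intro tendsto_intros)
  ultimately show ?thesis
    unfolding E_def by (intro LIMSEQ_le_const2) auto
qed

definition confinement :: "(real \<Rightarrow> real) \<Rightarrow> 'a \<times> real \<Rightarrow> real" where
  "confinement f' z = (\<Sum>i = 1..N. f' (configuration z i) * U' (configuration z i)) / N"

definition interaction :: "(real \<Rightarrow> real) \<Rightarrow> 'a \<times> real \<Rightarrow> real" where
  "interaction f' z = (\<Sum>i = 1..N. \<Sum>j = 1..N. interaction_kernel \<alpha> f' (configuration z i, configuration z j)) / (real N)\<^sup>2"

text \<open>Symmetrisation turns the force tested against \<open>f'\<close> into half of the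
  interaction kernel: this is the 1/2 of the theorem. One factor \<open>1 / N\<close> belongs to the
  force and one to the average over particles.\<close>

lemma sum_drift:
  "(\<Sum>i = 1..N. f' (configuration z i) * drift i z) / N = - confinement f' z + 1 / 2 * interaction f' z"
proof -
  let ?x = "configuration z"
  have "(\<Sum>i = 1..N. \<Sum>j = 1..N. f' (?x i) * V_deriv \<alpha> (?x i - ?x j))
      = (\<Sum>i = 1..N. \<Sum>j = 1..N. (f' (?x i) - f' (?x j)) * V_deriv \<alpha> (?x i - ?x j)) / 2"
    by (rule sum_antisymmetric) (metis V_deriv_minus minus_diff_eq)
  also have "\<dots> = - ((real N)\<^sup>2 * interaction f' z) / 2"
    using N by (simp add: interaction_def interaction_kernel_V_deriv sum_negf)
  finally have *: "(\<Sum>i = 1..N. \<Sum>j = 1..N. f' (?x i) * V_deriv \<alpha> (?x i - ?x j)) = - ((real N)\<^sup>2 * interaction f' z) / 2" .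
  have "(\<Sum>i = 1..N. f' (?x i) * drift i z) = - (\<Sum>i = 1..N. f' (?x i) * U' (?x i))
      - 1 / N * (\<Sum>i = 1..N. \<Sum>j = 1..N. f' (?x i) * V_deriv \<alpha> (?x i - ?x j))"
    by (simp add: drift_def right_diff_distrib sum_subtractf sum_negf sum_divide_distrib[symmetric] sum_distrib_left[symmetric])
  then show ?thesis
    unfolding * using N by (simp add: confinement_def power2_eq_square diff_divide_distrib)
qed

lemma
  assumes f: "test_function f f' C\<^sub>1 C\<^sub>2"
  shows interaction_integrable: "integrable P (interaction f')"
    and weak_form_error: "\<bar>expectation (\<lambda>\<omega>. (\<Sum>i = 1..N. f (X i T \<omega>)) / N) - expectation (\<lambda>\<omega>. (\<Sum>i = 1..N. f (X i 0 \<omega>)) / N)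
      + (LINT z|P. confinement f' z) - 1 / 2 * (LINT z|P. interaction f' z)\<bar> \<le> 2 * C\<^sub>2 * \<sigma> * T"
proof -
  interpret f: test_function f f' C\<^sub>1 C\<^sub>2 by (rule f)
  have fm: "(\<lambda>z. f' (configuration z i)) \<in> borel_measurable P" if "i \<in> {1..N}" for i
    using X_P[OF that] by measurable
  have c: "integrable P (confinement f')"
    unfolding confinement_def[abs_def] using confinement_integrable_P fm
    by (intro integrable_divide Bochner_Integration.integrable_sum integrable_bounded_times[where C="C\<^sub>1"])
       (use f.bounded in auto)
  have "\<bar>f' x - f' y\<bar> \<le> 2 * C\<^sub>1" for x y using f.bounded[of x] f.bounded[of y] by linarith
  then show k: "integrable P (interaction f')"
    unfolding interaction_def[abs_def] interaction_kernel_V_deriv using force_integrable_P fm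
    by (intro integrable_divide Bochner_Integration.integrable_sum integrable_minus integrable_bounded_times[where C="2 * C\<^sub>1"]) auto
  have d: "integrable P (\<lambda>z. f' (configuration z i) * drift i z)" if "i \<in> {1..N}" for i
    using integrable_bounded_times[OF drift_integrable_P[OF that] fm[OF that]] f.bounded by blast
  define e where "e = (\<lambda>i. expectation (\<lambda>\<omega>. f (X i T \<omega>)) - expectation (\<lambda>\<omega>. f (X i 0 \<omega>))
    - (LINT z|P. f' (configuration z i) * drift i z))"
  have "(LINT z|P. (\<Sum>i = 1..N. f' (configuration z i) * drift i z) / N)
      = - (LINT z|P. confinement f' z) + 1 / 2 * (LINT z|P. interaction f' z)"
    unfolding sum_drift using c k by simp
  then have "(\<Sum>i = 1..N. e i) / N = expectation (\<lambda>\<omega>. (\<Sum>i = 1..N. f (X i T \<omega>)) / N) - expectation (\<lambda>\<omega>. (\<Sum>i = 1..N. f (X i 0 \<omega>)) / N)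
      + (LINT z|P. confinement f' z) - 1 / 2 * (LINT z|P. interaction f' z)"
    unfolding e_def using d integrable_test_function[OF f X_T] integrable_test_function[OF f X_0]
    by (simp add: sum_subtractf diff_divide_distrib)
  moreover have "\<bar>(\<Sum>i = 1..N. e i) / N\<bar> \<le> (\<Sum>i = 1..N. 2 * C\<^sub>2 * \<sigma> * T) / N"
  proof -
    have "\<bar>\<Sum>i = 1..N. e i\<bar> \<le> (\<Sum>i = 1..N. \<bar>e i\<bar>)" by (rule sum_abs)
    also have "\<dots> \<le> (\<Sum>i = 1..N. 2 * C\<^sub>2 * \<sigma> * T)" unfolding e_def using dynkin_error[OF f] by (intro sum_mono) auto
    finally show ?thesis using N by (simp add: divide_le_eq mult_ac)
  qed
  ultimately show "\<bar>expectation (\<lambda>\<omega>. (\<Sum>i = 1..N. f (X i T \<omega>)) / N) - expectation (\<lambda>\<omega>. (\<Sum>i = 1..N. f (X i 0 \<omega>)) / N)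
      + (LINT z|P. confinement f' z) - 1 / 2 * (LINT z|P. interaction f' z)\<bar> \<le> 2 * C\<^sub>2 * \<sigma> * T"
    using N by simp
qed

end

section \<open>Truncated kernels\<close>

text \<open>The odd function \<open>u / |u| powr p\<close> with its denominator frozen at distances
  below \<delta>. It vanishes at 0, is Lipschitz, and grows in absolute value as \<delta> decreases.
  The exponent \<open>\<alpha> + 1\<close> serves the interaction kernel, and
  \<open>\<beta> + 1\<close> the Riesz power of order \<beta>.\<close>

definition truncated_power :: "real \<Rightarrow> real \<Rightarrow> real \<Rightarrow> real" where
  "truncated_power \<delta> p u = u / (max \<bar>u\<bar> \<delta>) powr p"

lemma truncated_power_measurable[measurable]: "truncated_power \<delta> p \<in> borel_measurable borel"
  unfolding truncated_power_def by measurable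

lemma abs_truncated_power: "\<bar>truncated_power \<delta> p u\<bar> = \<bar>u\<bar> / (max \<bar>u\<bar> \<delta>) powr p"
  by (simp add: truncated_power_def abs_divide)

lemma truncated_power_eq: "\<delta> \<le> \<bar>u\<bar> \<Longrightarrow> truncated_power \<delta> p u = u / \<bar>u\<bar> powr p"
  by (simp add: truncated_power_def max_def)

lemma abs_divide_powr: "\<bar>u\<bar> / \<bar>u\<bar> powr p = \<bar>u\<bar> powr (1 - p)" for u :: real
  by (cases "u = 0") (simp_all add: powr_diff)

lemma abs_truncated_power_antimono:
  assumes "0 < \<delta>" "\<delta> \<le> \<delta>'" "0 \<le> p"
  shows "\<bar>truncated_power \<delta>' p u\<bar> \<le> \<bar>truncated_power \<delta> p u\<bar>"
  unfolding abs_truncated_power using assms by (intro divide_left_mono powr_mono2) auto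

lemma abs_truncated_power_le:
  assumes "0 < \<delta>" "0 \<le> p"
  shows "\<bar>truncated_power \<delta> p u\<bar> \<le> \<bar>u\<bar> powr (1 - p)"
proof (cases "u = 0")
  case False
  then have "\<bar>u\<bar> / (max \<bar>u\<bar> \<delta>) powr p \<le> \<bar>u\<bar> / \<bar>u\<bar> powr p"
    using assms by (intro divide_left_mono powr_mono2) auto
  then show ?thesis by (simp add: abs_truncated_power abs_divide_powr)
qed (simp add: truncated_power_def)

lemma abs_truncated_power_bound:
  assumes "0 < \<delta>" "1 \<le> p"
  shows "\<bar>truncated_power \<delta> p u\<bar> \<le> \<delta> powr (1 - p)"
proof -
  define m where "m = max \<bar>u\<bar> \<delta>"
  have m: "0 < m" "\<delta> \<le> m" "\<bar>u\<bar> \<le> m" using assms by (auto simp: m_def)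
  have "\<bar>u\<bar> / m powr p \<le> m / m powr p" using m by (intro divide_right_mono) auto
  also have "\<dots> = m powr (1 - p)" using m by (simp add: powr_diff)
  also have "\<dots> \<le> \<delta> powr (1 - p)" using assms m by (intro powr_mono2') auto
  finally show ?thesis by (simp add: abs_truncated_power m_def)
qed

lemma powr_minus_lipschitz:
  fixes a b :: real
  assumes "0 < a" "a \<le> b" "0 \<le> p"
  shows "a powr (- p) - b powr (- p) \<le> p * a powr (- p - 1) * (b - a)"
proof (cases "a = b")
  case False
  then have "a < b" using assms by simp
  then obtain z where z: "a < z" "z < b" "b powr (- p) - a powr (- p) = (b - a) * (- p * z powr (- p - 1))"
  proof -
    have "((\<lambda>x. x powr (- p)) has_real_derivative - p * x powr (- p - 1)) (at x)" if "a \<le> x" for x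
      using has_real_derivative_powr[of x "- p"] that assms by simp
    from MVT2[OF \<open>a < b\<close> this] that show ?thesis by blast
  qed
  have "z powr (- p - 1) \<le> a powr (- p - 1)" using z assms by (intro powr_mono2') auto
  then have "(b - a) * (p * z powr (- p - 1)) \<le> (b - a) * (p * a powr (- p - 1))"
    using assms by (intro mult_left_mono) auto
  then show ?thesis using z(3) by (simp add: mult_ac)
qed simp

text \<open>The change of the numerator costs the 1 and the change of the denominator the
  \<open>p\<close>. With the smaller of the two truncated distances called \<open>a\<close>, the
  extra singular factor \<open>1 / a\<close> of the derivative is absorbed by
  \<open>|v| \<le> a\<close>.\<close>

lemma truncated_power_lipschitz:
  assumes \<delta>: "0 < \<delta>" and p: "0 \<le> p"
  shows "((1 + p) * \<delta> powr (- p))-lipschitz_on UNIV (truncated_power \<delta> p)"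
proof (rule lipschitz_onI)
  have main: "\<bar>truncated_power \<delta> p u - truncated_power \<delta> p v\<bar> \<le> (1 + p) * \<delta> powr (- p) * \<bar>u - v\<bar>"
    if uv: "\<bar>v\<bar> \<le> \<bar>u\<bar>" for u v
  proof -
    define a where "a = max \<bar>v\<bar> \<delta>"
    define b where "b = max \<bar>u\<bar> \<delta>"
    have a: "0 < a" "\<bar>v\<bar> \<le> a" "\<delta> \<le> a" "a \<le> b" "b - a \<le> \<bar>u - v\<bar>"
      using uv \<delta> by (auto simp: a_def b_def max_def)
    have "b powr (- p) \<le> a powr (- p)" using a p by (intro powr_mono2') auto
    have "truncated_power \<delta> p u - truncated_power \<delta> p v
        = (u - v) * b powr (- p) - v * (a powr (- p) - b powr (- p))"
      by (simp add: truncated_power_def a_def b_def powr_minus divide_inverse algebra_simps)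
    then have "\<bar>truncated_power \<delta> p u - truncated_power \<delta> p v\<bar>
        \<le> \<bar>(u - v) * b powr (- p)\<bar> + \<bar>v * (a powr (- p) - b powr (- p))\<bar>" by linarith
    also have "\<dots> = \<bar>u - v\<bar> * b powr (- p) + \<bar>v\<bar> * (a powr (- p) - b powr (- p))"
      using \<open>b powr (- p) \<le> a powr (- p)\<close> by (simp add: abs_mult)
    also have "\<dots> \<le> \<bar>u - v\<bar> * a powr (- p) + a * (p * a powr (- p - 1) * \<bar>u - v\<bar>)"
    proof (intro add_mono mult_mono)
      have "a powr (- p) - b powr (- p) \<le> p * a powr (- p - 1) * (b - a)"
        using a p by (intro powr_minus_lipschitz) auto
      also have "\<dots> \<le> p * a powr (- p - 1) * \<bar>u - v\<bar>" using a p by (intro mult_left_mono) auto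
      finally show "a powr (- p) - b powr (- p) \<le> p * a powr (- p - 1) * \<bar>u - v\<bar>" .
    qed (use a \<open>b powr (- p) \<le> a powr (- p)\<close> in auto)
    also have "a * (p * a powr (- p - 1) * \<bar>u - v\<bar>) = p * a powr (- p) * \<bar>u - v\<bar>"
      using a by (simp add: powr_diff)
    also have "\<bar>u - v\<bar> * a powr (- p) + p * a powr (- p) * \<bar>u - v\<bar> = (1 + p) * \<bar>u - v\<bar> * a powr (- p)"
      by (simp add: algebra_simps)
    also have "\<dots> \<le> (1 + p) * \<bar>u - v\<bar> * \<delta> powr (- p)"
      using a \<delta> p by (intro mult_left_mono powr_mono2') auto
    finally show ?thesis by (simp add: mult_ac)
  qed
  show "dist (truncated_power \<delta> p u) (truncated_power \<delta> p v) \<le> (1 + p) * \<delta> powr (- p) * dist u v" for u v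
    using main[of u v] main[of v u] by (cases "\<bar>u\<bar> \<le> \<bar>v\<bar>") (auto simp: dist_real_def abs_minus_commute)
qed (use p in auto)

section \<open>Lipschitz kernels on pairs and convergence of expectations\<close>

definition pair_lipschitz :: "real \<Rightarrow> (real \<Rightarrow> real \<Rightarrow> real) \<Rightarrow> bool" where
  "pair_lipschitz L G \<longleftrightarrow> (\<forall>y. L-lipschitz_on UNIV (\<lambda>x. G x y)) \<and> (\<forall>x. L-lipschitz_on UNIV (G x))"

lemma lipschitz_on_abs:
  fixes g :: "real \<Rightarrow> real"
  assumes "L-lipschitz_on UNIV g"
  shows "L-lipschitz_on UNIV (\<lambda>x. \<bar>g x\<bar>)"
proof (rule lipschitz_onI)
  show "dist \<bar>g x\<bar> \<bar>g y\<bar> \<le> L * dist x y" for x y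
    using lipschitz_onD[OF assms, of x y] by (simp add: dist_real_def)
qed (rule lipschitz_on_nonneg[OF assms])

lemma pair_lipschitz_abs: "pair_lipschitz L G \<Longrightarrow> pair_lipschitz L (\<lambda>x y. \<bar>G x y\<bar>)"
  by (auto simp: pair_lipschitz_def intro: lipschitz_on_abs)

lemma pair_lipschitz_diff:
  fixes g :: "real \<Rightarrow> real"
  assumes g: "L-lipschitz_on UNIV g"
  shows "pair_lipschitz L (\<lambda>x y. g (x - y))"
  unfolding pair_lipschitz_def
proof (intro conjI allI lipschitz_onI)
  show "dist (g (x - y)) (g (x' - y)) \<le> L * dist x x'" for x x' y
    using lipschitz_onD[OF g, of "x - y" "x' - y"] by (simp add: dist_real_def)
  show "dist (g (x - y)) (g (x - y')) \<le> L * dist y y'" for x y y'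
    using lipschitz_onD[OF g, of "x - y" "x - y'"] by (simp add: dist_real_def abs_minus_commute)
qed (rule lipschitz_on_nonneg[OF g])+

text \<open>Product rule: the Lipschitz constant of one factor times the bound of the other, twice.
  Stating \<open>main\<close> for simultaneous changes of both arguments covers each variable in
  turn.\<close>

lemma (in test_function) truncated_kernel_lipschitz:
  assumes \<delta>: "0 < \<delta>" and p: "1 \<le> p"
  shows "pair_lipschitz (C\<^sub>2 * \<delta> powr (1 - p) + 2 * C\<^sub>1 * ((1 + p) * \<delta> powr (- p)))
    (\<lambda>x y. (f' x - f' y) * truncated_power \<delta> p (x - y))"
proof -
  let ?t = "truncated_power \<delta> p" and ?L = "(1 + p) * \<delta> powr (- p)"
  let ?C = "C\<^sub>2 * \<delta> powr (1 - p) + 2 * C\<^sub>1 * ?L"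
  have C: "0 \<le> ?C" using C\<^sub>1_nonneg C\<^sub>2_nonneg p by auto
  have main: "\<bar>(f' x - f' y) * ?t (x - y) - (f' x' - f' y') * ?t (x' - y')\<bar> \<le> ?C * d"
    if d: "\<bar>(f' x - f' y) - (f' x' - f' y')\<bar> \<le> C\<^sub>2 * d" "\<bar>(x - y) - (x' - y')\<bar> \<le> d" for x y x' y' d
  proof -
    have "(f' x - f' y) * ?t (x - y) - (f' x' - f' y') * ?t (x' - y') =
        ((f' x - f' y) - (f' x' - f' y')) * ?t (x - y) + (f' x' - f' y') * (?t (x - y) - ?t (x' - y'))"
      by (simp add: algebra_simps)
    then have "\<bar>(f' x - f' y) * ?t (x - y) - (f' x' - f' y') * ?t (x' - y')\<bar> \<le>
        \<bar>(f' x - f' y) - (f' x' - f' y')\<bar> * \<bar>?t (x - y)\<bar> + \<bar>f' x' - f' y'\<bar> * \<bar>?t (x - y) - ?t (x' - y')\<bar>"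
      by (metis abs_mult abs_triangle_ineq)
    also have "\<dots> \<le> (C\<^sub>2 * d) * \<delta> powr (1 - p) + (2 * C\<^sub>1) * (?L * d)"
    proof (intro add_mono mult_mono)
      show "\<bar>?t (x - y)\<bar> \<le> \<delta> powr (1 - p)" by (rule abs_truncated_power_bound[OF \<delta> p])
      show "\<bar>f' x' - f' y'\<bar> \<le> 2 * C\<^sub>1" using bounded[of x'] bounded[of y'] by linarith
      have "\<bar>?t (x - y) - ?t (x' - y')\<bar> \<le> ?L * \<bar>(x - y) - (x' - y')\<bar>"
        using lipschitz_onD[OF truncated_power_lipschitz[OF \<delta>, of p], of "x - y" "x' - y'"] p by (simp add: dist_real_def)
      also have "\<dots> \<le> ?L * d" using d(2) p by (intro mult_left_mono) auto
      finally show "\<bar>?t (x - y) - ?t (x' - y')\<bar> \<le> ?L * d" .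
    qed (use d C\<^sub>1_nonneg C\<^sub>2_nonneg in auto)
    finally show ?thesis by (simp add: algebra_simps)
  qed
  show ?thesis
    unfolding pair_lipschitz_def
  proof (intro conjI allI lipschitz_onI C)
    show "dist ((f' x - f' y) * ?t (x - y)) ((f' x' - f' y) * ?t (x' - y)) \<le> ?C * dist x x'" for x x' y
      unfolding dist_real_def using lipschitz[of x x'] by (intro main) auto
    show "dist ((f' x - f' y) * ?t (x - y)) ((f' x - f' y') * ?t (x - y')) \<le> ?C * dist y y'" for x y y'
      unfolding dist_real_def using lipschitz[of y y'] by (intro main) auto
  qed
qed

lemma P2_pair_integral:
  fixes g :: "real \<times> real \<Rightarrow> real"
  assumes \<mu>: "\<mu> \<in> P2" and g: "g \<in> borel_measurable (borel \<Otimes>\<^sub>M borel)" "\<And>z. \<bar>g z\<bar> \<le> C"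
  shows "integrable (\<mu> \<Otimes>\<^sub>M \<mu>) g"
    and "(LINT z|(\<mu> \<Otimes>\<^sub>M \<mu>). g z) = (LINT x|\<mu>. LINT y|\<mu>. g (x, y))"
proof -
  interpret prob_space \<mu> using P2_D[OF \<mu>] by simp
  interpret pair_prob_space \<mu> \<mu> ..
  have "sets (\<mu> \<Otimes>\<^sub>M \<mu>) = sets (borel \<Otimes>\<^sub>M borel)"
    by (rule sets_pair_measure_cong) (use P2_D[OF \<mu>] in auto)
  then have "g \<in> borel_measurable (\<mu> \<Otimes>\<^sub>M \<mu>)" using g(1) measurable_cong_sets by blast
  then show i: "integrable (\<mu> \<Otimes>\<^sub>M \<mu>) g"
    by (intro P.integrable_const_bound[of _ C]) (use g(2) in auto)
  show "(LINT z|(\<mu> \<Otimes>\<^sub>M \<mu>). g z) = (LINT x|\<mu>. LINT y|\<mu>. g (x, y))"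
    by (rule integral_fst'[OF i, symmetric])
qed

lemma mean_W2:
  assumes N: "0 < N" and \<mu>: "\<mu> \<in> P2" and g: "L-lipschitz_on UNIV g"
  shows "\<bar>(\<Sum>i = 1..N. g (y i)) / N - (LINT x|\<mu>. g x)\<bar> \<le> L * W2 (empirical N y) \<mu>"
  using W2_lipschitz[OF empirical_P2[OF N] \<mu> g, of y]
  by (simp add: integral_empirical[OF N lipschitz_borel_measurable[OF g]])

text \<open>Pairs \<open>i = j\<close> are kept because the product of the empirical measure with
  itself charges the diagonal; the kernels to which this is applied vanish there.\<close>

lemma pair_mean_W2:
  assumes N: "0 < N" and \<mu>: "\<mu> \<in> P2" and G: "pair_lipschitz L G"
  shows "\<bar>(\<Sum>i = 1..N. \<Sum>j = 1..N. G (y i) (y j)) / (real N)\<^sup>2 - (LINT x|\<mu>. LINT y|\<mu>. G x y)\<bar>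
    \<le> 2 * L * W2 (empirical N y) \<mu>"
proof -
  have g: "L-lipschitz_on UNIV (\<lambda>x. G x y)" "L-lipschitz_on UNIV (G x)" for x y
    using G by (auto simp: pair_lipschitz_def)
  note W = W2_lipschitz_pair[OF empirical_P2[OF N] \<mu> g, of y]
  have "(LINT u|empirical N y. LINT v|empirical N y. G u v) = (\<Sum>i = 1..N. (\<Sum>j = 1..N. G (y i) (y j)) / N) / N"
    using integral_empirical[OF N lipschitz_borel_measurable[OF W(2)]]
      integral_empirical[OF N lipschitz_borel_measurable[OF g(2)]] by simp
  also have "\<dots> = (\<Sum>i = 1..N. \<Sum>j = 1..N. G (y i) (y j)) / (real N)\<^sup>2"
    by (simp add: sum_divide_distrib power2_eq_square)
  finally show ?thesis using W(1) by simp
qed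

text \<open>\<open>W\<close> stands for a Wasserstein distance as a function of the sample point,
  whose measurability is not established. Monotonicity of the upper integral is therefore the only
  property used of it. Integrability holds once that integral is finite, hence eventually.\<close>

lemma expectation_tendsto:
  fixes Y :: "nat \<Rightarrow> 'a \<Rightarrow> real" and W :: "nat \<Rightarrow> 'a \<Rightarrow> real"
  assumes prob: "\<And>n. n \<ge> n0 \<Longrightarrow> prob_space (M n)"
    and Y: "\<And>n. n \<ge> n0 \<Longrightarrow> Y n \<in> borel_measurable (M n)"
    and le: "\<And>n \<omega>. n \<ge> n0 \<Longrightarrow> \<bar>Y n \<omega> - c\<bar> \<le> C * W n \<omega>"
    and W: "(\<lambda>n. \<integral>\<^sup>+\<omega>. ennreal (W n \<omega>) \<partial>M n) \<longlonglongrightarrow> 0" and C: "0 < C"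
  shows "eventually (\<lambda>n. integrable (M n) (Y n)) sequentially"
    and "(\<lambda>n. LINT \<omega>|M n. Y n \<omega>) \<longlonglongrightarrow> c"
proof -
  \<comment> \<open>The constant is divided out on the left, since taking it out of the integral of
    \<open>W\<close> would require measurability.\<close>
  have I: "(\<integral>\<^sup>+\<omega>. ennreal (\<bar>Y n \<omega> - c\<bar> / C) \<partial>M n) \<le> (\<integral>\<^sup>+\<omega>. ennreal (W n \<omega>) \<partial>M n)" if "n \<ge> n0" for n
    using le[OF that] C by (intro nn_integral_mono ennreal_leI) (simp add: divide_le_eq mult.commute)
  have "eventually (\<lambda>n. (\<integral>\<^sup>+\<omega>. ennreal (W n \<omega>) \<partial>M n) < 1) sequentially"
    using order_tendstoD(2)[OF W, of 1] by simp
  then have ev: "eventually (\<lambda>n. integrable (M n) (\<lambda>\<omega>. \<bar>Y n \<omega> - c\<bar> / C)) sequentially"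
    using eventually_ge_at_top[of n0]
  proof eventually_elim
    case (elim n)
    show ?case
    proof (rule integrableI_bounded)
      show "(\<lambda>\<omega>. \<bar>Y n \<omega> - c\<bar> / C) \<in> borel_measurable (M n)" using Y[OF elim(2)] by measurable
      have "(\<integral>\<^sup>+\<omega>. ennreal (norm (\<bar>Y n \<omega> - c\<bar> / C)) \<partial>M n) < 1"
        using I[OF elim(2)] elim(1) C by simp
      also have "(1 :: ennreal) < \<infinity>" by simp
      finally show "(\<integral>\<^sup>+\<omega>. ennreal (norm (\<bar>Y n \<omega> - c\<bar> / C)) \<partial>M n) < \<infinity>" .
    qed
  qed
  show "eventually (\<lambda>n. integrable (M n) (Y n)) sequentially"
    using ev eventually_ge_at_top[of n0]
  proof eventually_elim
    case (elim n)
    interpret prob_space "M n" by (rule prob[OF elim(2)])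
    have "integrable (M n) (\<lambda>\<omega>. C * (\<bar>Y n \<omega> - c\<bar> / C))" using elim(1) by (rule integrable_mult_right)
    then have "integrable (M n) (\<lambda>\<omega>. \<bar>Y n \<omega> - c\<bar>)" using C by simp
    then have "integrable (M n) (\<lambda>\<omega>. Y n \<omega> - c)"
    proof (rule integrable_abs_cancel)
      show "(\<lambda>\<omega>. Y n \<omega> - c) \<in> borel_measurable (M n)" using Y[OF elim(2)] by measurable
    qed
    then have "integrable (M n) (\<lambda>\<omega>. (Y n \<omega> - c) + c)" by (intro Bochner_Integration.integrable_add) auto
    then show ?case by simp
  qed
  have "(\<lambda>n. enn2real (\<integral>\<^sup>+\<omega>. ennreal (W n \<omega>) \<partial>M n)) \<longlonglongrightarrow> 0"
    by (rule tendsto_enn2real) (use W in auto)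
  from tendsto_mult[OF tendsto_const[of C] this] have z: "(\<lambda>n. C * enn2real (\<integral>\<^sup>+\<omega>. ennreal (W n \<omega>) \<partial>M n)) \<longlonglongrightarrow> 0" by simp
  show "(\<lambda>n. LINT \<omega>|M n. Y n \<omega>) \<longlonglongrightarrow> c"
  proof (rule LIM_zero_cancel, rule Lim_null_comparison[OF _ z])
    show "eventually (\<lambda>n. norm ((LINT \<omega>|M n. Y n \<omega>) - c) \<le> C * enn2real (\<integral>\<^sup>+\<omega>. ennreal (W n \<omega>) \<partial>M n)) sequentially"
      using ev \<open>eventually (\<lambda>n. integrable (M n) (Y n)) sequentially\<close> eventually_ge_at_top[of n0]
        \<open>eventually (\<lambda>n. (\<integral>\<^sup>+\<omega>. ennreal (W n \<omega>) \<partial>M n) < 1) sequentially\<close>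
    proof eventually_elim
      case (elim n)
      interpret prob_space "M n" by (rule prob[OF elim(3)])
      have "ennreal (LINT \<omega>|M n. \<bar>Y n \<omega> - c\<bar> / C) \<le> (\<integral>\<^sup>+\<omega>. ennreal (W n \<omega>) \<partial>M n)"
        using I[OF elim(3)] C by (subst nn_integral_eq_integral[OF elim(1), symmetric]) auto
      then have le': "(LINT \<omega>|M n. \<bar>Y n \<omega> - c\<bar> / C) \<le> enn2real (\<integral>\<^sup>+\<omega>. ennreal (W n \<omega>) \<partial>M n)"
        using elim(4) by (cases "\<integral>\<^sup>+\<omega>. ennreal (W n \<omega>) \<partial>M n" rule: ennreal_cases) (auto simp: ennreal_le_iff)
      have "\<bar>expectation (Y n) - c\<bar> = \<bar>expectation (\<lambda>\<omega>. Y n \<omega> - c)\<bar>"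
        using elim(2) by (simp add: prob_space)
      also have "\<dots> \<le> expectation (\<lambda>\<omega>. \<bar>Y n \<omega> - c\<bar>)" by (rule integral_abs_bound)
      also have "\<dots> = C * expectation (\<lambda>\<omega>. \<bar>Y n \<omega> - c\<bar> / C)" using C by simp
      also have "\<dots> \<le> C * enn2real (\<integral>\<^sup>+\<omega>. ennreal (W n \<omega>) \<partial>M n)" using le' C by (intro mult_left_mono) auto
      finally show ?case by simp
    qed
  qed
qed

section \<open>Passage to the limit\<close>

lemma integrable_of_mean_abs:
  fixes Y :: "nat \<Rightarrow> 'a \<Rightarrow> real"
  assumes Y: "\<And>i. i \<in> {1..N} \<Longrightarrow> Y i \<in> borel_measurable M"
    and mean: "integrable M (\<lambda>\<omega>. (\<Sum>i = 1..N. \<bar>Y i \<omega>\<bar>) / N)" and i: "i \<in> {1..N}"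
  shows "integrable M (Y i)"
proof (rule Bochner_Integration.integrable_bound)
  show "integrable M (\<lambda>\<omega>. N * ((\<Sum>i = 1..N. \<bar>Y i \<omega>\<bar>) / N))"
    using mean by (rule integrable_mult_right)
  have "\<bar>Y i \<omega>\<bar> \<le> N * ((\<Sum>i = 1..N. \<bar>Y i \<omega>\<bar>) / N)" for \<omega>
    using member_le_sum[OF i, of "\<lambda>i. \<bar>Y i \<omega>\<bar>"] i by simp
  then show "AE \<omega> in M. norm (Y i \<omega>) \<le> norm (N * ((\<Sum>i = 1..N. \<bar>Y i \<omega>\<bar>) / N))"
    by (auto intro!: AE_I2 order_trans[OF _ abs_ge_self] simp del: times_divide_eq_right)
qed (rule Y[OF i])

locale mean_field_limit =
  fixes M :: "nat \<Rightarrow> 'a measure" and \<alpha> K :: real and U' :: "real \<Rightarrow> real" and \<sigma> :: "nat \<Rightarrow> real"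
    and X B :: "nat \<Rightarrow> nat \<Rightarrow> real \<Rightarrow> 'a \<Rightarrow> real" and \<rho> :: "real \<Rightarrow> real measure" and T :: real
  assumes regular: "\<And>N. 2 \<le> N \<Longrightarrow> regular_solution (M N) N \<alpha> (\<sigma> N) K U' (X N) (B N)"
    and \<alpha>: "1 \<le> \<alpha>" "\<alpha> < 2" and \<sigma>_lim: "\<sigma> \<longlonglongrightarrow> 0"
    and \<rho>_P2: "\<And>t. 0 \<le> t \<Longrightarrow> \<rho> t \<in> P2"
    and \<rho>_cont: "\<And>t. 0 \<le> t \<Longrightarrow> ((\<lambda>s. W2 (\<rho> s) (\<rho> t)) \<longlongrightarrow> 0) (at t within {0..})"
    and lim: "\<And>t. 0 \<le> t \<Longrightarrow>
      (\<lambda>N. \<integral>\<^sup>+\<omega>. ennreal (W2 (empirical N (\<lambda>i. X N i t \<omega>)) (\<rho> t)) \<partial>M N) \<longlonglongrightarrow> 0"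
    and T: "0 \<le> T"
begin

abbreviation L :: "real measure" where "L \<equiv> restrict_space lborel {0..T}"
abbreviation P :: "nat \<Rightarrow> ('a \<times> real) measure" where "P N \<equiv> M N \<Otimes>\<^sub>M L"
abbreviation configuration :: "nat \<Rightarrow> 'a \<times> real \<Rightarrow> nat \<Rightarrow> real" where
  "configuration N z \<equiv> \<lambda>i. X N i (snd z) (fst z)"
abbreviation pair_mean :: "nat \<Rightarrow> (real \<Rightarrow> real \<Rightarrow> real) \<Rightarrow> (nat \<Rightarrow> real) \<Rightarrow> real" where
  "pair_mean N G y \<equiv> (\<Sum>i = 1..N. \<Sum>j = 1..N. G (y i) (y j)) / (real N)\<^sup>2"
abbreviation on_system :: "nat \<Rightarrow> bool" where
  "on_system N \<equiv> regular_solution_on (M N) N \<alpha> (\<sigma> N) K U' (X N) (B N) T"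

lemma prob_M: "2 \<le> N \<Longrightarrow> prob_space (M N)"
  using regular regular_solution.axioms(1) by blast

lemma X_M: "2 \<le> N \<Longrightarrow> i \<in> {1..N} \<Longrightarrow> 0 \<le> s \<Longrightarrow> X N i s \<in> borel_measurable (M N)"
  using regular_solution.X_M[OF regular] by blast

lemma
  assumes g: "C-lipschitz_on UNIV g" and s: "0 \<le> s"
  shows mean_integrable: "\<forall>\<^sub>F N in sequentially. integrable (M N) (\<lambda>\<omega>. (\<Sum>i = 1..N. g (X N i s \<omega>)) / N)"
    and mean_tendsto: "(\<lambda>N. LINT \<omega>|M N. (\<Sum>i = 1..N. g (X N i s \<omega>)) / N) \<longlonglongrightarrow> (LINT x|\<rho> s. g x)"
proof -
  have C: "0 \<le> C" by (rule lipschitz_on_nonneg[OF g])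
  have m: "(\<lambda>\<omega>. (\<Sum>i = 1..N. g (X N i s \<omega>)) / N) \<in> borel_measurable (M N)" if N: "2 \<le> N" for N
  proof -
    have "(\<lambda>\<omega>. g (X N i s \<omega>)) \<in> borel_measurable (M N)" if "i \<in> {1..N}" for i
      by (rule measurable_compose[OF X_M[OF N that s] lipschitz_borel_measurable[OF g]])
    then show ?thesis by (intro borel_measurable_divide borel_measurable_sum) auto
  qed
  \<comment> \<open>\<open>C + 1\<close> replaces \<open>C\<close> because a positive constant is
    required.\<close>
  have le: "\<bar>(\<Sum>i = 1..N. g (X N i s \<omega>)) / N - (LINT x|\<rho> s. g x)\<bar> \<le> (C + 1) * W2 (empirical N (\<lambda>i. X N i s \<omega>)) (\<rho> s)"
    if "2 \<le> N" for N \<omega>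
    using mean_W2[OF _ \<rho>_P2[OF s] g, of N "\<lambda>i. X N i s \<omega>"] that W2_nonneg[of "empirical N (\<lambda>i. X N i s \<omega>)" "\<rho> s"]
    by (simp add: distrib_right)
  note E = expectation_tendsto[OF prob_M m le lim[OF s]]
  show "\<forall>\<^sub>F N in sequentially. integrable (M N) (\<lambda>\<omega>. (\<Sum>i = 1..N. g (X N i s \<omega>)) / N)"
    "(\<lambda>N. LINT \<omega>|M N. (\<Sum>i = 1..N. g (X N i s \<omega>)) / N) \<longlonglongrightarrow> (LINT x|\<rho> s. g x)"
    using E C by auto
qed

lemma pair_mean_tendsto:
  assumes G: "pair_lipschitz C G" and Gm: "(\<lambda>z. G (fst z) (snd z)) \<in> borel_measurable (borel \<Otimes>\<^sub>M borel)" and s: "0 \<le> s"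
  shows "(\<lambda>N. LINT \<omega>|M N. pair_mean N G (\<lambda>i. X N i s \<omega>)) \<longlonglongrightarrow> (LINT x|\<rho> s. LINT y|\<rho> s. G x y)"
proof -
  have C: "0 \<le> C" using G lipschitz_on_nonneg by (auto simp: pair_lipschitz_def)
  have m: "(\<lambda>\<omega>. pair_mean N G (\<lambda>i. X N i s \<omega>)) \<in> borel_measurable (M N)" if N: "2 \<le> N" for N
  proof -
    have "(\<lambda>\<omega>. G (X N i s \<omega>) (X N j s \<omega>)) \<in> borel_measurable (M N)" if "i \<in> {1..N}" "j \<in> {1..N}" for i j
    proof -
      have "(\<lambda>\<omega>. (X N i s \<omega>, X N j s \<omega>)) \<in> measurable (M N) (borel \<Otimes>\<^sub>M borel)"
        using X_M[OF N _ s] that by (intro measurable_Pair) auto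
      from measurable_compose[OF this Gm] show ?thesis by simp
    qed
    then show ?thesis by (intro borel_measurable_divide borel_measurable_sum) auto
  qed
  have le: "\<bar>pair_mean N G (\<lambda>i. X N i s \<omega>) - (LINT x|\<rho> s. LINT y|\<rho> s. G x y)\<bar>
      \<le> (2 * C + 1) * W2 (empirical N (\<lambda>i. X N i s \<omega>)) (\<rho> s)"
    if "2 \<le> N" for N \<omega>
    using pair_mean_W2[OF _ \<rho>_P2[OF s] G, of N "\<lambda>i. X N i s \<omega>"] that W2_nonneg[of "empirical N (\<lambda>i. X N i s \<omega>)" "\<rho> s"]
    by (simp add: distrib_right)
  show ?thesis
    using expectation_tendsto(2)[OF prob_M m le lim[OF s]] C by auto
qed

lemma lipschitz_abs_id: "1-lipschitz_on UNIV (\<lambda>x::real. \<bar>x\<bar>)"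
  by (rule lipschitz_onI) (auto simp: dist_real_def)

lemma eventually_on_system: "\<forall>\<^sub>F N in sequentially. 2 \<le> N \<and> on_system N"
  using mean_integrable[OF lipschitz_abs_id order_refl] mean_integrable[OF lipschitz_abs_id T]
    eventually_ge_at_top[of "2::nat"]
proof eventually_elim
  case (elim N)
  have "on_system N"
    unfolding regular_solution_on_def regular_solution_on_axioms_def
    using regular[OF elim(3)] T integrable_of_mean_abs[OF X_M[OF elim(3)] elim(1)]
      integrable_of_mean_abs[OF X_M[OF elim(3)] elim(2)] by auto
  then show ?case using elim by simp
qed

text \<open>Fubini, then dominated convergence in time with the constant majorant \<open>C\<close>.
  It transfers the convergence assumed at each single time to the time integrals.\<close>

lemma time_integral_tendsto:
  fixes F :: "nat \<Rightarrow> 'a \<times> real \<Rightarrow> real"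
  assumes F: "\<forall>\<^sub>F N in sequentially. F N \<in> borel_measurable (P N)"
    and bound: "\<And>N z. \<bar>F N z\<bar> \<le> C"
    and F_lim: "\<And>s. s \<in> {0..T} \<Longrightarrow> (\<lambda>N. LINT \<omega>|M N. F N (\<omega>, s)) \<longlonglongrightarrow> c s"
    and c: "c \<in> borel_measurable L"
  shows "(\<lambda>N. LINT z|P N. F N z) \<longlonglongrightarrow> (LINT s|L. c s)"
    and "\<forall>\<^sub>F N in sequentially. integrable (P N) (F N)"
proof -
  define good where "good = (\<lambda>N. F N \<in> borel_measurable (P N) \<and> 2 \<le> N \<and> on_system N)"
  have ev: "\<forall>\<^sub>F N in sequentially. good N"
    using F eventually_on_system by eventually_elim (simp add: good_def)
  have C: "0 \<le> C" by (rule order_trans[OF abs_ge_zero bound])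
  have good: "integrable (P N) (F N)" "integrable L (\<lambda>s. LINT \<omega>|M N. F N (\<omega>, s))"
    "(LINT z|P N. F N z) = (LINT s|L. LINT \<omega>|M N. F N (\<omega>, s))"
    "\<bar>LINT \<omega>|M N. F N (\<omega>, s)\<bar> \<le> C" if "good N" for N s
  proof -
    interpret S: regular_solution_on "M N" N \<alpha> "\<sigma> N" K U' "X N" "B N" T
      using that by (simp add: good_def)
    have "emeasure (P N) (space (P N)) = emeasure (M N) (space (M N)) * emeasure L (space L)"
      unfolding space_pair_measure by (rule S.L.emeasure_pair_measure_Times) (rule sets.top)+
    then have fin: "emeasure (P N) (space (P N)) < \<infinity>"
      by (simp add: emeasure_restrict_space T S.emeasure_space_1)
    show i: "integrable (P N) (F N)"
    proof (rule integrableI_bounded)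
      have "(\<integral>\<^sup>+z. ennreal (norm (F N z)) \<partial>P N) \<le> (\<integral>\<^sup>+z. ennreal C \<partial>P N)"
        using bound by (intro nn_integral_mono ennreal_leI) auto
      also have "\<dots> < \<infinity>" using fin by (simp add: ennreal_mult_less_top)
      finally show "(\<integral>\<^sup>+z. ennreal (norm (F N z)) \<partial>P N) < \<infinity>" .
    qed (use that in \<open>simp add: good_def\<close>)
    show "integrable L (\<lambda>s. LINT \<omega>|M N. F N (\<omega>, s))"
      using S.integrable_snd[of "\<lambda>\<omega> s. F N (\<omega>, s)"] i by simp
    show "(LINT z|P N. F N z) = (LINT s|L. LINT \<omega>|M N. F N (\<omega>, s))"
      using S.integral_snd[of "\<lambda>\<omega> s. F N (\<omega>, s)"] i by simp
    have "\<bar>LINT \<omega>|M N. F N (\<omega>, s)\<bar> \<le> (LINT \<omega>|M N. \<bar>F N (\<omega>, s)\<bar>)" by (rule integral_abs_bound)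
    also have "\<dots> \<le> (LINT \<omega>|M N. C)"
      using bound C by (intro Bochner_Integration.integral_mono') auto
    finally show "\<bar>LINT \<omega>|M N. F N (\<omega>, s)\<bar> \<le> C" by (simp add: S.prob_space)
  qed
  show "\<forall>\<^sub>F N in sequentially. integrable (P N) (F N)"
    using ev by eventually_elim (rule good(1))
  \<comment> \<open>Dominated convergence asks for measurability at every index, while the systems
    are known to be good only eventually; the others are replaced by 0.\<close>
  define u where "u = (\<lambda>N s. if good N then LINT \<omega>|M N. F N (\<omega>, s) else 0)"
  interpret L: finite_measure L
    by (rule finite_measureI) (use T in \<open>simp add: emeasure_restrict_space\<close>)
  have "(\<lambda>N. LINT s|L. u N s) \<longlonglongrightarrow> (LINT s|L. c s)"
  proof (rule integral_dominated_convergence)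
    show "integrable L (\<lambda>_. C)" by simp
    show "u N \<in> borel_measurable L" for N
      using good(2)[of N] by (cases "good N") (auto simp: u_def)
    show "AE s in L. norm (u N s) \<le> C" for N
      using good(4)[of N] C by (auto simp: u_def)
    show "AE s in L. (\<lambda>N. u N s) \<longlonglongrightarrow> c s"
    proof (rule AE_I2)
      fix s assume "s \<in> space L"
      then have "(\<lambda>N. LINT \<omega>|M N. F N (\<omega>, s)) \<longlonglongrightarrow> c s" using F_lim by simp
      then show "(\<lambda>N. u N s) \<longlonglongrightarrow> c s"
        by (rule Lim_transform_eventually) (use ev in eventually_elim, simp add: u_def)
    qed
  qed (rule c)
  then show "(\<lambda>N. LINT z|P N. F N z) \<longlonglongrightarrow> (LINT s|L. c s)"
    by (rule Lim_transform_eventually) (use ev in eventually_elim, simp add: u_def good(3))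
qed

text \<open>Uniformity in \<open>N\<close> comes from the convergence of the first absolute moment
  at \<open>T\<close>. The constants \<open>m + 1\<close> and 2 are eventual bounds for that moment
  and for \<open>sqrt (2 * \<sigma> N)\<close>.\<close>

lemma riesz_energy_bounded:
  assumes \<beta>: "0 < \<beta>" "2 * \<beta> < \<alpha>"
  shows "\<exists>C\<ge>0. \<forall>\<^sub>F N in sequentially. integrable (P N) (\<lambda>z. riesz_energy N \<beta> (configuration N z)) \<and>
    (LINT z|P N. riesz_energy N \<beta> (configuration N z)) \<le> C"
proof -
  define m where "m = (LINT x|\<rho> T. \<bar>x\<bar>)"
  define A where "A = 1 + K * exp (K * T) * (1 + T)"
  define C where "C = 2 * (A * (m + 1 + 2 * (1 + T)\<^sup>2)) + 2 / (1 - \<beta> / (\<alpha> - \<beta>)) * T"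
  have "\<forall>\<^sub>F N in sequentially. (LINT \<omega>|M N. (\<Sum>i = 1..N. \<bar>X N i T \<omega>\<bar>) / N) < m + 1"
    by (rule order_tendstoD(2)[OF mean_tendsto[OF lipschitz_abs_id T]]) (simp add: m_def)
  moreover have "\<forall>\<^sub>F N in sequentially. \<sigma> N < 1"
    by (rule order_tendstoD(2)[OF \<sigma>_lim]) simp
  ultimately have ev: "\<forall>\<^sub>F N in sequentially. integrable (P N) (\<lambda>z. riesz_energy N \<beta> (configuration N z)) \<and>
      (LINT z|P N. riesz_energy N \<beta> (configuration N z)) \<le> C"
    using eventually_on_system
  proof eventually_elim
    case (elim N)
    interpret S: regular_solution_on "M N" N \<alpha> "\<sigma> N" K U' "X N" "B N" T using elim by simp
    have A: "0 \<le> A" unfolding A_def using S.K T by simp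
    have "sqrt (2 * \<sigma> N) \<le> sqrt 4" using elim by (intro real_sqrt_le_mono) simp
    then have sq: "sqrt (2 * \<sigma> N) \<le> 2" by simp
    have "(LINT z|P N. ranked_energy N \<alpha> (configuration N z)) \<le>
        A * ((LINT \<omega>|M N. (\<Sum>i = 1..N. \<bar>X N i T \<omega>\<bar>) / N) + sqrt (2 * \<sigma> N) * (1 + T)\<^sup>2)"
      unfolding A_def by (rule S.ranked_energy_bound(2))
    also have "\<dots> \<le> A * (m + 1 + 2 * (1 + T)\<^sup>2)"
      using A sq elim(1) by (intro mult_left_mono add_mono mult_right_mono) auto
    finally show ?case
      using S.riesz_energy_bound[OF \<beta>] by (simp add: C_def)
  qed
  then have "\<forall>\<^sub>F N in sequentially. integrable (P N) (\<lambda>z. riesz_energy N \<beta> (configuration N z)) \<and>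
      (LINT z|P N. riesz_energy N \<beta> (configuration N z)) \<le> max 0 C"
    by eventually_elim auto
  then show ?thesis by (intro exI[of _ "max 0 C"]) auto
qed

lemma continuous_measurable_L:
  fixes c :: "real \<Rightarrow> real"
  assumes "continuous_on {0..} c"
  shows "c \<in> borel_measurable L"
proof -
  have "c \<in> borel_measurable (restrict_space borel {0..T})"
    by (intro borel_measurable_continuous_on_restrict continuous_on_subset[OF assms]) auto
  moreover have "sets L = sets (restrict_space borel {0..T})"
    by (rule sets_restrict_space_cong) simp
  ultimately show ?thesis using measurable_cong_sets by blast
qed

text \<open>This is where the time continuity of the limit enters: functionals controlled by
  \<open>W2\<close> become continuous in time, hence measurable on \<open>L\<close>.\<close>

lemma continuous_on_W2:
  fixes c :: "real \<Rightarrow> real"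
  assumes "\<And>s t. 0 \<le> s \<Longrightarrow> 0 \<le> t \<Longrightarrow> \<bar>c s - c t\<bar> \<le> C * W2 (\<rho> s) (\<rho> t)"
  shows "continuous_on {0..} c"
  unfolding continuous_on_def
proof
  fix t :: real assume t: "t \<in> {0..}"
  have "((\<lambda>s. C * W2 (\<rho> s) (\<rho> t)) \<longlongrightarrow> C * 0) (at t within {0..})"
    using t by (intro tendsto_mult tendsto_const \<rho>_cont) simp
  then have z: "((\<lambda>s. C * W2 (\<rho> s) (\<rho> t)) \<longlongrightarrow> 0) (at t within {0..})" by simp
  show "(c \<longlongrightarrow> c t) (at t within {0..})"
    by (rule LIM_zero_cancel, rule Lim_null_comparison[OF _ z])
       (use assms t in \<open>auto simp: eventually_at_filter\<close>)
qed

lemma mean_measurable_L: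
  fixes g :: "real \<Rightarrow> real"
  assumes "C-lipschitz_on UNIV g"
  shows "(\<lambda>s. LINT x|\<rho> s. g x) \<in> borel_measurable L"
proof (rule continuous_measurable_L, rule continuous_on_W2)
  show "\<bar>(LINT x|\<rho> s. g x) - (LINT x|\<rho> t. g x)\<bar> \<le> C * W2 (\<rho> s) (\<rho> t)" if "0 \<le> s" "0 \<le> t" for s t
    by (rule W2_lipschitz[OF \<rho>_P2 \<rho>_P2 assms]) fact+
qed

lemma pair_mean_measurable_L:
  assumes "pair_lipschitz C G"
  shows "(\<lambda>s. LINT x|\<rho> s. LINT y|\<rho> s. G x y) \<in> borel_measurable L"
proof (rule continuous_measurable_L, rule continuous_on_W2)
  show "\<bar>(LINT x|\<rho> s. LINT y|\<rho> s. G x y) - (LINT x|\<rho> t. LINT y|\<rho> t. G x y)\<bar> \<le> 2 * C * W2 (\<rho> s) (\<rho> t)"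
    if "0 \<le> s" "0 \<le> t" for s t
    using assms unfolding pair_lipschitz_def by (intro W2_lipschitz_pair(1) \<rho>_P2 that) auto
qed

lemma mean_time_integral_tendsto:
  assumes g: "C-lipschitz_on UNIV g" and bound: "\<And>x. \<bar>g x\<bar> \<le> b"
  shows "(\<lambda>N. LINT z|P N. (\<Sum>i = 1..N. g (configuration N z i)) / N) \<longlonglongrightarrow> (LINT s|L. LINT x|\<rho> s. g x)"
proof (rule time_integral_tendsto(1))
  show "\<forall>\<^sub>F N in sequentially. (\<lambda>z. (\<Sum>i = 1..N. g (configuration N z i)) / N) \<in> borel_measurable (P N)"
    using eventually_on_system
  proof eventually_elim
    case (elim N)
    have "(\<lambda>z. g (configuration N z i)) \<in> borel_measurable (P N)" if "i \<in> {1..N}" for i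
      by (rule measurable_compose[OF regular_solution_on.X_P[OF conjunct2[OF elim] that] lipschitz_borel_measurable[OF g]])
    then show ?case by (intro borel_measurable_divide borel_measurable_sum) auto
  qed
  have b: "0 \<le> b" using bound[of 0] by linarith
  show "\<bar>(\<Sum>i = 1..N. g (configuration N z i)) / N\<bar> \<le> b" for N z
  proof -
    have "\<bar>\<Sum>i = 1..N. g (configuration N z i)\<bar> \<le> (\<Sum>i = 1..N. b)"
      by (rule order_trans[OF sum_abs sum_mono]) (rule bound)
    then show ?thesis using b by (cases "N = 0") (auto simp: divide_le_eq mult.commute)
  qed
  show "(\<lambda>N. LINT \<omega>|M N. (\<Sum>i = 1..N. g (configuration N (\<omega>, s) i)) / N) \<longlonglongrightarrow> (LINT x|\<rho> s. g x)"
    if "s \<in> {0..T}" for s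
    using mean_tendsto[OF g, of s] that by simp
qed (rule mean_measurable_L[OF g])

lemma
  assumes G: "pair_lipschitz C G" and Gm: "(\<lambda>z. G (fst z) (snd z)) \<in> borel_measurable (borel \<Otimes>\<^sub>M borel)"
    and bound: "\<And>x y. \<bar>G x y\<bar> \<le> b"
  shows pair_mean_time_integral_tendsto:
      "(\<lambda>N. LINT z|P N. pair_mean N G (configuration N z)) \<longlonglongrightarrow> (LINT s|L. LINT x|\<rho> s. LINT y|\<rho> s. G x y)"
    and pair_mean_integrable: "\<forall>\<^sub>F N in sequentially. integrable (P N) (\<lambda>z. pair_mean N G (configuration N z))"
proof -
  have m: "\<forall>\<^sub>F N in sequentially. (\<lambda>z. pair_mean N G (configuration N z)) \<in> borel_measurable (P N)"
    using eventually_on_system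
  proof eventually_elim
    case (elim N)
    have "(\<lambda>z. G (configuration N z i) (configuration N z j)) \<in> borel_measurable (P N)"
      if "i \<in> {1..N}" "j \<in> {1..N}" for i j
    proof -
      have "(\<lambda>z. (configuration N z i, configuration N z j)) \<in> measurable (P N) (borel \<Otimes>\<^sub>M borel)"
        using regular_solution_on.X_P[OF conjunct2[OF elim]] that by (intro measurable_Pair) auto
      from measurable_compose[OF this Gm] show ?thesis by simp
    qed
    then show ?case by (intro borel_measurable_divide borel_measurable_sum) auto
  qed
  have b: "0 \<le> b" using bound[of 0 0] by linarith
  have le: "\<bar>pair_mean N G (configuration N z)\<bar> \<le> b" for N z
  proof -
    have "\<bar>\<Sum>i = 1..N. \<Sum>j = 1..N. G (configuration N z i) (configuration N z j)\<bar> \<le> (\<Sum>i = 1..N. \<Sum>j = 1..N. b)"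
      by (rule order_trans[OF sum_abs sum_mono], rule order_trans[OF sum_abs sum_mono]) (rule bound)
    then show ?thesis using b by (cases "N = 0") (auto simp: divide_le_eq mult_ac power2_eq_square)
  qed
  have l: "(\<lambda>N. LINT \<omega>|M N. pair_mean N G (configuration N (\<omega>, s))) \<longlonglongrightarrow> (LINT x|\<rho> s. LINT y|\<rho> s. G x y)"
    if "s \<in> {0..T}" for s
    using pair_mean_tendsto[OF G Gm, of s] that by simp
  note t = time_integral_tendsto[OF m le l pair_mean_measurable_L[OF G]]
  show "(\<lambda>N. LINT z|P N. pair_mean N G (configuration N z)) \<longlonglongrightarrow> (LINT s|L. LINT x|\<rho> s. LINT y|\<rho> s. G x y)"
    by (rule t(1))
  show "\<forall>\<^sub>F N in sequentially. integrable (P N) (\<lambda>z. pair_mean N G (configuration N z))"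
    by (rule t(2))
qed

text \<open>Monotone convergence writes the integral of a singular function as a supremum of
  integrals of bounded functions. For Lipschitz truncations those depend continuously on time, so
  the supremum is measurable in \<open>s\<close>.\<close>

lemma nn_integral_increasing_pair:
  fixes G :: "nat \<Rightarrow> real \<Rightarrow> real \<Rightarrow> real"
  assumes Gm: "\<And>m. (\<lambda>z. G m (fst z) (snd z)) \<in> borel_measurable (borel \<Otimes>\<^sub>M borel)"
    and bound: "\<And>m x y. \<bar>G m x y\<bar> \<le> b m" and nonneg: "\<And>m x y. 0 \<le> G m x y"
    and inc: "\<And>x y. incseq (\<lambda>m. G m x y)" and g: "\<And>x y. (\<lambda>m. G m x y) \<longlonglongrightarrow> g (x, y)" and s: "0 \<le> s"
  shows "(\<integral>\<^sup>+z. ennreal (g z) \<partial>(\<rho> s \<Otimes>\<^sub>M \<rho> s)) = (SUP m. ennreal (LINT x|\<rho> s. LINT y|\<rho> s. G m x y))"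
proof -
  note I = P2_pair_integral[OF \<rho>_P2[OF s] Gm, OF bound]
  have "(SUP m. ennreal (G m (fst z) (snd z))) = ennreal (g z)" for z
  proof -
    have "(\<lambda>m. ennreal (G m (fst z) (snd z))) \<longlonglongrightarrow> ennreal (g z)"
      using g[of "fst z" "snd z"] by (intro tendsto_ennrealI) simp
    moreover have "(\<lambda>m. ennreal (G m (fst z) (snd z))) \<longlonglongrightarrow> (SUP m. ennreal (G m (fst z) (snd z)))"
      using inc[of "fst z" "snd z"] by (intro LIMSEQ_SUP) (auto simp: incseq_def intro: ennreal_leI)
    ultimately show ?thesis using LIMSEQ_unique by blast
  qed
  then have "(\<integral>\<^sup>+z. ennreal (g z) \<partial>(\<rho> s \<Otimes>\<^sub>M \<rho> s))
      = (\<integral>\<^sup>+z. (SUP m. ennreal (G m (fst z) (snd z))) \<partial>(\<rho> s \<Otimes>\<^sub>M \<rho> s))" by simp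
  also have "\<dots> = (SUP m. \<integral>\<^sup>+z. ennreal (G m (fst z) (snd z)) \<partial>(\<rho> s \<Otimes>\<^sub>M \<rho> s))"
  proof (rule nn_integral_monotone_convergence_SUP)
    show "incseq (\<lambda>m z. ennreal (G m (fst z) (snd z)))"
      using inc by (auto simp: incseq_def le_fun_def intro!: ennreal_leI)
    show "(\<lambda>z. ennreal (G m (fst z) (snd z))) \<in> borel_measurable (\<rho> s \<Otimes>\<^sub>M \<rho> s)" for m
      using I(1)[of m] by auto
  qed
  also have "\<dots> = (SUP m. ennreal (LINT x|\<rho> s. LINT y|\<rho> s. G m x y))"
    using I nonneg by (intro SUP_cong refl) (simp add: nn_integral_eq_integral)
  finally show ?thesis .
qed

end

section \<open>The limit of the singular interaction\<close>

lemma truncated_power_tendsto: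
  assumes d: "d \<longlonglongrightarrow> 0"
  shows "(\<lambda>m. truncated_power (d m) p u) \<longlonglongrightarrow> u / \<bar>u\<bar> powr p"
proof (cases "u = 0")
  case False
  then have "\<forall>\<^sub>F m in sequentially. d m < \<bar>u\<bar>" using order_tendstoD(2)[OF d, of "\<bar>u\<bar>"] by simp
  then have "\<forall>\<^sub>F m in sequentially. u / \<bar>u\<bar> powr p = truncated_power (d m) p u"
    by eventually_elim (simp add: truncated_power_eq)
  with tendsto_const show ?thesis by (rule Lim_transform_eventually)
qed (simp add: truncated_power_def)

definition cutoff :: "nat \<Rightarrow> real" where "cutoff m = 1 / real (Suc m)"

lemma cutoff_pos: "0 < cutoff m"
  by (simp add: cutoff_def)

lemma cutoff_antimono: "m \<le> n \<Longrightarrow> cutoff n \<le> cutoff m"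
  by (simp add: cutoff_def frac_le)

lemma cutoff_tendsto: "cutoff \<longlonglongrightarrow> 0"
  unfolding cutoff_def[abs_def] using LIMSEQ_inverse_real_of_nat by (simp add: inverse_eq_divide)

lemma abs_truncated_power_incseq:
  assumes "0 \<le> p"
  shows "incseq (\<lambda>m. \<bar>truncated_power (cutoff m) p u\<bar>)"
  unfolding incseq_def by (intro allI impI abs_truncated_power_antimono cutoff_pos cutoff_antimono assms)

section \<open>Truncation of the interaction kernel\<close>

context test_function
begin

definition truncated_kernel :: "real \<Rightarrow> nat \<Rightarrow> real \<Rightarrow> real \<Rightarrow> real" where
  "truncated_kernel \<alpha> m x y = (f' x - f' y) * truncated_power (cutoff m) (\<alpha> + 1) (x - y)"

lemma interaction_kernel_eq:
  "interaction_kernel \<alpha> f' (x, y) = (f' x - f' y) * ((x - y) / \<bar>x - y\<bar> powr (\<alpha> + 1))"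
  by (simp add: interaction_kernel_def)

lemma interaction_kernel_measurable: "interaction_kernel \<alpha> f' \<in> borel_measurable (borel \<Otimes>\<^sub>M borel)"
  unfolding interaction_kernel_def split_beta' by measurable

lemma truncated_kernel_measurable:
  "(\<lambda>z. truncated_kernel \<alpha> m (fst z) (snd z)) \<in> borel_measurable (borel \<Otimes>\<^sub>M borel)"
  unfolding truncated_kernel_def by measurable

lemma truncated_kernel_tendsto: "(\<lambda>m. truncated_kernel \<alpha> m x y) \<longlonglongrightarrow> interaction_kernel \<alpha> f' (x, y)"
  unfolding truncated_kernel_def interaction_kernel_eq
  by (intro tendsto_mult tendsto_const truncated_power_tendsto cutoff_tendsto)

context
  fixes \<alpha> :: real
  assumes \<alpha>: "1 \<le> \<alpha>"
begin

lemma truncated_kernel_pair_lipschitz: "\<exists>C. pair_lipschitz C (truncated_kernel \<alpha> m)"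
  unfolding truncated_kernel_def[abs_def]
  using truncated_kernel_lipschitz[OF cutoff_pos, of "\<alpha> + 1" m] \<alpha> by (intro exI) auto

lemma truncated_kernel_bound: "\<bar>truncated_kernel \<alpha> m x y\<bar> \<le> 2 * C\<^sub>1 * cutoff m powr (- \<alpha>)"
proof -
  have "\<bar>f' x - f' y\<bar> \<le> 2 * C\<^sub>1" using bounded[of x] bounded[of y] by linarith
  then show ?thesis
    unfolding truncated_kernel_def abs_mult
    using abs_truncated_power_bound[OF cutoff_pos, of "\<alpha> + 1" m "x - y"] \<alpha> C\<^sub>1_nonneg by (intro mult_mono) auto
qed

lemma abs_truncated_kernel_incseq: "incseq (\<lambda>m. \<bar>truncated_kernel \<alpha> m x y\<bar>)"
  using abs_truncated_power_incseq[of "\<alpha> + 1" "x - y"] \<alpha>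
  by (auto simp: incseq_def truncated_kernel_def abs_mult intro: mult_left_mono)

lemma abs_truncated_kernel_le: "\<bar>truncated_kernel \<alpha> m x y\<bar> \<le> \<bar>interaction_kernel \<alpha> f' (x, y)\<bar>"
  using incseq_le[OF abs_truncated_kernel_incseq tendsto_rabs[OF truncated_kernel_tendsto]] .

lemma abs_interaction_kernel_le: "\<bar>interaction_kernel \<alpha> f' (x, y)\<bar> \<le> C\<^sub>2 * \<bar>x - y\<bar> powr (1 - \<alpha>)"
proof (cases "x = y")
  case False
  have "\<bar>interaction_kernel \<alpha> f' (x, y)\<bar> = \<bar>f' x - f' y\<bar> * (\<bar>x - y\<bar> / \<bar>x - y\<bar> powr (\<alpha> + 1))"
    by (simp add: interaction_kernel_eq abs_mult)
  also have "\<dots> \<le> (C\<^sub>2 * \<bar>x - y\<bar>) * (\<bar>x - y\<bar> / \<bar>x - y\<bar> powr (\<alpha> + 1))"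
    by (intro mult_right_mono lipschitz) simp
  also have "\<dots> = C\<^sub>2 * \<bar>x - y\<bar> powr (1 - \<alpha>)"
    using False by (simp add: powr_diff powr_add)
  finally show ?thesis .
qed (simp add: interaction_kernel_eq)

text \<open>The two kernels differ only below the cutoff, where the error is at most the full kernel
  and hence at most a constant times \<open>|x - y| powr (1 - \<alpha>)\<close>. Splitting off the
  Riesz power of order \<beta> leaves a nonnegative power of the distance, bounded by that of the
  cutoff.\<close>

lemma truncated_kernel_error:
  assumes \<beta>: "\<alpha> - 1 \<le> \<beta>"
  shows "\<bar>interaction_kernel \<alpha> f' (x, y) - truncated_kernel \<alpha> m x y\<bar>
    \<le> C\<^sub>2 * cutoff m powr (\<beta> + 1 - \<alpha>) * \<bar>x - y\<bar> powr (- \<beta>)"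
proof (cases "cutoff m \<le> \<bar>x - y\<bar>")
  case True
  then show ?thesis
    using C\<^sub>2_nonneg by (simp add: truncated_kernel_def interaction_kernel_eq truncated_power_eq)
next
  case False
  define u where "u = x - y"
  let ?a = "1 / (max \<bar>u\<bar> (cutoff m)) powr (\<alpha> + 1)" and ?b = "1 / \<bar>u\<bar> powr (\<alpha> + 1)"
  show ?thesis
  proof (cases "u = 0")
    case True
    then show ?thesis by (simp add: u_def truncated_kernel_def interaction_kernel_eq)
  next
    case u: False
    have ab: "0 \<le> ?a" "?a \<le> ?b"
      using u \<alpha> by (auto intro!: divide_left_mono powr_mono2 mult_pos_pos)
    have "\<bar>interaction_kernel \<alpha> f' (x, y) - truncated_kernel \<alpha> m x y\<bar> = \<bar>(f' x - f' y) * u * (?b - ?a)\<bar>"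
      by (simp add: truncated_kernel_def interaction_kernel_eq truncated_power_def u_def right_diff_distrib)
    also have "\<dots> = \<bar>(f' x - f' y) * u\<bar> * (?b - ?a)" using ab(2) by (simp add: abs_mult)
    also have "\<dots> \<le> \<bar>(f' x - f' y) * u\<bar> * ?b" using ab by (intro mult_left_mono) auto
    also have "\<dots> = \<bar>interaction_kernel \<alpha> f' (x, y)\<bar>" by (simp add: interaction_kernel_eq u_def abs_mult)
    also have "\<dots> \<le> C\<^sub>2 * \<bar>u\<bar> powr (1 - \<alpha>)" unfolding u_def by (rule abs_interaction_kernel_le)
    also have "\<bar>u\<bar> powr (1 - \<alpha>) = \<bar>u\<bar> powr (\<beta> + 1 - \<alpha>) * \<bar>u\<bar> powr (- \<beta>)" by (simp add: powr_add[symmetric])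
    also have "C\<^sub>2 * (\<bar>u\<bar> powr (\<beta> + 1 - \<alpha>) * \<bar>u\<bar> powr (- \<beta>)) \<le> C\<^sub>2 * (cutoff m powr (\<beta> + 1 - \<alpha>) * \<bar>u\<bar> powr (- \<beta>))"
      using False \<beta> by (intro mult_left_mono mult_right_mono powr_mono2 C\<^sub>2_nonneg) (auto simp: u_def)
    finally show ?thesis by (simp add: u_def mult.assoc)
  qed
qed

text \<open>Up to distance 1 the singularity of order \<open>\<alpha> - 1\<close> is dominated by
  that of order \<beta>; beyond it the power is at most 1, which accounts for the added 1.\<close>

lemma abs_interaction_kernel_le_riesz:
  assumes \<beta>: "\<alpha> - 1 \<le> \<beta>"
  shows "\<bar>interaction_kernel \<alpha> f' (x, y)\<bar> \<le> C\<^sub>2 * (\<bar>x - y\<bar> powr (- \<beta>) + 1)"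
proof -
  have "\<bar>x - y\<bar> powr (1 - \<alpha>) \<le> \<bar>x - y\<bar> powr (- \<beta>) + 1"
  proof (cases "\<bar>x - y\<bar> \<le> 1")
    case True
    then have "\<bar>x - y\<bar> powr (1 - \<alpha>) \<le> \<bar>x - y\<bar> powr (- \<beta>)"
      using \<beta> by (cases "x = y") (auto intro!: powr_mono')
    then show ?thesis by simp
  next
    case False
    then have "\<bar>x - y\<bar> powr (1 - \<alpha>) \<le> 1" using \<alpha> powr_mono2'[of "1 - \<alpha>" 1 "\<bar>x - y\<bar>"] by simp
    then show ?thesis by (simp add: add_increasing)
  qed
  then show ?thesis
    by (intro order_trans[OF abs_interaction_kernel_le] mult_left_mono C\<^sub>2_nonneg)
qed

end

end

context mean_field_limit
begin

text \<open>The midpoint of the admissible orders, which lie between \<open>\<alpha> - 1\<close> and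
  \<open>\<alpha> / 2\<close>.\<close>

definition \<beta> :: real where "\<beta> = (3 * \<alpha> - 2) / 4"

lemma \<beta>: "0 < \<beta>" "2 * \<beta> < \<alpha>" "\<alpha> - 1 < \<beta>"
  using \<alpha> by (auto simp: \<beta>_def)

text \<open>Extended-valued, since finiteness is a conclusion and holds only for almost every
  time.\<close>

definition riesz :: "real \<Rightarrow> ennreal" where
  "riesz s = (\<integral>\<^sup>+z. ennreal (\<bar>fst z - snd z\<bar> powr (- \<beta>)) \<partial>(\<rho> s \<Otimes>\<^sub>M \<rho> s))"

abbreviation self_integral :: "(real \<Rightarrow> real \<Rightarrow> real) \<Rightarrow> real \<Rightarrow> real" where
  "self_integral G s \<equiv> (LINT x|\<rho> s. LINT y|\<rho> s. G x y)"

lemma pair_prob_\<rho>: "0 \<le> s \<Longrightarrow> prob_space (\<rho> s \<Otimes>\<^sub>M \<rho> s)"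
  by (intro prob_space_pair P2_D(1) \<rho>_P2)

lemma sets_\<rho>_pair: "0 \<le> s \<Longrightarrow> sets (\<rho> s \<Otimes>\<^sub>M \<rho> s) = sets (borel \<Otimes>\<^sub>M borel)"
  by (rule sets_pair_measure_cong) (use P2_D(2)[OF \<rho>_P2] in auto)

lemma measurable_\<rho>_pair:
  "0 \<le> s \<Longrightarrow> g \<in> borel_measurable (borel \<Otimes>\<^sub>M borel) \<Longrightarrow> g \<in> borel_measurable (\<rho> s \<Otimes>\<^sub>M \<rho> s)"
  using measurable_cong_sets[OF sets_\<rho>_pair refl] by blast

lemma self_integral_eq:
  assumes "(\<lambda>z. G (fst z) (snd z)) \<in> borel_measurable (borel \<Otimes>\<^sub>M borel)" "\<And>x y. \<bar>G x y\<bar> \<le> b" "0 \<le> s"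
  shows "integrable (\<rho> s \<Otimes>\<^sub>M \<rho> s) (\<lambda>z. G (fst z) (snd z))"
    and "self_integral G s = (LINT z|(\<rho> s \<Otimes>\<^sub>M \<rho> s). G (fst z) (snd z))"
  using P2_pair_integral[OF \<rho>_P2[OF assms(3)] assms(1), of b] assms(2) by auto

lemma self_integral_mono:
  assumes "(\<lambda>z. G (fst z) (snd z)) \<in> borel_measurable (borel \<Otimes>\<^sub>M borel)" "\<And>x y. \<bar>G x y\<bar> \<le> b"
    and "(\<lambda>z. G' (fst z) (snd z)) \<in> borel_measurable (borel \<Otimes>\<^sub>M borel)" "\<And>x y. \<bar>G' x y\<bar> \<le> b'"
    and "\<And>x y. G x y \<le> G' x y" and s: "0 \<le> s"
  shows "self_integral G s \<le> self_integral G' s"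
  unfolding self_integral_eq(2)[OF assms(1,2) s] self_integral_eq(2)[OF assms(3,4) s]
  by (intro integral_mono self_integral_eq(1)[OF assms(1,2) s] self_integral_eq(1)[OF assms(3,4) s] assms(5))

lemma self_integral_bound:
  assumes "(\<lambda>z. G (fst z) (snd z)) \<in> borel_measurable (borel \<Otimes>\<^sub>M borel)" "\<And>x y. \<bar>G x y\<bar> \<le> b" and s: "0 \<le> s"
  shows "\<bar>self_integral G s\<bar> \<le> b"
proof -
  interpret prob_space "\<rho> s \<Otimes>\<^sub>M \<rho> s" by (rule pair_prob_\<rho>[OF s])
  note E = self_integral_eq[OF assms]
  have "\<bar>self_integral G s\<bar> \<le> (LINT z|(\<rho> s \<Otimes>\<^sub>M \<rho> s). \<bar>G (fst z) (snd z)\<bar>)"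
    unfolding E(2) by (rule integral_abs_bound)
  also have "\<dots> \<le> (LINT z|(\<rho> s \<Otimes>\<^sub>M \<rho> s). b)"
    using E(1) assms(2) by (intro integral_mono) auto
  finally show ?thesis by (simp add: prob_space)
qed

lemma finite_L: "finite_measure L"
  by (rule finite_measureI) (use T in \<open>simp add: emeasure_restrict_space\<close>)

lemma self_integral_integrable_L:
  assumes "pair_lipschitz C G" "(\<lambda>z. G (fst z) (snd z)) \<in> borel_measurable (borel \<Otimes>\<^sub>M borel)" "\<And>x y. \<bar>G x y\<bar> \<le> b"
  shows "integrable L (self_integral G)"
proof -
  interpret finite_measure L by (rule finite_L)
  have "AE s in L. norm (self_integral G s) \<le> b"
    using self_integral_bound[OF assms(2,3)] by (intro AE_I2) auto
  then show ?thesis using pair_mean_measurable_L[OF assms(1)] by (rule integrable_const_bound)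
qed

text \<open>Lower semicontinuity of the Riesz energy: truncations pass to the limit with the uniform
  bound of the particle systems, and monotone convergence then removes the truncation, both in space
  and in time.\<close>

lemma riesz_limit:
  shows "riesz \<in> borel_measurable L"
    and "\<exists>C\<ge>0. (\<integral>\<^sup>+s. riesz s \<partial>L) \<le> ennreal C \<and>
      (\<forall>\<^sub>F N in sequentially. integrable (P N) (\<lambda>z. riesz_energy N \<beta> (configuration N z)) \<and>
        (LINT z|P N. riesz_energy N \<beta> (configuration N z)) \<le> C)"
proof -
  obtain C where C: "0 \<le> C" and ev: "\<forall>\<^sub>F N in sequentially. integrable (P N) (\<lambda>z. riesz_energy N \<beta> (configuration N z)) \<and>
      (LINT z|P N. riesz_energy N \<beta> (configuration N z)) \<le> C"
    using riesz_energy_bounded[OF \<beta>(1,2)] by blast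
  define G where "G = (\<lambda>m x y. \<bar>truncated_power (cutoff m) (\<beta> + 1) (x - y)\<bar>)"
  define b where "b = (\<lambda>m. cutoff m powr (- \<beta>))"
  have Gl: "\<exists>C. pair_lipschitz C (G m)" for m
    unfolding G_def
    by (rule exI, rule pair_lipschitz_abs, rule pair_lipschitz_diff, rule truncated_power_lipschitz[OF cutoff_pos])
       (use \<beta>(1) in simp)
  have Gm: "(\<lambda>z. G m (fst z) (snd z)) \<in> borel_measurable (borel \<Otimes>\<^sub>M borel)" for m
    unfolding G_def by measurable
  have Gb: "\<bar>G m x y\<bar> \<le> b m" for m x y
    using abs_truncated_power_bound[OF cutoff_pos, of "\<beta> + 1" m "x - y"] \<beta>(1) by (simp add: G_def b_def)
  have G0: "0 \<le> G m x y" for m x y by (simp add: G_def)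
  have Ginc: "incseq (\<lambda>m. G m x y)" for x y
    unfolding G_def using \<beta>(1) by (intro abs_truncated_power_incseq) simp
  have Glim: "(\<lambda>m. G m x y) \<longlonglongrightarrow> (\<lambda>z. \<bar>fst z - snd z\<bar> powr (- \<beta>)) (x, y)" for x y
    using tendsto_rabs[OF truncated_power_tendsto[OF cutoff_tendsto, of "\<beta> + 1" "x - y"]] abs_divide_powr[of "x - y" "\<beta> + 1"]
    by (simp add: G_def abs_divide)
  have sup: "riesz s = (SUP m. ennreal (self_integral (G m) s))" if "0 \<le> s" for s
    unfolding riesz_def by (rule nn_integral_increasing_pair[OF Gm Gb G0 Ginc Glim that])
  have meas: "(\<lambda>s. ennreal (self_integral (G m) s)) \<in> borel_measurable L" for m
    using Gl[of m] pair_mean_measurable_L by (auto intro!: measurable_compose[OF _ measurable_ennreal])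
  have "(\<lambda>s. SUP m. ennreal (self_integral (G m) s)) \<in> borel_measurable L"
    using meas by (intro borel_measurable_SUP) auto
  then show "riesz \<in> borel_measurable L"
    by (rule measurable_cong[THEN iffD2, rotated]) (simp add: sup)
  \<comment> \<open>Here \<open>N\<close> tends to infinity at a fixed cutoff; on each particle
    system the truncated mean lies below the Riesz energy.\<close>
  have int_le: "(LINT s|L. self_integral (G m) s) \<le> C" for m
  proof -
    obtain D where D: "pair_lipschitz D (G m)" using Gl by blast
    show ?thesis
    proof (rule tendsto_le[OF _ tendsto_const pair_mean_time_integral_tendsto[OF D Gm Gb]])
      show "\<forall>\<^sub>F N in sequentially. (LINT z|P N. pair_mean N (G m) (configuration N z)) \<le> C"
        using ev pair_mean_integrable[OF D Gm Gb]
      proof eventually_elim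
        case (elim N)
        have "pair_mean N (G m) y \<le> riesz_energy N \<beta> y" for y
          unfolding riesz_energy_def G_def
          using abs_truncated_power_le[OF cutoff_pos, of "\<beta> + 1"] \<beta>(1)
          by (intro divide_right_mono sum_mono) auto
        then have "(LINT z|P N. pair_mean N (G m) (configuration N z)) \<le> (LINT z|P N. riesz_energy N \<beta> (configuration N z))"
          using elim by (intro integral_mono) auto
        then show ?case using elim by linarith
      qed
    qed simp
  qed
  have "(\<integral>\<^sup>+s. riesz s \<partial>L) = (\<integral>\<^sup>+s. (SUP m. ennreal (self_integral (G m) s)) \<partial>L)"
    by (intro nn_integral_cong) (simp add: sup)
  also have "\<dots> = (SUP m. \<integral>\<^sup>+s. ennreal (self_integral (G m) s) \<partial>L)"
  proof (rule nn_integral_monotone_convergence_SUP_AE[OF _ meas])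
    show "AE s in L. ennreal (self_integral (G m) s) \<le> ennreal (self_integral (G (Suc m)) s)" for m
      using Ginc by (intro AE_I2 ennreal_leI self_integral_mono[OF Gm Gb Gm Gb]) (auto simp: incseq_Suc_iff)
  qed
  also have "\<dots> \<le> ennreal C"
  proof (rule SUP_least)
    fix m
    have "(\<integral>\<^sup>+s. ennreal (self_integral (G m) s) \<partial>L) = ennreal (LINT s|L. self_integral (G m) s)"
      using Gl[of m] self_integral_integrable_L[OF _ Gm Gb] G0
      by (intro nn_integral_eq_integral) (auto intro!: AE_I2 Bochner_Integration.integral_nonneg)
    also have "\<dots> \<le> ennreal C" by (rule ennreal_leI[OF int_le])
    finally show "(\<integral>\<^sup>+s. ennreal (self_integral (G m) s) \<partial>L) \<le> ennreal C" .
  qed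
  finally show "\<exists>C\<ge>0. (\<integral>\<^sup>+s. riesz s \<partial>L) \<le> ennreal C \<and>
      (\<forall>\<^sub>F N in sequentially. integrable (P N) (\<lambda>z. riesz_energy N \<beta> (configuration N z)) \<and>
        (LINT z|P N. riesz_energy N \<beta> (configuration N z)) \<le> C)"
    using C ev by blast
qed

definition limit_interaction :: "(real \<Rightarrow> real) \<Rightarrow> real \<Rightarrow> real" where
  "limit_interaction f' s = (LINT z|(\<rho> s \<Otimes>\<^sub>M \<rho> s). interaction_kernel \<alpha> f' z)"

text \<open>Finiteness of the Riesz integral at time \<open>s\<close> dominates the kernel, and
  integrating the pointwise truncation error leaves a power of the cutoff that tends to 0.\<close>

lemma
  assumes f: "test_function f f' C\<^sub>1 C\<^sub>2" and s: "0 \<le> s" and fin: "riesz s < \<infinity>"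
  shows interaction_kernel_integrable: "integrable (\<rho> s \<Otimes>\<^sub>M \<rho> s) (interaction_kernel \<alpha> f')"
    and limit_interaction_error: "\<bar>limit_interaction f' s - self_integral (test_function.truncated_kernel f' \<alpha> m) s\<bar>
      \<le> C\<^sub>2 * cutoff m powr (\<beta> + 1 - \<alpha>) * enn2real (riesz s)"
proof -
  interpret f: test_function f f' C\<^sub>1 C\<^sub>2 by (rule f)
  interpret prob_space "\<rho> s \<Otimes>\<^sub>M \<rho> s" by (rule pair_prob_\<rho>[OF s])
  have [measurable]: "(\<lambda>z. \<bar>fst z - snd z\<bar> powr (- \<beta>)) \<in> borel_measurable (\<rho> s \<Otimes>\<^sub>M \<rho> s)"
    by (rule measurable_\<rho>_pair[OF s]) measurable
  have r: "integrable (\<rho> s \<Otimes>\<^sub>M \<rho> s) (\<lambda>z. \<bar>fst z - snd z\<bar> powr (- \<beta>))"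
    using fin by (intro integrableI_nonneg) (auto simp: riesz_def)
  have rE: "(LINT z|(\<rho> s \<Otimes>\<^sub>M \<rho> s). \<bar>fst z - snd z\<bar> powr (- \<beta>)) = enn2real (riesz s)"
    unfolding riesz_def by (rule integral_eq_nn_integral) auto
  note km = measurable_\<rho>_pair[OF s f.interaction_kernel_measurable]
  show k: "integrable (\<rho> s \<Otimes>\<^sub>M \<rho> s) (interaction_kernel \<alpha> f')"
  proof (rule Bochner_Integration.integrable_bound[OF _ km])
    show "integrable (\<rho> s \<Otimes>\<^sub>M \<rho> s) (\<lambda>z. C\<^sub>2 * (\<bar>fst z - snd z\<bar> powr (- \<beta>) + 1))" using r by simp
    have "\<bar>interaction_kernel \<alpha> f' z\<bar> \<le> C\<^sub>2 * (\<bar>fst z - snd z\<bar> powr (- \<beta>) + 1)" for z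
      using f.abs_interaction_kernel_le_riesz[OF \<alpha>(1), of \<beta> "fst z" "snd z"] \<beta>(3) by simp
    then show "AE z in \<rho> s \<Otimes>\<^sub>M \<rho> s. norm (interaction_kernel \<alpha> f' z) \<le> norm (C\<^sub>2 * (\<bar>fst z - snd z\<bar> powr (- \<beta>) + 1))"
      by (auto intro!: AE_I2 order_trans[OF _ abs_ge_self])
  qed
  note t = self_integral_eq[OF f.truncated_kernel_measurable f.truncated_kernel_bound[OF \<alpha>(1)] s, of m]
  have "\<bar>limit_interaction f' s - self_integral (f.truncated_kernel \<alpha> m) s\<bar>
      = \<bar>LINT z|(\<rho> s \<Otimes>\<^sub>M \<rho> s). interaction_kernel \<alpha> f' z - f.truncated_kernel \<alpha> m (fst z) (snd z)\<bar>"
    unfolding limit_interaction_def t(2) using k t(1) by simp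
  also have "\<dots> \<le> (LINT z|(\<rho> s \<Otimes>\<^sub>M \<rho> s). \<bar>interaction_kernel \<alpha> f' z - f.truncated_kernel \<alpha> m (fst z) (snd z)\<bar>)"
    by (rule integral_abs_bound)
  also have "\<dots> \<le> (LINT z|(\<rho> s \<Otimes>\<^sub>M \<rho> s). C\<^sub>2 * cutoff m powr (\<beta> + 1 - \<alpha>) * \<bar>fst z - snd z\<bar> powr (- \<beta>))"
  proof (rule integral_mono)
    show "\<bar>interaction_kernel \<alpha> f' z - f.truncated_kernel \<alpha> m (fst z) (snd z)\<bar>
        \<le> C\<^sub>2 * cutoff m powr (\<beta> + 1 - \<alpha>) * \<bar>fst z - snd z\<bar> powr (- \<beta>)" for z
      using f.truncated_kernel_error[OF \<alpha>(1), of \<beta> "fst z" "snd z" m] \<beta>(3) by simp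
  qed (use k t(1) r in auto)
  also have "\<dots> = C\<^sub>2 * cutoff m powr (\<beta> + 1 - \<alpha>) * enn2real (riesz s)" by (simp add: rE)
  finally show "\<bar>limit_interaction f' s - self_integral (f.truncated_kernel \<alpha> m) s\<bar>
      \<le> C\<^sub>2 * cutoff m powr (\<beta> + 1 - \<alpha>) * enn2real (riesz s)" .
qed

text \<open>The limit of the truncated integrals is the Bochner integral only at times where the
  kernel is integrable. The supremum \<open>A\<close> of the absolute truncated integrals detects
  these times measurably.\<close>

lemma limit_interaction_measurable:
  assumes f: "test_function f f' C\<^sub>1 C\<^sub>2"
  shows "limit_interaction f' \<in> borel_measurable L"
proof -
  interpret f: test_function f f' C\<^sub>1 C\<^sub>2 by (rule f)
  define A where "A = (\<lambda>s. SUP m. ennreal (self_integral (\<lambda>x y. \<bar>f.truncated_kernel \<alpha> m x y\<bar>) s))"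
  have tm: "self_integral (f.truncated_kernel \<alpha> m) \<in> borel_measurable L" for m
    using f.truncated_kernel_pair_lipschitz[OF \<alpha>(1)] pair_mean_measurable_L by blast
  have am: "(\<lambda>z. \<bar>f.truncated_kernel \<alpha> m (fst z) (snd z)\<bar>) \<in> borel_measurable (borel \<Otimes>\<^sub>M borel)" for m
    using f.truncated_kernel_measurable by measurable
  have "(\<lambda>s. ennreal (self_integral (\<lambda>x y. \<bar>f.truncated_kernel \<alpha> m x y\<bar>) s)) \<in> borel_measurable L" for m
    using f.truncated_kernel_pair_lipschitz[OF \<alpha>(1), of m] pair_mean_measurable_L pair_lipschitz_abs
    by (intro measurable_compose[OF _ measurable_ennreal]) blast
  then have Am: "A \<in> borel_measurable L" unfolding A_def by (intro borel_measurable_SUP) auto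
  \<comment> \<open>The value 0 in the other case is the convention for a Bochner integral that does
    not exist.\<close>
  have "limit_interaction f' s = (if A s < \<infinity> then lim (\<lambda>m. self_integral (f.truncated_kernel \<alpha> m) s) else 0)"
    if "s \<in> space L" for s
  proof -
    have s: "0 \<le> s" using that by simp
    have A: "A s = (\<integral>\<^sup>+z. ennreal \<bar>interaction_kernel \<alpha> f' z\<bar> \<partial>(\<rho> s \<Otimes>\<^sub>M \<rho> s))"
      unfolding A_def
      by (rule nn_integral_increasing_pair[OF am, symmetric])
         (auto intro!: f.truncated_kernel_bound \<alpha>(1) f.abs_truncated_kernel_incseq tendsto_rabs f.truncated_kernel_tendsto s)
    note km = measurable_\<rho>_pair[OF s f.interaction_kernel_measurable]
    have int: "integrable (\<rho> s \<Otimes>\<^sub>M \<rho> s) (interaction_kernel \<alpha> f') \<longleftrightarrow> A s < \<infinity>"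
      using km by (simp add: integrable_iff_bounded A)
    show ?thesis
    proof (cases "A s < \<infinity>")
      case True
      note t = self_integral_eq[OF f.truncated_kernel_measurable f.truncated_kernel_bound[OF \<alpha>(1)] s]
      have "(\<lambda>m. LINT z|(\<rho> s \<Otimes>\<^sub>M \<rho> s). f.truncated_kernel \<alpha> m (fst z) (snd z)) \<longlonglongrightarrow> limit_interaction f' s"
        unfolding limit_interaction_def
      proof (rule integral_dominated_convergence[OF km])
        show "integrable (\<rho> s \<Otimes>\<^sub>M \<rho> s) (\<lambda>z. \<bar>interaction_kernel \<alpha> f' z\<bar>)" using True int by simp
        show "(\<lambda>z. f.truncated_kernel \<alpha> m (fst z) (snd z)) \<in> borel_measurable (\<rho> s \<Otimes>\<^sub>M \<rho> s)" for m
          by (rule measurable_\<rho>_pair[OF s f.truncated_kernel_measurable])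
        show "AE z in \<rho> s \<Otimes>\<^sub>M \<rho> s. (\<lambda>m. f.truncated_kernel \<alpha> m (fst z) (snd z)) \<longlonglongrightarrow> interaction_kernel \<alpha> f' z"
          using f.truncated_kernel_tendsto by (intro AE_I2) (metis prod.collapse)
        show "AE z in \<rho> s \<Otimes>\<^sub>M \<rho> s. norm (f.truncated_kernel \<alpha> m (fst z) (snd z)) \<le> \<bar>interaction_kernel \<alpha> f' z\<bar>" for m
          using f.abs_truncated_kernel_le[OF \<alpha>(1)] by (intro AE_I2) (metis prod.collapse real_norm_def)
      qed
      then have "(\<lambda>m. self_integral (f.truncated_kernel \<alpha> m) s) \<longlonglongrightarrow> limit_interaction f' s" by (simp add: t(2))
      then show ?thesis using True by (simp add: limI)
    next
      case False
      then show ?thesis using int by (simp add: limit_interaction_def not_integrable_integral_eq)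
    qed
  qed
  moreover have "(\<lambda>s. if A s < \<infinity> then lim (\<lambda>m. self_integral (f.truncated_kernel \<alpha> m) s) else 0) \<in> borel_measurable L"
  proof -
    have [measurable]: "(\<lambda>s. lim (\<lambda>m. self_integral (f.truncated_kernel \<alpha> m) s)) \<in> borel_measurable L"
      by (rule borel_measurable_lim_metric[OF tm])
    show ?thesis using Am by measurable
  qed
  ultimately show ?thesis by (rule measurable_cong[THEN iffD2])
qed

text \<open>First \<open>N\<close> tends to infinity at a fixed cutoff, then the cutoff tends to 0.
  The order is legitimate because the truncation error is bounded by the same \<open>C\<close> for
  the particle systems and for the limit.\<close>

lemma weak_limit:
  assumes f: "test_function f f' C\<^sub>1 C\<^sub>2"
    and fU: "C\<^sub>3-lipschitz_on UNIV (\<lambda>x. f' x * U' x)" "\<And>x. \<bar>f' x * U' x\<bar> \<le> C\<^sub>4"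
  shows "AE s in L. integrable (\<rho> s \<Otimes>\<^sub>M \<rho> s) (interaction_kernel \<alpha> f')"
    and "integrable L (limit_interaction f')"
    and "(LINT x|\<rho> T. f x) = (LINT x|\<rho> 0. f x) - (LINT s|L. LINT x|\<rho> s. f' x * U' x)
      + 1 / 2 * (LINT s|L. limit_interaction f' s)"
proof -
  interpret f: test_function f f' C\<^sub>1 C\<^sub>2 by (rule f)
  obtain C where C: "0 \<le> C" and rC: "(\<integral>\<^sup>+s. riesz s \<partial>L) \<le> ennreal C"
    and ev: "\<forall>\<^sub>F N in sequentially. integrable (P N) (\<lambda>z. riesz_energy N \<beta> (configuration N z)) \<and>
        (LINT z|P N. riesz_energy N \<beta> (configuration N z)) \<le> C"
    using riesz_limit(2) by blast
  define \<eta> where "\<eta> = \<beta> + 1 - \<alpha>"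
  have \<eta>: "0 < \<eta>" using \<beta>(3) by (simp add: \<eta>_def)
  define k where "k = (\<lambda>m. f.truncated_kernel \<alpha> m)"
  define b where "b = (\<lambda>m. C\<^sub>2 * cutoff m powr \<eta> * C)"
  note rm = riesz_limit(1)
  have fin: "AE s in L. riesz s < \<infinity>"
  proof -
    have "(\<integral>\<^sup>+s. riesz s \<partial>L) \<noteq> \<infinity>" using rC by (auto simp: top_unique)
    from nn_integral_PInf_AE[OF rm this] show ?thesis by (simp add: less_top)
  qed
  have pos: "AE s in L. 0 \<le> s" by (rule AE_I2) simp
  show "AE s in L. integrable (\<rho> s \<Otimes>\<^sub>M \<rho> s) (interaction_kernel \<alpha> f')"
    using fin pos by eventually_elim (rule interaction_kernel_integrable[OF f])
  have r: "integrable L (\<lambda>s. enn2real (riesz s))" "(LINT s|L. enn2real (riesz s)) \<le> C"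
  proof -
    have e: "(\<integral>\<^sup>+s. ennreal (enn2real (riesz s)) \<partial>L) = (\<integral>\<^sup>+s. riesz s \<partial>L)"
      using fin by (intro nn_integral_cong_AE) (auto elim!: eventually_mono)
    show i: "integrable L (\<lambda>s. enn2real (riesz s))"
      using rm rC e by (intro integrableI_nonneg) (auto intro: le_less_trans)
    have "ennreal (LINT s|L. enn2real (riesz s)) \<le> ennreal C"
      using rC e by (subst nn_integral_eq_integral[OF i, symmetric]) auto
    then show "(LINT s|L. enn2real (riesz s)) \<le> C" using C by (simp add: ennreal_le_iff)
  qed
  obtain D where D: "\<And>m. pair_lipschitz (D m) (k m)"
    using f.truncated_kernel_pair_lipschitz[OF \<alpha>(1)] unfolding k_def by metis
  note km = f.truncated_kernel_measurable[of \<alpha>, folded k_def] and kb = f.truncated_kernel_bound[OF \<alpha>(1), folded k_def]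
  have ki: "integrable L (self_integral (k m))" for m by (rule self_integral_integrable_L[OF D km kb])
  have err: "AE s in L. \<bar>limit_interaction f' s - self_integral (k m) s\<bar> \<le> C\<^sub>2 * cutoff m powr \<eta> * enn2real (riesz s)" for m
    using fin pos by eventually_elim (simp add: k_def \<eta>_def limit_interaction_error[OF f])
  show li: "integrable L (limit_interaction f')"
  proof (rule Bochner_Integration.integrable_bound[OF _ limit_interaction_measurable[OF f]])
    show "integrable L (\<lambda>s. \<bar>self_integral (k 0) s\<bar> + C\<^sub>2 * cutoff 0 powr \<eta> * enn2real (riesz s))"
      using ki r by simp
    show "AE s in L. norm (limit_interaction f' s) \<le> norm (\<bar>self_integral (k 0) s\<bar> + C\<^sub>2 * cutoff 0 powr \<eta> * enn2real (riesz s))"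
      using err[of 0] by eventually_elim auto
  qed
  \<comment> \<open>The defect of the weak equation when the interaction integral is given the value
    \<open>j\<close>.\<close>
  define E where "E = (\<lambda>j. (LINT x|\<rho> T. f x) - (LINT x|\<rho> 0. f x) + (LINT s|L. LINT x|\<rho> s. f' x * U' x) - 1 / 2 * j)"
  \<comment> \<open>The noise error vanishes with \<open>\<sigma> N\<close>; what survives is the
    truncation error of the particle systems.\<close>
  have E_m: "\<bar>E (LINT s|L. self_integral (k m) s)\<bar> \<le> 1 / 2 * b m" for m
  proof -
    define e where "e = (\<lambda>N. (LINT \<omega>|M N. (\<Sum>i = 1..N. f (X N i T \<omega>)) / N) - (LINT \<omega>|M N. (\<Sum>i = 1..N. f (X N i 0 \<omega>)) / N)
      + (LINT z|P N. (\<Sum>i = 1..N. f' (configuration N z i) * U' (configuration N z i)) / N)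
      - 1 / 2 * (LINT z|P N. pair_mean N (k m) (configuration N z)))"
    have "e \<longlonglongrightarrow> E (LINT s|L. self_integral (k m) s)"
      unfolding e_def E_def
      by (intro tendsto_intros mean_tendsto[OF f.lipschitz_on_f T] mean_tendsto[OF f.lipschitz_on_f order_refl]
          mean_time_integral_tendsto[OF fU] pair_mean_time_integral_tendsto[OF D km kb])
    then have "(\<lambda>N. \<bar>e N\<bar>) \<longlonglongrightarrow> \<bar>E (LINT s|L. self_integral (k m) s)\<bar>" by (rule tendsto_rabs)
    moreover have "(\<lambda>N. 2 * C\<^sub>2 * \<sigma> N * T + 1 / 2 * b m) \<longlonglongrightarrow> 2 * C\<^sub>2 * 0 * T + 1 / 2 * b m"
      by (intro tendsto_intros \<sigma>_lim)
    moreover have "\<forall>\<^sub>F N in sequentially. \<bar>e N\<bar> \<le> 2 * C\<^sub>2 * \<sigma> N * T + 1 / 2 * b m"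
      using ev eventually_on_system pair_mean_integrable[OF D km kb, of m]
    proof eventually_elim
      case (elim N)
      interpret S: regular_solution_on "M N" N \<alpha> "\<sigma> N" K U' "X N" "B N" T using elim by simp
      have point: "\<bar>S.interaction f' z - pair_mean N (k m) (configuration N z)\<bar>
          \<le> C\<^sub>2 * cutoff m powr \<eta> * riesz_energy N \<beta> (configuration N z)" for z
      proof -
        let ?x = "configuration N z"
        have "\<bar>\<Sum>i = 1..N. \<Sum>j = 1..N. interaction_kernel \<alpha> f' (?x i, ?x j) - k m (?x i) (?x j)\<bar>
            \<le> (\<Sum>i = 1..N. \<Sum>j = 1..N. C\<^sub>2 * cutoff m powr \<eta> * \<bar>?x i - ?x j\<bar> powr (- \<beta>))"
          unfolding k_def \<eta>_def
          by (rule order_trans[OF sum_abs sum_mono], rule order_trans[OF sum_abs sum_mono],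
              rule f.truncated_kernel_error[OF \<alpha>(1)]) (use \<beta>(3) in simp)
        then have "\<bar>\<Sum>i = 1..N. \<Sum>j = 1..N. interaction_kernel \<alpha> f' (?x i, ?x j) - k m (?x i) (?x j)\<bar> / (real N)\<^sup>2
            \<le> (\<Sum>i = 1..N. \<Sum>j = 1..N. C\<^sub>2 * cutoff m powr \<eta> * \<bar>?x i - ?x j\<bar> powr (- \<beta>)) / (real N)\<^sup>2"
          by (rule divide_right_mono) simp
        then show ?thesis
          by (simp add: S.interaction_def riesz_energy_def sum_subtractf sum_distrib_left[symmetric]
              diff_divide_distrib[symmetric] abs_divide)
      qed
      have "\<bar>(LINT z|P N. S.interaction f' z) - (LINT z|P N. pair_mean N (k m) (configuration N z))\<bar>
          = \<bar>LINT z|P N. S.interaction f' z - pair_mean N (k m) (configuration N z)\<bar>"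
        using S.interaction_integrable[OF f] elim(3) by simp
      also have "\<dots> \<le> (LINT z|P N. \<bar>S.interaction f' z - pair_mean N (k m) (configuration N z)\<bar>)"
        by (rule integral_abs_bound)
      also have "\<dots> \<le> (LINT z|P N. C\<^sub>2 * cutoff m powr \<eta> * riesz_energy N \<beta> (configuration N z))"
        using S.interaction_integrable[OF f] elim(1,3) point
        by (intro integral_mono integrable_abs Bochner_Integration.integrable_diff integrable_mult_right) auto
      also have "\<dots> \<le> b m"
        using elim(1) f.C\<^sub>2_nonneg by (simp add: b_def mult_left_mono)
      finally have "\<bar>(LINT z|P N. S.interaction f' z) - (LINT z|P N. pair_mean N (k m) (configuration N z))\<bar> \<le> b m" .
      moreover have "S.confinement f' = (\<lambda>z. (\<Sum>i = 1..N. f' (configuration N z i) * U' (configuration N z i)) / N)"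
        by (simp add: S.confinement_def[abs_def])
      ultimately show ?case
        using S.weak_form_error[OF f] unfolding e_def by (simp add: abs_le_iff)
    qed
    ultimately show ?thesis
      using tendsto_le[OF sequentially_bot, of "\<lambda>N. 2 * C\<^sub>2 * \<sigma> N * T + 1 / 2 * b m"] by fastforce
  qed
  have J_m: "\<bar>(LINT s|L. limit_interaction f' s) - (LINT s|L. self_integral (k m) s)\<bar> \<le> b m" for m
  proof -
    have "\<bar>(LINT s|L. limit_interaction f' s) - (LINT s|L. self_integral (k m) s)\<bar>
        = \<bar>LINT s|L. limit_interaction f' s - self_integral (k m) s\<bar>" using li ki by simp
    also have "\<dots> \<le> (LINT s|L. \<bar>limit_interaction f' s - self_integral (k m) s\<bar>)" by (rule integral_abs_bound)
    also have "\<dots> \<le> (LINT s|L. C\<^sub>2 * cutoff m powr \<eta> * enn2real (riesz s))"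
      using li ki r(1) err by (intro integral_mono_AE) auto
    also have "\<dots> \<le> b m" using r(2) f.C\<^sub>2_nonneg by (simp add: b_def mult_left_mono)
    finally show ?thesis .
  qed
  \<comment> \<open>Half of \<open>b m\<close> comes from truncating the particle systems and half
    from truncating the limit, whose interaction enters \<open>E\<close> with the factor
    1/2.\<close>
  have le: "\<bar>E (LINT s|L. limit_interaction f' s)\<bar> \<le> b m" for m
    using E_m[of m] J_m[of m] unfolding E_def by linarith
  have "(\<lambda>m. cutoff m powr \<eta>) \<longlonglongrightarrow> 0"
    by (rule tendsto_zero_powrI[OF cutoff_tendsto tendsto_const _ \<eta>]) (simp add: less_imp_le cutoff_pos)
  then have "b \<longlonglongrightarrow> C\<^sub>2 * 0 * C" unfolding b_def by (intro tendsto_intros)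
  then have "\<bar>E (LINT s|L. limit_interaction f' s)\<bar> \<le> C\<^sub>2 * 0 * C"
    using le by (intro LIMSEQ_le_const) auto
  then show "(LINT x|\<rho> T. f x) = (LINT x|\<rho> 0. f x) - (LINT s|L. LINT x|\<rho> s. f' x * U' x)
      + 1 / 2 * (LINT s|L. limit_interaction f' s)"
    by (simp add: E_def)
qed

end

text \<open>Both alternatives bound the second derivative: it is the constant \<open>c\<close> in
  the quadratic case, and bounded by hypothesis in the other. This unifies the two cases for the
  rest of the proof.\<close>

lemma confinement_lipschitz:
  fixes U U' U'' :: "real \<Rightarrow> real"
  assumes U: "C2_with U U' U''"
    and cases: "(1 < \<alpha> \<and> \<alpha> < 2 \<and> (\<exists>c>0. \<forall>x. U x = c / 2 * x\<^sup>2)) \<or>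
                (\<alpha> = 1 \<and> bdd_above (range (\<lambda>x. \<bar>U'' x\<bar>)))"
  shows "\<exists>K\<ge>0. \<forall>a b. \<bar>U' a - U' b\<bar> \<le> K * \<bar>a - b\<bar>"
proof -
  have d: "(U has_real_derivative U' x) (at x)" and d': "(U' has_real_derivative U'' x) (at x)" for x
    using U by (auto simp: C2_with_def)
  from cases show ?thesis
  proof (elim disjE conjE exE)
    fix c :: real assume c: "0 < c" and quad: "\<forall>x. U x = c / 2 * x\<^sup>2"
    have "U' x = c * x" for x
    proof (rule DERIV_unique[OF d])
      have "U = (\<lambda>x. c / 2 * x\<^sup>2)" using quad by auto
      then show "(U has_real_derivative c * x) (at x)"
        by (auto intro!: derivative_eq_intros)
    qed
    then have "\<bar>U' a - U' b\<bar> \<le> c * \<bar>a - b\<bar>" for a b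
      using c by (simp add: right_diff_distrib[symmetric] abs_mult)
    then show ?thesis using c by (intro exI[of _ c]) auto
  next
    assume "bdd_above (range (\<lambda>x. \<bar>U'' x\<bar>))"
    then obtain K where K: "\<And>x. \<bar>U'' x\<bar> \<le> K" by (auto simp: bdd_above_def)
    have K0: "0 \<le> K" using K[of 0] by linarith
    have "norm (U' a - U' b) \<le> K * norm (a - b)" for a b
      by (rule field_differentiable_bound[of UNIV U' U'']) (use d' K in auto)
    then show ?thesis using K0 by auto
  qed
qed

theorem theorem5:
  fixes U U' U'' :: "real \<Rightarrow> real" and \<alpha> :: real and \<sigma> :: "nat \<Rightarrow> real"
    and M :: "nat \<Rightarrow> 'a measure" and F :: "nat \<Rightarrow> real \<Rightarrow> 'a measure"
    and B X :: "nat \<Rightarrow> nat \<Rightarrow> real \<Rightarrow> 'a \<Rightarrow> real"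
    and \<rho> :: "real \<Rightarrow> real measure"
    and f f' f'' :: "real \<Rightarrow> real" and t :: real
  assumes U: "C2_with U U' U''"
    and \<alpha>: "1 \<le> \<alpha>" "\<alpha> < 2"
    and \<sigma>: "\<And>N. 0 \<le> \<sigma> N" "\<sigma> \<longlonglongrightarrow> 0"
    and cases: "(1 < \<alpha> \<and> \<alpha> < 2 \<and> (\<exists>c>0. \<forall>x. U x = c / 2 * x\<^sup>2)) \<or>
                (\<alpha> = 1 \<and> bdd_above (range (\<lambda>x. \<bar>U'' x\<bar>)))"
    and sol: "\<And>N. 2 \<le> N \<Longrightarrow> solution \<alpha> U' (\<sigma> N) N (M N) (F N) (B N) (X N)"
    and \<rho>_P2: "\<And>t. 0 \<le> t \<Longrightarrow> \<rho> t \<in> P2"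
    and \<rho>_cont: "\<And>t. 0 \<le> t \<Longrightarrow> ((\<lambda>s. W2 (\<rho> s) (\<rho> t)) \<longlongrightarrow> 0) (at t within {0..})"
    and init: "(\<lambda>N. \<integral>\<^sup>+\<omega>. ennreal ((W2 (empirical N (\<lambda>i. X N i 0 \<omega>)) (\<rho> 0))\<^sup>2) \<partial>M N) \<longlonglongrightarrow> 0"
    and lim: "\<And>t. 0 \<le> t \<Longrightarrow>
                (\<lambda>N. \<integral>\<^sup>+\<omega>. ennreal (W2 (empirical N (\<lambda>i. X N i t \<omega>)) (\<rho> t)) \<partial>M N) \<longlonglongrightarrow> 0"
    and f: "C2_with f f' f''" "bounded (range f')" "bounded (range f'')"
    and f_lipschitz: "lipschitz f" "lipschitz f'" "lipschitz (\<lambda>x. f' x * U' x)" "lipschitz f''"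
    and f'U'_bounded: "bounded (range (\<lambda>x. f' x * U' x))"
    and t: "0 \<le> t"
  shows "(AE s in lborel. s \<in> {0..t} \<longrightarrow>
            set_integrable (\<rho> s \<Otimes>\<^sub>M \<rho> s) off_diagonal (interaction_kernel \<alpha> f')) \<and>
         set_integrable lborel {0..t}
           (\<lambda>s. LINT z:off_diagonal|\<rho> s \<Otimes>\<^sub>M \<rho> s. interaction_kernel \<alpha> f' z) \<and>
         (LINT x|\<rho> t. f x) = (LINT x|\<rho> 0. f x)
           - (LBINT s:{0..t}. LINT x|\<rho> s. f' x * U' x)
           + 1 / 2 * (LBINT s:{0..t}. LINT z:off_diagonal|\<rho> s \<Otimes>\<^sub>M \<rho> s. interaction_kernel \<alpha> f' z)"
proof -
  obtain K where K: "0 \<le> K" "\<And>a b. \<bar>U' a - U' b\<bar> \<le> K * \<bar>a - b\<bar>"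
    using confinement_lipschitz[OF U cases] by blast
  have "\<forall>N. \<exists>X' B'. 2 \<le> N \<longrightarrow> regular_solution (M N) N \<alpha> (\<sigma> N) K U' X' B' \<and>
      (AE \<omega> in M N. \<forall>i t. X' i t \<omega> = X N i t \<omega>)"
    using solution_regular_version[OF sol _ \<sigma>(1) K] by blast
  from choice[OF this] obtain X' where "\<forall>N. \<exists>B'. 2 \<le> N \<longrightarrow> regular_solution (M N) N \<alpha> (\<sigma> N) K U' (X' N) B' \<and>
      (AE \<omega> in M N. \<forall>i t. X' N i t \<omega> = X N i t \<omega>)" by blast
  from choice[OF this] obtain B' where reg: "\<And>N. 2 \<le> N \<Longrightarrow> regular_solution (M N) N \<alpha> (\<sigma> N) K U' (X' N) (B' N)"
    and eq: "\<And>N. 2 \<le> N \<Longrightarrow> AE \<omega> in M N. \<forall>i t. X' N i t \<omega> = X N i t \<omega>"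
    by blast
  \<comment> \<open>The convergence carries over to the regular versions, because both empirical
    measures agree at every time off a null set.\<close>
  have lim': "(\<lambda>N. \<integral>\<^sup>+\<omega>. ennreal (W2 (empirical N (\<lambda>i. X' N i s \<omega>)) (\<rho> s)) \<partial>M N) \<longlonglongrightarrow> 0" if "0 \<le> s" for s
    using lim[OF that]
  proof (rule Lim_transform_eventually)
    show "\<forall>\<^sub>F N in sequentially. (\<integral>\<^sup>+\<omega>. ennreal (W2 (empirical N (\<lambda>i. X N i s \<omega>)) (\<rho> s)) \<partial>M N)
        = (\<integral>\<^sup>+\<omega>. ennreal (W2 (empirical N (\<lambda>i. X' N i s \<omega>)) (\<rho> s)) \<partial>M N)"
      using eventually_ge_at_top[of 2]
    proof eventually_elim
      case (elim N)
      show ?case using eq[OF elim] by (intro nn_integral_cong_AE) (auto elim!: eventually_mono)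
    qed
  qed
  interpret mean_field_limit M \<alpha> K U' \<sigma> X' B' \<rho> t
    by (rule mean_field_limit.intro[OF reg \<alpha> \<sigma>(2) \<rho>_P2 \<rho>_cont lim' t])
  obtain C\<^sub>1 where C1: "\<And>x. \<bar>f' x\<bar> \<le> C\<^sub>1" using f(2) by (auto simp: bounded_iff)
  obtain C\<^sub>2 where C2: "C\<^sub>2-lipschitz_on UNIV f'" using f_lipschitz(2) by (auto simp: lipschitz_def)
  obtain C\<^sub>3 where C3: "C\<^sub>3-lipschitz_on UNIV (\<lambda>x. f' x * U' x)" using f_lipschitz(3) by (auto simp: lipschitz_def)
  obtain C\<^sub>4 where C4: "\<And>x. \<bar>f' x * U' x\<bar> \<le> C\<^sub>4" using f'U'_bounded by (auto simp: bounded_iff)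
  have test: "test_function f f' C\<^sub>1 C\<^sub>2"
    using f(1) C1 lipschitz_onD[OF C2] by unfold_locales (auto simp: C2_with_def dist_real_def)
  note W = weak_limit[OF test C3 C4]
  \<comment> \<open>On the diagonal the kernel is 0 by the convention for division, so restricting
    the integral to the complement changes nothing.\<close>
  have off: "indicator off_diagonal z *\<^sub>R interaction_kernel \<alpha> f' z = interaction_kernel \<alpha> f' z" for z
    by (cases z) (auto simp: off_diagonal_def interaction_kernel_def indicator_def)
  have J: "(LINT z:off_diagonal|(\<rho> s \<Otimes>\<^sub>M \<rho> s). interaction_kernel \<alpha> f' z) = limit_interaction f' s" for s
    unfolding set_lebesgue_integral_def limit_interaction_def off ..
  have i: "set_integrable (\<rho> s \<Otimes>\<^sub>M \<rho> s) off_diagonal (interaction_kernel \<alpha> f')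
      \<longleftrightarrow> integrable (\<rho> s \<Otimes>\<^sub>M \<rho> s) (interaction_kernel \<alpha> f')" for s
    unfolding set_integrable_def off ..
  have L: "(LINT s|L. g s) = (LBINT s:{0..t}. g s)" for g :: "real \<Rightarrow> real"
    by (simp add: set_lebesgue_integral_def integral_restrict_space)
  show ?thesis
    using W unfolding J i L by (simp add: AE_restrict_space_iff set_integrable_eq)
qed

end
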